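(* Let $X$ be an ultrametric space satisfying the regularity properties (1)–(3) (given in the context), let $\nu$ be a measure on $X$ for which the measures of all balls are positive, and let $T$ be a positive pseudodifferential operator on this space of the form $$Tf(x)=\int_X T(\sup(x,y))\,(f(x)-f(y))\,d\nu(y).$$ Assume that both the series $$\sum_{J>R}T(J)\,\bigl(\nu(J)-\nu(J-1,R)\bigr)\qquad\text{and}\qquad \sum_{I>R}\lambda_I^{-2}\bigl(\nu^{-1}(I-1,R)-\nu^{-1}(I)\bigr)$$ converge for fixed vertex $R$ of the tree of balls $\mathcal{T}(X)$, where $$\lambda_I=T(I)\nu(I)+\sum_{J>I}T(J)\bigl(\nu(J)-\nu(J-1,I)\bigr).$$ Let $\phi(x)$ be white noise on $X$. Then the solution $\psi$ of the stochastic pseudodifferential equation $$T\psi(x)=\phi(x)$$ is a Gaussian mean zero random field with covariation $$\langle\overline{\psi(x)}\psi(x')\rangle=-\lambda^{-2}_{\sup(x,x')}\,\nu^{-1}(\sup(x,x'))+\sum_{I>\sup(x,x')}\lambda_I^{-2}\Bigl(\nu^{-1}(I-1,\sup(x,x'))-\nu^{-1}(I)\Bigr).$$ The corresponding Gaussian measure is $\sigma$-additive on the $\sigma$-algebra of weak Borel subsets of the space of distributions $D'(X)$.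
   Context: **Space.** An ultrametric space is a metric space $X$ whose distance $|xy|$ satisfies $|xy|\le\max(|xz|,|yz|)$ for all $z$. The regularity properties are: (1) the set of all balls of nonzero diameter in $X$ is no more than countable; (2) for any (infinite, strictly) decreasing sequence of balls $D^{(k)}\supset D^{(k+1)}$ the diameters tend to zero; (3) any ball is a finite union of maximal subballs. **Tree.** $\mathcal{T}(X)$ is the set of all balls of nonzero diameter in $X$ together with the balls of zero diameter that are maximal subballs of balls of nonzero diameter, ordered by inclusion; it is a directed tree and its elements are called vertices. For a non-minimal vertex $I$, $p_I$ is the number of maximal subballs of $I$. For points $x,y\in X$, $\sup(x,y)$ is the minimal ball containing both. For $J>I$, $(J-1,I)$ is the maximal vertex which is less than $J$ and larger than (or equal to) $I$; $\nu(J-1,I)$ is its measure, and $\nu^{-1}(\cdot)=1/\nu(\cdot)$. Sums over $J>I$ run over the increasing path in the tree of balls strictly containing $I$. **Measure and operator.** $\nu$ is a $\sigma$-additive Borel measure with countable or finite basis such that $\nu(D)$ is a positive number for every ball $D$. $T(I)$ is a nonnegative function on $\mathcal{T}(X)$. **Wavelets.** For non-minimal $I$, $V^0_I$ is the space of linear combinations of characteristic functions of the maximal subballs of $I$ with zero mean with respect to $\nu$, and $\{\Psi_{Ij}\}$, $j=1,\dots,p_I-1$, is an orthonormal basis of $V_I^0$ in $L^2(X,\nu)$. The functions $\Psi_{Ij}$, for all non-minimal $I$, are the ultrametric wavelets; $T\Psi_{Ij}=\lambda_I\Psi_{Ij}$. **Test functions and distributions.** $D(X)$ is the space of complex-valued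 locally constant functions on $X$ with compact support. It carries the topology of the inductive limit of the finite-dimensional spaces $D(\mathcal S)$, where $D(\mathcal S)$ is the linear span of the characteristic functions of the balls $J\in\mathcal S$, and $\mathcal S$ runs over the finite directed subtrees of $\mathcal{T}(X)$ such that whenever $\mathcal S$ contains $I$ and one maximal subball of $I$, it contains all maximal subballs of $I$. $D'(X)$ is the space of linear functionals on $D(X)$ with the weak topology. **White noise and solution.** White noise $\phi$ is the generalized Gaussian real-valued random field on $X$ with mean zero and covariation $\langle\phi(x)\phi(x')\rangle=\delta(x-x')$, the $\delta$-function being understood in the sense of distributions. It is expanded as $\phi=\sum_{I,j}d_{Ij}\Psi_{Ij}$, $d_{Ij}=\int_X\phi(x)\overline{\Psi_{Ij}(x)}\,d\nu(x)$, and the solution of $T\psi=\phi$ is $\psi=T^{-1}\phi=\sum_{I,j}\lambda_I^{-1}d_{Ij}\Psi_{Ij}$. The corresponding Gaussian measure is the mean zero Gaussian measure on $D'(X)$ determined by the covariation of $\psi$.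
   Formalization: The covariation formula, wrong or undefined on the diagonal x = x' (a delta term or an isolated point), is stated pointwise for x ≠ x' and for disjoint supports; across the diagonal the covariation is the distributional sum of its kernels over non-minimal balls I. *)

theory Defs
  imports "HOL-Probability.Probability"
begin

section \<open>Balls and the tree of balls\<close>

text \<open>
  Radii are positive, so a ball of diameter zero is an isolated point. (If every singleton
  counted as a ball, positivity of the measure on all balls would make every point an atom.)
  In a space with the regularity properties below, open and closed balls of positive
  radius are the same sets.
\<close>

definition is_ball :: "'a::metric_space set \<Rightarrow> bool" where
  "is_ball D \<longleftrightarrow> (\<exists>x r. 0 < r \<and> D = cball x r)"

definition max_subballs :: "'a::metric_space set \<Rightarrow> 'a set set" where
  "max_subballs I =
     {M. is_ball M \<and> M \<subset> I \<and> \<not> (\<exists>K. is_ball K \<and> M \<subset> K \<and> K \<subset> I)}"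

text \<open>Property (3) can only concern balls of nonzero diameter: a one-point ball has no proper subballs.\<close>

definition regular_balls :: "'a::metric_space itself \<Rightarrow> bool" where
  "regular_balls _ \<longleftrightarrow>
     countable {D :: 'a set. is_ball D \<and> diameter D \<noteq> 0} \<and>
     (\<forall>D :: nat \<Rightarrow> 'a set. (\<forall>k. is_ball (D k) \<and> D (Suc k) \<subset> D k)
        \<longrightarrow> (\<lambda>k. diameter (D k)) \<longlonglongrightarrow> 0) \<and>
     (\<forall>D :: 'a set. is_ball D \<and> diameter D \<noteq> 0
        \<longrightarrow> (\<exists>F. finite F \<and> F \<subseteq> max_subballs D \<and> D = \<Union>F))"

definition ball_tree :: "'a::metric_space set set" where
  "ball_tree = {D. is_ball D \<and> diameter D \<noteq> 0}
     \<union> {D. is_ball D \<and> diameter D = 0 \<and>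
            (\<exists>I. is_ball I \<and> diameter I \<noteq> 0 \<and> D \<in> max_subballs I)}"

definition nonminimal :: "'a::metric_space set set" where
  "nonminimal = {I \<in> ball_tree. \<exists>J\<in>ball_tree. J \<subset> I}"

text \<open>
  The minimal ball containing both points when \<open>x \<noteq> y\<close>, and the one-point set
  when \<open>x = y\<close>; the latter is a vertex if the point is isolated and otherwise
  the end of an infinite decreasing path.
\<close>

definition sup_ball :: "'a::metric_space \<Rightarrow> 'a \<Rightarrow> 'a set" where
  "sup_ball x y = \<Inter>{D. is_ball D \<and> x \<in> D \<and> y \<in> D}"

text \<open>The vertex \<open>(J-1,I)\<close>; the order is inclusion.\<close>

definition pred_vertex :: "'a::metric_space set \<Rightarrow> 'a set \<Rightarrow> 'a set" where
  "pred_vertex J I = (GREATEST M. M \<in> ball_tree \<and> M \<subset> J \<and> I \<subseteq> M)"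

section \<open>The measure and the operator\<close>

text \<open>A basis of a measure approximates every set of finite measure up to arbitrarily small measure.\<close>

definition has_countable_basis :: "'a measure \<Rightarrow> bool" where
  "has_countable_basis \<nu> \<longleftrightarrow>
     (\<exists>\<B>. countable \<B> \<and> \<B> \<subseteq> sets \<nu> \<and>
        (\<forall>A\<in>sets \<nu>. emeasure \<nu> A < \<infinity> \<longrightarrow>
           (\<forall>e>0. \<exists>B\<in>\<B>. emeasure \<nu> ((A - B) \<union> (B - A)) < e)))"

definition psd_op ::
  "'a::metric_space measure \<Rightarrow> ('a set \<Rightarrow> real) \<Rightarrow> ('a \<Rightarrow> complex) \<Rightarrow> 'a \<Rightarrow> complex" where
  "psd_op \<nu> T f x = (\<integral>y. complex_of_real (T (sup_ball x y)) * (f x - f y) \<partial>\<nu>)"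

definition psd_eigenvalue ::
  "'a::metric_space measure \<Rightarrow> ('a set \<Rightarrow> real) \<Rightarrow> 'a set \<Rightarrow> real" where
  "psd_eigenvalue \<nu> T I = T I * measure \<nu> I
     + (\<Sum>\<^sub>\<infinity>J\<in>{J\<in>ball_tree. I \<subset> J}. T J * (measure \<nu> J - measure \<nu> (pred_vertex J I)))"

section \<open>Wavelets\<close>

definition wavelet_space ::
  "'a::metric_space measure \<Rightarrow> 'a set \<Rightarrow> ('a \<Rightarrow> complex) set" where
  "wavelet_space \<nu> I =
     {f. (\<exists>c. f = (\<lambda>x. \<Sum>M\<in>max_subballs I. c M * indicator M x)) \<and> (\<integral>x. f x \<partial>\<nu>) = 0}"

definition wavelet_index :: "('a::metric_space set \<times> nat) set" where
  "wavelet_index = (SIGMA I:nonminimal. {1..card (max_subballs I) - 1})"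

definition wavelet_basis ::
  "'a::metric_space measure \<Rightarrow> ('a set \<Rightarrow> nat \<Rightarrow> 'a \<Rightarrow> complex) \<Rightarrow> bool" where
  "wavelet_basis \<nu> \<Psi> \<longleftrightarrow>
     (\<forall>I\<in>nonminimal.
        (\<forall>j\<in>{1..card (max_subballs I) - 1}. \<Psi> I j \<in> wavelet_space \<nu> I) \<and>
        (\<forall>j\<in>{1..card (max_subballs I) - 1}. \<forall>k\<in>{1..card (max_subballs I) - 1}.
           (\<integral>x. cnj (\<Psi> I j x) * \<Psi> I k x \<partial>\<nu>) = (if j = k then 1 else 0)) \<and>
        (\<forall>f\<in>wavelet_space \<nu> I. \<exists>c.
           f = (\<lambda>x. \<Sum>j = 1..card (max_subballs I) - 1. c j * \<Psi> I j x)))"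

section \<open>Test functions and distributions\<close>

definition full_subtree :: "'a::metric_space set set \<Rightarrow> bool" where
  "full_subtree S \<longleftrightarrow>
     finite S \<and> S \<subseteq> ball_tree \<and>
     (\<forall>I\<in>S. \<forall>J\<in>S. \<exists>K\<in>S. I \<subseteq> K \<and> J \<subseteq> K) \<and>
     (\<forall>I\<in>S. \<forall>J\<in>S. \<forall>K\<in>ball_tree. I \<subseteq> K \<and> K \<subseteq> J \<longrightarrow> K \<in> S) \<and>
     (\<forall>I\<in>S. max_subballs I \<inter> S \<noteq> {} \<longrightarrow> max_subballs I \<subseteq> S)"

definition subtree_functions :: "'a::metric_space set set \<Rightarrow> ('a \<Rightarrow> complex) set" where
  "subtree_functions S = {f. \<exists>c. f = (\<lambda>x. \<Sum>J\<in>S. c J * indicator J x)}"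

definition test_functions :: "('a::metric_space \<Rightarrow> complex) set" where
  "test_functions = (\<Union>S\<in>{S. full_subtree S}. subtree_functions S)"

text \<open>
  When balls are compact, the union of the spaces \<open>subtree_functions S\<close> is the space of
  compactly supported locally constant functions.
\<close>

context
  assumes ultra: "\<And>x y z :: 'a::metric_space. dist x y \<le> max (dist x z) (dist y z)"
    and reg: "regular_balls TYPE('a)"
begin

lemma cball_recentre:
  fixes x y :: 'a
  assumes "y \<in> cball x r"
  shows "cball y r = cball x r"
proof (rule set_eqI)
  fix z
  show "z \<in> cball y r \<longleftrightarrow> z \<in> cball x r"
    using assms ultra[of y z x] ultra[of x z y] by (auto simp: dist_commute)
qed

lemma balls_nested:
  fixes D E :: "'a set"
  assumes "is_ball D" "is_ball E" "D \<inter> E \<noteq> {}"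
  shows "D \<subseteq> E \<or> E \<subseteq> D"
proof -
  obtain z where z: "z \<in> D" "z \<in> E" using assms(3) by blast
  obtain r where r: "D = cball z r" using assms(1) z cball_recentre unfolding is_ball_def by metis
  obtain s where s: "E = cball z s" using assms(2) z cball_recentre unfolding is_ball_def by metis
  show ?thesis
  proof (cases "r \<le> s")
    case True
    then show ?thesis unfolding r s by auto
  next
    case False
    then show ?thesis unfolding r s by auto
  qed
qed

lemma ball_props:
  fixes D :: "'a set"
  assumes "is_ball D"
  shows "D \<noteq> {}" "open D" "closed D" "bounded D"
proof -
  obtain x r where D: "0 < r" "D = cball x r" using assms unfolding is_ball_def by blast
  show "D \<noteq> {}" "closed D" "bounded D" using D by auto
  show "open D"
  proof (rule openI)
    fix y assume "y \<in> D"
    then have "cball y r = D" using cball_recentre D by blast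
    then show "\<exists>e>0. ball y e \<subseteq> D" using D(1) ball_subset_cball by blast
  qed
qed

lemma diameter_zero_ball:
  fixes D :: "'a set"
  assumes "is_ball D" "diameter D = 0" "x \<in> D"
  shows "D = {x}"
proof -
  have "y = x" if "y \<in> D" for y
    using diameter_bounded_bound[OF ball_props(4)[OF assms(1)] that assms(3)] assms(2) by simp
  then show ?thesis using assms(3) by blast
qed

lemma diameter_nonzero:
  fixes D :: "'a set"
  assumes "is_ball D" "I \<subset> D" "I \<noteq> {}"
  shows "diameter D \<noteq> 0"
proof
  assume z: "diameter D = 0"
  obtain x where "x \<in> I" using assms(3) by blast
  then have "D = {x}" using diameter_zero_ball[OF assms(1) z] assms(2) by blast
  with assms(2,3) show False by blast
qed

lemma wf_balls_above:
  fixes I :: "'a set"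
  assumes I: "is_ball I"
  shows "wf {(K, J). is_ball K \<and> is_ball J \<and> I \<subseteq> K \<and> K \<subset> J}"
proof (subst wf_iff_no_infinite_down_chain, rule notI, elim exE)
  fix D :: "nat \<Rightarrow> 'a set"
  assume "\<forall>i. (D (Suc i), D i) \<in> {(K, J). is_ball K \<and> is_ball J \<and> I \<subseteq> K \<and> K \<subset> J}"
  then have b: "is_ball (D k)" "D (Suc k) \<subset> D k" "I \<subseteq> D (Suc k)" for k by auto
  then have I_sub: "I \<subseteq> D k" for k by blast
  have lim: "(\<lambda>k. diameter (D k)) \<longlonglongrightarrow> 0" using reg b(1,2) unfolding regular_balls_def by simp
  obtain x r where r: "0 < r" "I = cball x r" using I unfolding is_ball_def by blast
  obtain k where k: "diameter (D k) < r"
    using order_tendstoD(2)[OF lim r(1)] by (meson eventually_sequentially order_refl)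
  have "x \<in> I" using r by simp
  then have x: "x \<in> D k" using I_sub by blast
  have "D k \<subseteq> I"
  proof
    fix y assume "y \<in> D k"
    then have "dist x y \<le> diameter (D k)"
      using diameter_bounded_bound[OF ball_props(4)[OF b(1)[of k]] x] by blast
    then show "y \<in> I" using k r(2) by auto
  qed
  then show False using b(2)[of k] b(3)[of k] by blast
qed

lemma max_subballs_cover:
  fixes J :: "'a set"
  assumes J: "is_ball J" and nz: "diameter J \<noteq> 0"
  shows "finite (max_subballs J)" "J = \<Union>(max_subballs J)"
proof -
  obtain F where F: "finite F" "F \<subseteq> max_subballs J" "J = \<Union>F"
    using reg J nz unfolding regular_balls_def by blast
  have "max_subballs J \<subseteq> F"
  proof
    fix M assume M: "M \<in> max_subballs J"
    then have Mb: "is_ball M" "M \<subset> J" unfolding max_subballs_def by auto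
    then obtain x N where "x \<in> M" "N \<in> F" "x \<in> N" using F(3) ball_props(1) by blast
    moreover from this have N: "N \<in> max_subballs J" using F(2) by blast
    then have "is_ball N" unfolding max_subballs_def by simp
    ultimately have "M \<subseteq> N \<or> N \<subseteq> M"
      using balls_nested[OF Mb(1)] by blast
    then have "M = N" using M N unfolding max_subballs_def by blast
    then show "M \<in> F" using \<open>N \<in> F\<close> by simp
  qed
  with F have "F = max_subballs J" by blast
  then show "finite (max_subballs J)" "J = \<Union>(max_subballs J)" using F by auto
qed

lemma step_down:
  fixes I J :: "'a set"
  assumes I: "is_ball I" and J: "is_ball J" and IJ: "I \<subset> J"
  obtains M where "M \<in> max_subballs J" "is_ball M" "M \<subset> J"
    "\<And>K. is_ball K \<Longrightarrow> I \<subseteq> K \<Longrightarrow> K \<subset> J \<Longrightarrow> K \<subseteq> M" "I \<subseteq> M"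
proof -
  have "diameter J \<noteq> 0" using diameter_nonzero[OF J IJ] ball_props(1)[OF I] by blast
  then obtain x M where M: "x \<in> I" "x \<in> M" "M \<in> max_subballs J"
    using max_subballs_cover[OF J] IJ ball_props(1)[OF I] by blast
  have sub: "K \<subseteq> M" if K: "is_ball K" "I \<subseteq> K" "K \<subset> J" for K
  proof -
    have "K \<subseteq> M \<or> M \<subseteq> K"
      using K M balls_nested[of K M] unfolding max_subballs_def by blast
    then show ?thesis using K M(3) unfolding max_subballs_def by blast
  qed
  show ?thesis
    by (rule that[of M]) (use M sub I IJ in \<open>auto simp: max_subballs_def\<close>)
qed

lemma finite_path:
  fixes I J :: "'a set"
  assumes I: "is_ball I"
  shows "is_ball J \<Longrightarrow> I \<subseteq> J \<Longrightarrow> finite {K. is_ball K \<and> I \<subseteq> K \<and> K \<subseteq> J}"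
proof (induction J rule: wf_induct_rule[OF wf_balls_above[OF I]])
  case (1 J)
  show ?case
  proof (cases "I = J")
    case True
    then have "{K. is_ball K \<and> I \<subseteq> K \<and> K \<subseteq> J} \<subseteq> {J}" by auto
    then show ?thesis using finite_subset by blast
  next
    case False
    then obtain M where M: "is_ball M" "M \<subset> J" "I \<subseteq> M"
      "\<And>K. is_ball K \<Longrightarrow> I \<subseteq> K \<Longrightarrow> K \<subset> J \<Longrightarrow> K \<subseteq> M"
      using step_down[OF I 1(2)] 1(3) by (metis psubsetI)
    have "finite {K. is_ball K \<and> I \<subseteq> K \<and> K \<subseteq> M}" using 1 M by blast
    moreover have "{K. is_ball K \<and> I \<subseteq> K \<and> K \<subseteq> J} \<subseteq>
        insert J {K. is_ball K \<and> I \<subseteq> K \<and> K \<subseteq> M}"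
      using M(4) by blast
    ultimately show ?thesis by (rule finite_subset[OF _ finite.insertI, rotated])
  qed
qed

lemma ex_parent:
  fixes I J :: "'a set"
  assumes I: "is_ball I"
  shows "is_ball J \<Longrightarrow> I \<subset> J \<Longrightarrow> \<exists>L. is_ball L \<and> L \<subseteq> J \<and> I \<in> max_subballs L"
proof (induction J rule: wf_induct_rule[OF wf_balls_above[OF I]])
  case (1 J)
  obtain M where M: "M \<in> max_subballs J" "is_ball M" "M \<subset> J" "I \<subseteq> M"
    using step_down[OF I 1(2,3)] by metis
  show ?case
  proof (cases "I = M")
    case True
    then show ?thesis using M 1 by blast
  next
    case False
    then show ?thesis using 1(1)[of M] 1(2) M by blast
  qed
qed

lemma balls_bounded_above:
  fixes F :: "'a set set"
  assumes "finite F" "\<forall>B\<in>F. is_ball B"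
  shows "\<exists>J. is_ball J \<and> \<Union>F \<subseteq> J \<and> x \<in> J \<and> y \<in> J"
proof -
  have "bounded (insert x (insert y (\<Union>F)))" using assms ball_props(4) by auto
  then obtain e where e: "\<forall>z\<in>insert x (insert y (\<Union>F)). dist x z \<le> e"
    using bounded_any_center by metis
  then have "insert x (insert y (\<Union>F)) \<subseteq> cball x (max e 1)" by (meson max.coboundedI1 mem_cball subsetI)
  moreover have "is_ball (cball x (max e 1))"
    unfolding is_ball_def by (intro exI[of _ x] exI[of _ "max e 1"]) simp
  ultimately show ?thesis by blast
qed

lemma ball_in_tree:
  fixes I :: "'a set"
  assumes two: "\<exists>x y :: 'a. x \<noteq> y" and I: "is_ball I"
  shows "I \<in> ball_tree"
proof (cases "diameter I = 0")
  case False
  then show ?thesis using I unfolding ball_tree_def by blast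
next
  case True
  obtain x y :: 'a where xy: "x \<noteq> y" using two by blast
  obtain J where J: "is_ball J" "\<Union>{I} \<subseteq> J" "x \<in> J" "y \<in> J"
    using balls_bounded_above[of "{I}" x y] I by auto
  have "I \<noteq> J" using diameter_zero_ball[OF I True] J xy by blast
  then obtain L where L: "is_ball L" "I \<in> max_subballs L" using ex_parent[OF I J(1)] J(2) by blast
  then have "diameter L \<noteq> 0"
    using diameter_nonzero[of L I] ball_props(1)[OF I] unfolding max_subballs_def by blast
  then show ?thesis using I True L unfolding ball_tree_def by blast
qed

lemma ex_full_subtree:
  fixes F :: "'a set set"
  assumes two: "\<exists>x y :: 'a. x \<noteq> y" and F: "finite F" "\<forall>B\<in>F. is_ball B"
  shows "\<exists>S. full_subtree S \<and> F \<subseteq> S"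
proof -
  obtain T where T: "is_ball T" "\<Union>F \<subseteq> T" using balls_bounded_above[OF F] by blast
  define P where "P = (\<Union>B\<in>F. {K. is_ball K \<and> B \<subset> K \<and> K \<subseteq> T})"
  define S where "S = insert T (\<Union>K\<in>P. max_subballs K)"
  have Pball: "is_ball K" "K \<subseteq> T" "diameter K \<noteq> 0" if "K \<in> P" for K
    using that F(2) diameter_nonzero ball_props(1) unfolding P_def by blast+
  have "finite {K. is_ball K \<and> B \<subset> K \<and> K \<subseteq> T}" if "B \<in> F" for B
  proof -
    have "is_ball B" "B \<subseteq> T" using F T that by auto
    then have "finite {K. is_ball K \<and> B \<subseteq> K \<and> K \<subseteq> T}" using finite_path T by blast
    then show ?thesis by (rule rev_finite_subset) auto
  qed
  then have finP: "finite P" unfolding P_def using F by blast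
  have finS: "finite S" unfolding S_def using finP max_subballs_cover Pball by auto
  have Sball: "is_ball K" "K \<subseteq> T" if "K \<in> S" for K
    using that T(1) Pball unfolding S_def max_subballs_def by blast+
  have up: "K \<in> S" if K: "is_ball K" "K \<subseteq> T" "B \<in> F" "B \<subseteq> K" for K B
  proof (cases "K = T")
    case True
    then show ?thesis unfolding S_def by simp
  next
    case False
    then have "K \<subset> T" using K(2) by simp
    from ex_parent[OF K(1) T(1) this] obtain L
      where L: "is_ball L" "L \<subseteq> T" "K \<in> max_subballs L" by blast
    have "K \<subset> L" using L(3) unfolding max_subballs_def by simp
    then have "B \<subset> L" using K(4) by simp
    then have "L \<in> P" using K(3) L(1,2) unfolding P_def by blast
    then show ?thesis using L unfolding S_def by blast
  qed
  have conv: "K \<in> S" if I: "I \<in> S" and K: "is_ball K" "I \<subseteq> K" "K \<subseteq> T" for I K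
  proof (cases "I = T \<or> I = K")
    case True
    then show ?thesis using I K by auto
  next
    case False
    then obtain L where L: "L \<in> P" "I \<in> max_subballs L" using I unfolding S_def by blast
    have Ib: "is_ball I" "I \<subset> L" using L unfolding max_subballs_def by auto
    have "K \<subseteq> L \<or> L \<subseteq> K"
      using balls_nested[OF K(1) Pball(1)[OF L(1)]] Ib K ball_props(1)[OF Ib(1)] by blast
    then have "L \<subseteq> K" using L(2) K False unfolding max_subballs_def by blast
    moreover obtain B where "B \<in> F" "B \<subset> L" using L(1) unfolding P_def by blast
    ultimately show ?thesis using up[OF K(1,3)] by blast
  qed
  have sib: "max_subballs I \<subseteq> S" if I: "I \<in> S" and M: "M \<in> max_subballs I" "M \<in> S" for I M
  proof -
    have Mb: "is_ball M" "M \<subset> I" using M unfolding max_subballs_def by auto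
    then have "M \<noteq> T" using Sball(2)[OF I] by blast
    then obtain L where L: "L \<in> P" "M \<in> max_subballs L" using M(2) unfolding S_def by blast
    have "M \<subset> L" using L(2) unfolding max_subballs_def by auto
    then have "I \<subseteq> L \<or> L \<subseteq> I"
      using balls_nested[OF Sball(1)[OF I] Pball(1)[OF L(1)]] Mb ball_props(1)[OF Mb(1)] by blast
    moreover have "\<not> I \<subset> L"
      using L(2) Sball(1)[OF I] Mb(2) unfolding max_subballs_def by simp
    moreover have "\<not> L \<subset> I"
      using M(1) Pball(1)[OF L(1)] \<open>M \<subset> L\<close> unfolding max_subballs_def by simp
    ultimately have "I = L" by blast
    then show ?thesis using L(1) unfolding S_def by auto
  qed
  have "full_subtree S"
    unfolding full_subtree_def
  proof (intro conjI ballI impI)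
    show "finite S" by (rule finS)
    show "S \<subseteq> ball_tree" using Sball(1) ball_in_tree[OF two] by blast
    show "\<exists>K\<in>S. I \<subseteq> K \<and> J \<subseteq> K" if "I \<in> S" "J \<in> S" for I J
      using that Sball(2) unfolding S_def by blast
    show "K \<in> S" if "I \<in> S" "J \<in> S" "K \<in> ball_tree" "I \<subseteq> K \<and> K \<subseteq> J" for I J K
    proof (rule conv[OF that(1)])
      show "is_ball K" using that(3) unfolding ball_tree_def by blast
      show "I \<subseteq> K" "K \<subseteq> T" using that(4) Sball(2)[OF that(2)] by auto
    qed
    show "max_subballs I \<subseteq> S" if "I \<in> S" "max_subballs I \<inter> S \<noteq> {}" for I
      using sib[OF that(1)] that(2) by blast
  qed
  moreover have "F \<subseteq> S" using up F(2) T(2) by blast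
  ultimately show ?thesis by blast
qed

lemma test_functions_eq:
  assumes two: "\<exists>x y :: 'a. x \<noteq> y" and cpt: "\<And>D :: 'a set. is_ball D \<Longrightarrow> compact D"
  shows "test_functions = {f :: 'a \<Rightarrow> complex.
           (\<forall>x. \<exists>U. open U \<and> x \<in> U \<and> (\<forall>y\<in>U. f y = f x)) \<and> compact (closure {x. f x \<noteq> 0})}"
proof (intro equalityI subsetI)
  fix f :: "'a \<Rightarrow> complex"
  assume "f \<in> test_functions"
  then obtain S c where S: "full_subtree S" and f: "f = (\<lambda>x. \<Sum>J\<in>S. c J * indicator J x)"
    unfolding test_functions_def subtree_functions_def by blast
  have fin: "finite S" and balls: "\<And>J. J \<in> S \<Longrightarrow> is_ball J"
    using S unfolding full_subtree_def ball_tree_def by auto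
  have "\<exists>U. open U \<and> x \<in> U \<and> (\<forall>y\<in>U. f y = f x)" for x
  proof (rule exI[of _ "\<Inter>J\<in>S. if x \<in> J then J else - J"], intro conjI ballI)
    show "open (\<Inter>J\<in>S. if x \<in> J then J else - J)"
      using fin balls ball_props by (intro open_INT) auto
    show "f y = f x" if "y \<in> (\<Inter>J\<in>S. if x \<in> J then J else - J)" for y
      unfolding f using that by (intro sum.cong) (auto simp: indicator_def split: if_splits)
  qed auto
  moreover have "compact (closure {x. f x \<noteq> 0})"
  proof -
    have "{x. f x \<noteq> 0} \<subseteq> \<Union>S"
    proof
      fix x assume "x \<in> {x. f x \<noteq> 0}"
      then have "(\<Sum>J\<in>S. c J * indicator J x) \<noteq> 0" using f by simp
      then obtain J where "J \<in> S" "c J * indicator J x \<noteq> 0" by (rule sum.not_neutral_contains_not_neutral)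
      then show "x \<in> \<Union>S" by (auto simp: indicator_def split: if_splits)
    qed
    moreover have K: "compact (\<Union>S)" using fin balls cpt by (intro compact_Union) auto
    ultimately have "closure {x. f x \<noteq> 0} \<subseteq> \<Union>S"
      by (intro closure_minimal compact_imp_closed)
    then show ?thesis using closed_Int_compact[OF closed_closure K] by (metis inf.absorb1)
  qed
  ultimately show "f \<in> {f. (\<forall>x. \<exists>U. open U \<and> x \<in> U \<and> (\<forall>y\<in>U. f y = f x)) \<and>
      compact (closure {x. f x \<noteq> 0})}" by blast
next
  fix f :: "'a \<Rightarrow> complex"
  assume "f \<in> {f. (\<forall>x. \<exists>U. open U \<and> x \<in> U \<and> (\<forall>y\<in>U. f y = f x)) \<and>
      compact (closure {x. f x \<noteq> 0})}"
  then have loc: "\<And>x. \<exists>U. open U \<and> x \<in> U \<and> (\<forall>y\<in>U. f y = f x)"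
    and K: "compact (closure {x. f x \<noteq> 0})" by auto
  define C where "C = {B. is_ball B \<and> (\<exists>v. \<forall>y\<in>B. f y = v)}"
  have "\<exists>B\<in>C. x \<in> B" for x
  proof -
    obtain U where U: "open U" "x \<in> U" "\<forall>y\<in>U. f y = f x" using loc by blast
    then obtain e where e: "0 < e" "cball x e \<subseteq> U" using open_contains_cball by blast
    then have "is_ball (cball x e)" unfolding is_ball_def by blast
    then have "cball x e \<in> C" using U(3) e(2) unfolding C_def by blast
    moreover have "x \<in> cball x e" using e(1) by simp
    ultimately show ?thesis by blast
  qed
  then have "closure {x. f x \<noteq> 0} \<subseteq> \<Union>C" by blast
  moreover have "\<forall>B\<in>C. open B" using ball_props(2) unfolding C_def by blast
  ultimately obtain F0 where F0: "F0 \<subseteq> C" "finite F0" "closure {x. f x \<noteq> 0} \<subseteq> \<Union>F0"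
    using compactE[OF K] by metis
  define F where "F = {B\<in>F0. \<forall>B'\<in>F0. B \<subseteq> B' \<longrightarrow> B' = B}"
  have F: "finite F" "F \<subseteq> C" unfolding F_def using F0 by auto
  have cover: "\<exists>B\<in>F. x \<in> B" if "f x \<noteq> 0" for x
  proof -
    have "x \<in> \<Union>F0" using that F0(3) closure_subset[of "{x. f x \<noteq> 0}"] by auto
    then obtain B where B: "B \<in> F0" "x \<in> B" by blast
    obtain M where M: "M \<in> F0" "B \<subseteq> M" "\<forall>B'\<in>F0. M \<subseteq> B' \<longrightarrow> M = B'"
      using finite_has_maximal2[OF F0(2) B(1)] by auto
    then have "M \<in> F" unfolding F_def by auto
    then show ?thesis using B(2) M(2) by blast
  qed
  have disj: "B = B'" if "B \<in> F" "B' \<in> F" "x \<in> B" "x \<in> B'" for x B B'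
    using that balls_nested[of B B'] F(2) unfolding F_def C_def by blast
  obtain S where S: "full_subtree S" "F \<subseteq> S"
    using ex_full_subtree[OF two F(1)] F(2) unfolding C_def by blast
  have fin: "finite S" using S unfolding full_subtree_def by blast
  define c where "c B = (if B \<in> F then f (SOME y. y \<in> B) else 0)" for B
  have c: "c B = f x" if Bx: "B \<in> F" "x \<in> B" for B x
  proof -
    have "(SOME y. y \<in> B) \<in> B" using Bx(2) by (rule someI)
    moreover obtain v where "\<forall>y\<in>B. f y = v" using F(2) Bx(1) unfolding C_def by blast
    ultimately show ?thesis using Bx unfolding c_def by simp
  qed
  have "f x = (\<Sum>J\<in>S. c J * indicator J x)" for x
  proof (cases "\<exists>B\<in>F. x \<in> B")
    case True
    then obtain B where B: "B \<in> F" "x \<in> B" by blast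
    have "(\<Sum>J\<in>S. c J * indicator J x) = (\<Sum>J\<in>S. if J = B then f x else 0)"
    proof (rule sum.cong[OF refl])
      fix J assume "J \<in> S"
      show "c J * indicator J x = (if J = B then f x else 0)"
      proof (cases "J = B")
        case True
        then show ?thesis using c[OF B] B(2) by simp
      next
        case False
        then have "J \<notin> F \<or> x \<notin> J" using disj[OF _ B(1) _ B(2), of J] by auto
        then have "c J = 0 \<or> x \<notin> J" unfolding c_def by auto
        then show ?thesis using False by auto
      qed
    qed
    then show ?thesis using fin S(2) B(1) by auto
  next
    case False
    then have "(\<Sum>J\<in>S. c J * indicator J x) = 0"
      by (intro sum.neutral) (auto simp: c_def indicator_def)
    moreover have "f x = 0" using False cover by blast
    ultimately show ?thesis by simp
  qed
  then show "f \<in> test_functions"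
    using S unfolding test_functions_def subtree_functions_def by blast
qed

end

text \<open>
  Every linear functional is continuous for the inductive limit topology. Functionals are
  extensional, so that a distribution is determined by its values on test functions.
\<close>

definition distributions :: "(('a::metric_space \<Rightarrow> complex) \<Rightarrow> complex) set" where
  "distributions = {u \<in> extensional test_functions.
     \<forall>f\<in>test_functions. \<forall>g\<in>test_functions. \<forall>a b.
       u (\<lambda>x. a * f x + b * g x) = a * u f + b * u g}"

definition weak_topology :: "(('a::metric_space \<Rightarrow> complex) \<Rightarrow> complex) topology" where
  "weak_topology =
     subtopology (product_topology (\<lambda>_. euclidean) test_functions) distributions"

definition weak_borel :: "(('a::metric_space \<Rightarrow> complex) \<Rightarrow> complex) measure" where
  "weak_borel = sigma distributions {U. openin weak_topology U}"

section \<open>Gaussian random fields\<close>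

definition centered_normal :: "real \<Rightarrow> real measure" where
  "centered_normal s =
     (if s = 0 then return borel 0 else density lborel (\<lambda>x. ennreal (normal_density 0 s x)))"

text \<open>
  Real-valued fields, extended complex linearly to complex test functions. By linearity,
  normality of the single variables on real test functions is joint normality of
  all finite families.
\<close>

definition gaussian_field ::
  "'w measure \<Rightarrow> (('a::metric_space \<Rightarrow> complex) \<Rightarrow> 'w \<Rightarrow> complex) \<Rightarrow> bool" where
  "gaussian_field P \<phi> \<longleftrightarrow>
     (\<forall>f\<in>test_functions. \<phi> f \<in> borel_measurable P) \<and>
     (\<forall>f\<in>test_functions. \<forall>g\<in>test_functions. \<forall>a b.
        AE \<omega> in P. \<phi> (\<lambda>x. a * f x + b * g x) \<omega> = a * \<phi> f \<omega> + b * \<phi> g \<omega>) \<and>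
     (\<forall>f\<in>test_functions. range f \<subseteq> \<real> \<longrightarrow>
        (AE \<omega> in P. \<phi> f \<omega> \<in> \<real>) \<and>
        (\<exists>s\<ge>0. distr P borel (\<lambda>\<omega>. Re (\<phi> f \<omega>)) = centered_normal s))"

definition white_noise ::
  "'a::metric_space measure \<Rightarrow> 'w measure \<Rightarrow> (('a \<Rightarrow> complex) \<Rightarrow> 'w \<Rightarrow> complex) \<Rightarrow> bool" where
  "white_noise \<nu> P \<phi> \<longleftrightarrow> gaussian_field P \<phi> \<and>
     (\<forall>f\<in>test_functions. \<forall>g\<in>test_functions.
        (\<integral>\<omega>. \<phi> f \<omega> * \<phi> g \<omega> \<partial>P) = (\<integral>x. f x * g x \<partial>\<nu>))"

text \<open>
  The field \<open>\<psi> = \<Sum> \<lambda>\<^sub>I\<^sup>-\<^sup>1 d\<^sub>I\<^sub>j \<Psi>\<^sub>I\<^sub>j\<close> with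
  \<open>d\<^sub>I\<^sub>j = \<integral> \<phi> cnj \<Psi>\<^sub>I\<^sub>j d\<nu>\<close>: tested against \<open>f\<close>, the
  series converges unconditionally in mean square.
\<close>

definition is_solution ::
  "'a::metric_space measure \<Rightarrow> ('a set \<Rightarrow> real) \<Rightarrow> ('a set \<Rightarrow> nat \<Rightarrow> 'a \<Rightarrow> complex)
     \<Rightarrow> 'w measure \<Rightarrow> (('a \<Rightarrow> complex) \<Rightarrow> 'w \<Rightarrow> complex)
     \<Rightarrow> (('a \<Rightarrow> complex) \<Rightarrow> 'w \<Rightarrow> complex) \<Rightarrow> bool" where
  "is_solution \<nu> T \<Psi> P \<phi> \<psi> \<longleftrightarrow>
     (\<forall>f\<in>test_functions. \<psi> f \<in> borel_measurable P \<and>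
        ((\<lambda>F. \<integral>\<^sup>+\<omega>. ennreal ((cmod (\<psi> f \<omega> -
             (\<Sum>(I, j)\<in>F. complex_of_real (inverse (psd_eigenvalue \<nu> T I))
                * \<phi> (\<lambda>x. cnj (\<Psi> I j x)) \<omega> * (\<integral>x. \<Psi> I j x * f x \<partial>\<nu>))))\<^sup>2) \<partial>P)
          \<longlongrightarrow> 0) (finite_subsets_at_top wavelet_index))"

section \<open>The covariation\<close>

definition covariation ::
  "'a::metric_space measure \<Rightarrow> ('a set \<Rightarrow> real) \<Rightarrow> 'a \<Rightarrow> 'a \<Rightarrow> real" where
  "covariation \<nu> T x x' =
     - (inverse (psd_eigenvalue \<nu> T (sup_ball x x')))\<^sup>2 * inverse (measure \<nu> (sup_ball x x'))
     + (\<Sum>\<^sub>\<infinity>I\<in>{I\<in>ball_tree. sup_ball x x' \<subset> I}.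
          (inverse (psd_eigenvalue \<nu> T I))\<^sup>2
          * (inverse (measure \<nu> (pred_vertex I (sup_ball x x'))) - inverse (measure \<nu> I)))"

text \<open>
  The contribution of the eigenvalue of \<open>I\<close> to the above expression. In general the
  covariation has a singular part on the diagonal (for \<open>\<lambda>\<^sub>I = 1\<close> it contains
  a \<open>\<delta>\<close>-function), so as a distribution on \<open>X \<times> X\<close> it is the sum of the
  distributions given by these kernels over all non-minimal vertices.
\<close>

definition covariation_term ::
  "'a::metric_space measure \<Rightarrow> ('a set \<Rightarrow> real) \<Rightarrow> 'a set \<Rightarrow> 'a \<Rightarrow> 'a \<Rightarrow> real" where
  "covariation_term \<nu> T I x x' =
     (if I = sup_ball x x'
        then - (inverse (psd_eigenvalue \<nu> T I))\<^sup>2 * inverse (measure \<nu> I)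
      else if sup_ball x x' \<subset> I
        then (inverse (psd_eigenvalue \<nu> T I))\<^sup>2
             * (inverse (measure \<nu> (pred_vertex I (sup_ball x x'))) - inverse (measure \<nu> I))
      else 0)"

end

theory Submission
  imports Defs "HOL-Library.Function_Algebras"
begin

text \<open>
  The projection onto the wavelet space of a vertex \<open>I\<close> has the kernel
  \<open>K\<^sub>I(x, y) = \<Sum>\<^sub>j \<Psi>\<^sub>I\<^sub>j(x) cnj \<Psi>\<^sub>I\<^sub>j(y) = \<Sum>\<^sub>M 1\<^sub>M(x) 1\<^sub>M(y) / \<nu>(M) - 1\<^sub>I(x) 1\<^sub>I(y) / \<nu>(I)\<close>,
  where \<open>M\<close> runs over the maximal subballs of \<open>I\<close>, and \<open>\<lambda>\<^sub>I\<^sup>-\<^sup>2 K\<^sub>I\<close> is the contribution of \<open>I\<close> to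
  the covariation. The projection of \<open>1\<^sub>B\<close> has squared norm
  \<open>\<nu>(B)\<^sup>2 (1 / \<nu>(I-1, B) - 1 / \<nu>(I))\<close> for \<open>I > B\<close> and vanishes otherwise. Hence convergence of
  the second series, which does not depend on the vertex it starts from, says that
  \<open>\<Sum> \<lambda>\<^sub>I\<^sup>-\<^sup>1 d\<^sub>I\<^sub>j \<integral> \<Psi>\<^sub>I\<^sub>j f d\<nu>\<close> converges in mean square for every test function \<open>f\<close>. A mean square
  limit of centered Gaussian variables is centered Gaussian, and its covariances are the limits.
  The first series makes the operator finite on test functions; those of mean zero are
  finite sums of wavelets, on which it acts by the eigenvalues.

  The space of test functions has countable dimension, so the weak Borel sets are generated by
  the values at a countable Hamel basis consisting of indicators of balls. Prescribing the
  values of the field on that basis turns every realization into a distribution, which at each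
  test function agrees with the field almost surely; its law is the measure. The measure is
  unique because a joint law is determined by the laws of the linear combinations.
\<close>

section \<open>Mean square convergence\<close>

text \<open>Three obstacles shape the details. Wavelets are complex, whereas the limit theorem for
  normal variables concerns real ones, and a partial sum over an arbitrary finite set of pairs
  \<open>(I, j)\<close>, tested against a real function, need not be real. Sums over all
  \<open>j\<close> belonging to a finite set of vertices are real, because their kernels are; such
  sums are cofinal among the finite partial sums, so the limit may be taken along them. The equation
  is tested by moving the operator onto the test function. If \<open>f\<close> has nonzero mean,
  then far from its support \<open>T f\<close> is a multiple of \<open>T (sup_ball x y)\<close>, so
  it need not vanish there; this is why the equation is tested on functions of mean zero. The kernel
  of the covariation is evaluated pointwise only off the diagonal. For test functions with disjoint
  supports everything reduces to a finite sum over pairs of disjoint balls, on each of which the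
  kernel is constant, so no interchange of an infinite sum with an integral arises.\<close>

definition square_integrable :: "'w measure \<Rightarrow> ('w \<Rightarrow> complex) \<Rightarrow> bool" where
  "square_integrable M f \<longleftrightarrow> f \<in> borel_measurable M \<and> integrable M (\<lambda>x. (cmod (f x))\<^sup>2)"

text \<open>Stated with the extended nonnegative integral, so that no integrability of
  \<open>Y\<close> is presupposed; it becomes a consequence. The shape is that of
  \<open>is_solution\<close>.\<close>

definition L2_tendsto :: "'w measure \<Rightarrow> ('i \<Rightarrow> 'w \<Rightarrow> complex) \<Rightarrow> ('w \<Rightarrow> complex) \<Rightarrow> 'i filter \<Rightarrow> bool" where
  "L2_tendsto M S Y F \<longleftrightarrow> ((\<lambda>i. \<integral>\<^sup>+\<omega>. ennreal ((cmod (Y \<omega> - S i \<omega>))\<^sup>2) \<partial>M) \<longlongrightarrow> 0) F"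

lemma borel_measurable_cnj [measurable]: "cnj \<in> borel_measurable borel"
  by (intro borel_measurable_continuous_onI continuous_intros)

lemma norm_sq_add_le: "(cmod (a + b))\<^sup>2 \<le> 2 * (cmod a)\<^sup>2 + 2 * (cmod b)\<^sup>2"
proof -
  have "(cmod (a + b))\<^sup>2 \<le> (cmod a + cmod b)\<^sup>2" by (intro power_mono norm_triangle_ineq) auto
  also have "\<dots> \<le> 2 * (cmod a)\<^sup>2 + 2 * (cmod b)\<^sup>2"
    using sum_squares_bound[of "cmod a" "cmod b"] by (simp add: power2_sum)
  finally show ?thesis .
qed

lemma square_integrable_measurable: "square_integrable M f \<Longrightarrow> f \<in> borel_measurable M"
  by (simp add: square_integrable_def)

lemma square_integrable_zero: "square_integrable M (\<lambda>x. 0)"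
  by (simp add: square_integrable_def)

lemma square_integrable_add:
  assumes "square_integrable M f" "square_integrable M g"
  shows "square_integrable M (\<lambda>x. f x + g x)"
  unfolding square_integrable_def
proof
  have [measurable]: "f \<in> borel_measurable M" "g \<in> borel_measurable M"
    using assms by (auto simp: square_integrable_def)
  show "(\<lambda>x. f x + g x) \<in> borel_measurable M" by simp
  have "integrable M (\<lambda>x. 2 * (cmod (f x))\<^sup>2 + 2 * (cmod (g x))\<^sup>2)"
    using assms by (auto simp: square_integrable_def)
  then show "integrable M (\<lambda>x. (cmod (f x + g x))\<^sup>2)"
    by (rule Bochner_Integration.integrable_bound) (auto simp: norm_sq_add_le)
qed

lemma square_integrable_scale:
  "square_integrable M f \<Longrightarrow> square_integrable M (\<lambda>x. c * f x)"
  by (auto simp: square_integrable_def norm_mult power_mult_distrib)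

lemma square_integrable_cnj:
  "square_integrable M f \<Longrightarrow> square_integrable M (\<lambda>x. cnj (f x))"
  by (auto simp: square_integrable_def)

lemma square_integrable_diff:
  "square_integrable M f \<Longrightarrow> square_integrable M g \<Longrightarrow> square_integrable M (\<lambda>x. f x - g x)"
  using square_integrable_add[of M f "\<lambda>x. (-1) * g x"] square_integrable_scale[of M g "-1"] by simp

lemma square_integrable_sum:
  "(\<And>i. i \<in> A \<Longrightarrow> square_integrable M (f i)) \<Longrightarrow> square_integrable M (\<lambda>x. \<Sum>i\<in>A. f i x)"
  by (induction A rule: infinite_finite_induct)
    (auto intro: square_integrable_zero square_integrable_add)

lemma square_integrable_AE_cong:
  assumes "square_integrable M f" "AE x in M. f x = g x" "g \<in> borel_measurable M"
  shows "square_integrable M g"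
proof -
  have [measurable]: "f \<in> borel_measurable M" "g \<in> borel_measurable M"
    using assms by (auto simp: square_integrable_def)
  have "integrable M (\<lambda>x. (cmod (f x))\<^sup>2) \<longleftrightarrow> integrable M (\<lambda>x. (cmod (g x))\<^sup>2)"
    by (rule integrable_cong_AE) (use assms(2) in auto)
  then show ?thesis using assms by (simp add: square_integrable_def)
qed

lemma square_integrable_mult:
  assumes "square_integrable M f" "square_integrable M g"
  shows "integrable M (\<lambda>x. f x * g x)"
proof -
  have [measurable]: "f \<in> borel_measurable M" "g \<in> borel_measurable M"
    using assms by (auto simp: square_integrable_def)
  have "integrable M (\<lambda>x. (cmod (f x))\<^sup>2 + (cmod (g x))\<^sup>2)"
    using assms by (auto simp: square_integrable_def)
  then show ?thesis
  proof (rule Bochner_Integration.integrable_bound)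
    have "cmod (f x) * cmod (g x) \<le> (cmod (f x))\<^sup>2 + (cmod (g x))\<^sup>2" for x
      using sum_squares_bound[of "cmod (f x)" "cmod (g x)"]
        mult_nonneg_nonneg[OF norm_ge_zero[of "f x"] norm_ge_zero[of "g x"]] by linarith
    then show "AE x in M. norm (f x * g x) \<le> norm ((cmod (f x))\<^sup>2 + (cmod (g x))\<^sup>2)"
      by (auto simp: norm_mult)
  qed simp
qed

lemma norm_integral_mult_le:
  assumes f: "square_integrable M f" and g: "square_integrable M g"
  shows "cmod (\<integral>x. f x * g x \<partial>M) \<le> sqrt (\<integral>x. (cmod (f x))\<^sup>2 \<partial>M) * sqrt (\<integral>x. (cmod (g x))\<^sup>2 \<partial>M)"
proof -
  have [measurable]: "f \<in> borel_measurable M" "g \<in> borel_measurable M"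
    using assms by (auto simp: square_integrable_def)
  have int: "integrable M (\<lambda>x. cmod (f x) * cmod (g x))"
    using integrable_norm[OF square_integrable_mult[OF f g]] by (simp add: norm_mult)
  have fi: "integrable M (\<lambda>x. (cmod (f x))\<^sup>2)" and gi: "integrable M (\<lambda>x. (cmod (g x))\<^sup>2)"
    using assms by (auto simp: square_integrable_def)
  have "(\<integral>\<^sup>+x. ennreal (cmod (f x)) * ennreal (cmod (g x)) \<partial>M)\<^sup>2 \<le>
     (\<integral>\<^sup>+x. ennreal (cmod (f x)) ^ 2 \<partial>M) * (\<integral>\<^sup>+x. ennreal (cmod (g x)) ^ 2 \<partial>M)"
    by (rule Cauchy_Schwarz_nn_integral) auto
  also have "(\<integral>\<^sup>+x. ennreal (cmod (f x)) ^ 2 \<partial>M) = ennreal (\<integral>x. (cmod (f x))\<^sup>2 \<partial>M)"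
    using fi by (simp add: nn_integral_eq_integral ennreal_power)
  also have "(\<integral>\<^sup>+x. ennreal (cmod (g x)) ^ 2 \<partial>M) = ennreal (\<integral>x. (cmod (g x))\<^sup>2 \<partial>M)"
    using gi by (simp add: nn_integral_eq_integral ennreal_power)
  also have "(\<integral>\<^sup>+x. ennreal (cmod (f x)) * ennreal (cmod (g x)) \<partial>M) = ennreal (\<integral>x. cmod (f x) * cmod (g x) \<partial>M)"
    using nn_integral_eq_integral[OF int] by (simp add: ennreal_mult'')
  finally have "(\<integral>x. cmod (f x) * cmod (g x) \<partial>M)\<^sup>2 \<le> (\<integral>x. (cmod (f x))\<^sup>2 \<partial>M) * (\<integral>x. (cmod (g x))\<^sup>2 \<partial>M)"
    by (simp add: ennreal_power flip: ennreal_mult)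
  then have "(\<integral>x. cmod (f x) * cmod (g x) \<partial>M) \<le> sqrt ((\<integral>x. (cmod (f x))\<^sup>2 \<partial>M) * (\<integral>x. (cmod (g x))\<^sup>2 \<partial>M))"
    by (rule real_le_rsqrt)
  moreover have "cmod (\<integral>x. f x * g x \<partial>M) \<le> (\<integral>x. cmod (f x) * cmod (g x) \<partial>M)"
    using integral_norm_bound[of M "\<lambda>x. f x * g x"] by (simp add: norm_mult)
  ultimately show ?thesis by (simp add: real_sqrt_mult)
qed

lemma L2_tendsto_cnj:
  "L2_tendsto M S Y F \<Longrightarrow> L2_tendsto M (\<lambda>i \<omega>. cnj (S i \<omega>)) (\<lambda>\<omega>. cnj (Y \<omega>)) F"
  unfolding L2_tendsto_def by (simp flip: complex_cnj_diff)

lemma nn_integral_norm_sq_add_le: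
  fixes f g :: "'w \<Rightarrow> complex"
  assumes [measurable]: "f \<in> borel_measurable M" "g \<in> borel_measurable M"
  shows "(\<integral>\<^sup>+\<omega>. ennreal ((cmod (f \<omega> + g \<omega>))\<^sup>2) \<partial>M) \<le>
     2 * (\<integral>\<^sup>+\<omega>. ennreal ((cmod (f \<omega>))\<^sup>2) \<partial>M) + 2 * (\<integral>\<^sup>+\<omega>. ennreal ((cmod (g \<omega>))\<^sup>2) \<partial>M)"
proof -
  have "(\<integral>\<^sup>+\<omega>. ennreal ((cmod (f \<omega> + g \<omega>))\<^sup>2) \<partial>M) \<le> (\<integral>\<^sup>+\<omega>. ennreal (2 * (cmod (f \<omega>))\<^sup>2 + 2 * (cmod (g \<omega>))\<^sup>2) \<partial>M)"
    by (intro nn_integral_mono ennreal_leI norm_sq_add_le)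
  also have "\<dots> = (\<integral>\<^sup>+\<omega>. 2 * ennreal ((cmod (f \<omega>))\<^sup>2) + 2 * ennreal ((cmod (g \<omega>))\<^sup>2) \<partial>M)"
    by (intro nn_integral_cong) (simp add: ennreal_mult)
  finally show ?thesis by (simp add: nn_integral_add nn_integral_cmult)
qed

text \<open>Measurability of the approximants is required only eventually: a partial sum is known to
  be measurable when its index set lies in \<open>wavelet_index\<close>, which holds eventually
  along the filter of its finite subsets.\<close>

lemma L2_tendsto_lincomb:
  fixes S S' :: "'i \<Rightarrow> 'w \<Rightarrow> complex"
  assumes lim: "L2_tendsto M S Y F" "L2_tendsto M S' Z F"
    and [measurable]: "Y \<in> borel_measurable M" "Z \<in> borel_measurable M"
    and meas: "\<forall>\<^sub>F i in F. S i \<in> borel_measurable M" "\<forall>\<^sub>F i in F. S' i \<in> borel_measurable M"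
  shows "L2_tendsto M (\<lambda>i \<omega>. a * S i \<omega> + b * S' i \<omega>) (\<lambda>\<omega>. a * Y \<omega> + b * Z \<omega>) F"
proof -
  let ?D = "\<lambda>i. \<integral>\<^sup>+\<omega>. ennreal ((cmod (Y \<omega> - S i \<omega>))\<^sup>2) \<partial>M"
  let ?E = "\<lambda>i. \<integral>\<^sup>+\<omega>. ennreal ((cmod (Z \<omega> - S' i \<omega>))\<^sup>2) \<partial>M"
  have "((\<lambda>i. (2 * ennreal ((cmod a)\<^sup>2)) * ?D i + (2 * ennreal ((cmod b)\<^sup>2)) * ?E i)
      \<longlongrightarrow> (2 * ennreal ((cmod a)\<^sup>2)) * 0 + (2 * ennreal ((cmod b)\<^sup>2)) * 0) F"
    using lim unfolding L2_tendsto_def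
    by (intro tendsto_add ennreal_tendsto_cmult) (auto simp: ennreal_mult_less_top)
  then have up: "((\<lambda>i. (2 * ennreal ((cmod a)\<^sup>2)) * ?D i + (2 * ennreal ((cmod b)\<^sup>2)) * ?E i) \<longlongrightarrow> 0) F" by simp
  have "\<forall>\<^sub>F i in F. (\<integral>\<^sup>+\<omega>. ennreal ((cmod (a * Y \<omega> + b * Z \<omega> - (a * S i \<omega> + b * S' i \<omega>)))\<^sup>2) \<partial>M)
     \<le> (2 * ennreal ((cmod a)\<^sup>2)) * ?D i + (2 * ennreal ((cmod b)\<^sup>2)) * ?E i"
    using meas
  proof eventually_elim
    case (elim i)
    note [measurable] = elim
    have "(\<integral>\<^sup>+\<omega>. ennreal ((cmod (a * Y \<omega> + b * Z \<omega> - (a * S i \<omega> + b * S' i \<omega>)))\<^sup>2) \<partial>M) =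
      (\<integral>\<^sup>+\<omega>. ennreal ((cmod (a * (Y \<omega> - S i \<omega>) + b * (Z \<omega> - S' i \<omega>)))\<^sup>2) \<partial>M)"
      by (simp add: algebra_simps)
    also have "\<dots> \<le> 2 * (\<integral>\<^sup>+\<omega>. ennreal ((cmod (a * (Y \<omega> - S i \<omega>)))\<^sup>2) \<partial>M)
         + 2 * (\<integral>\<^sup>+\<omega>. ennreal ((cmod (b * (Z \<omega> - S' i \<omega>)))\<^sup>2) \<partial>M)"
      by (rule nn_integral_norm_sq_add_le) auto
    also have "\<dots> = (2 * ennreal ((cmod a)\<^sup>2)) * ?D i + (2 * ennreal ((cmod b)\<^sup>2)) * ?E i"
      by (simp add: norm_mult power_mult_distrib ennreal_mult nn_integral_cmult mult.assoc)
    finally show ?case .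
  qed
  then show ?thesis unfolding L2_tendsto_def
    by (intro tendsto_sandwich[OF _ _ tendsto_const up]) auto
qed

lemma L2_tendsto_unique:
  assumes ne: "F \<noteq> bot" and lim: "L2_tendsto M S Y F" "L2_tendsto M S Z F"
    and [measurable]: "Y \<in> borel_measurable M" "Z \<in> borel_measurable M"
    and meas: "\<forall>\<^sub>F i in F. S i \<in> borel_measurable M"
  shows "AE \<omega> in M. Y \<omega> = Z \<omega>"
proof -
  \<comment> \<open>Subtracting the approximants from themselves leaves a distance from
    \<open>Y\<close> to \<open>Z\<close> that does not depend on \<open>i\<close> and tends to
    0.\<close>
  have "L2_tendsto M (\<lambda>i \<omega>. 1 * S i \<omega> + (-1) * S i \<omega>) (\<lambda>\<omega>. 1 * Y \<omega> + (-1) * Z \<omega>) F"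
    by (rule L2_tendsto_lincomb) (use assms in auto)
  then have "(\<integral>\<^sup>+\<omega>. ennreal ((cmod (Y \<omega> - Z \<omega>))\<^sup>2) \<partial>M) = 0"
    unfolding L2_tendsto_def using ne by (simp add: tendsto_const_iff)
  then have "AE \<omega> in M. ennreal ((cmod (Y \<omega> - Z \<omega>))\<^sup>2) = 0"
    by (subst (asm) nn_integral_0_iff_AE) auto
  then show ?thesis by (rule AE_mp) (auto simp: ennreal_eq_0_iff)
qed

lemma L2_tendsto_square_integrable:
  assumes ne: "F \<noteq> bot" and lim: "L2_tendsto M S Y F"
    and Y: "Y \<in> borel_measurable M" and sq: "\<forall>\<^sub>F i in F. square_integrable M (S i)"
  shows "square_integrable M Y"
proof -
  have "\<forall>\<^sub>F i in F. (\<integral>\<^sup>+\<omega>. ennreal ((cmod (Y \<omega> - S i \<omega>))\<^sup>2) \<partial>M) < 1"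
    using lim unfolding L2_tendsto_def by (intro order_tendstoD) auto
  \<comment> \<open>One square integrable approximant at finite distance is enough.\<close>
  from eventually_happens'[OF ne eventually_conj[OF this sq]] obtain i
    where i: "(\<integral>\<^sup>+\<omega>. ennreal ((cmod (Y \<omega> - S i \<omega>))\<^sup>2) \<partial>M) < 1" "square_integrable M (S i)" by blast
  have [measurable]: "S i \<in> borel_measurable M" using i(2) by (simp add: square_integrable_def)
  have "square_integrable M (\<lambda>\<omega>. Y \<omega> - S i \<omega>)"
    unfolding square_integrable_def using Y order_less_trans[OF i(1) ennreal_one_less_top]
    by (auto simp: integrable_iff_bounded)
  from square_integrable_add[OF this i(2)] show ?thesis by simp
qed

lemma L2_tendsto_norm:
  assumes lim: "L2_tendsto M S Y F" and Y: "square_integrable M Y"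
    and sq: "\<forall>\<^sub>F i in F. square_integrable M (S i)"
  shows "((\<lambda>i. \<integral>\<omega>. (cmod (Y \<omega> - S i \<omega>))\<^sup>2 \<partial>M) \<longlongrightarrow> 0) F"
proof -
  have "\<forall>\<^sub>F i in F. (\<integral>\<^sup>+\<omega>. ennreal ((cmod (Y \<omega> - S i \<omega>))\<^sup>2) \<partial>M) = ennreal (\<integral>\<omega>. (cmod (Y \<omega> - S i \<omega>))\<^sup>2 \<partial>M)"
    using sq
  proof eventually_elim
    case (elim i)
    then show ?case
      using square_integrable_diff[OF Y elim]
      by (intro nn_integral_eq_integral) (auto simp: square_integrable_def)
  qed
  then have "((\<lambda>i. ennreal (\<integral>\<omega>. (cmod (Y \<omega> - S i \<omega>))\<^sup>2 \<partial>M)) \<longlongrightarrow> ennreal 0) F"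
    using lim unfolding L2_tendsto_def by (simp add: tendsto_cong)
  then show ?thesis by (rule tendsto_ennrealD) auto
qed

lemma L2_tendsto_integral_mult:
  assumes ne: "F \<noteq> bot" and lim: "L2_tendsto M S Y F" "L2_tendsto M S' Z F"
    and Y: "Y \<in> borel_measurable M" and Z: "Z \<in> borel_measurable M"
    and sq: "\<forall>\<^sub>F i in F. square_integrable M (S i)" "\<forall>\<^sub>F i in F. square_integrable M (S' i)"
  shows "((\<lambda>i. \<integral>\<omega>. S i \<omega> * S' i \<omega> \<partial>M) \<longlongrightarrow> (\<integral>\<omega>. Y \<omega> * Z \<omega> \<partial>M)) F"
proof -
  have Ysq: "square_integrable M Y" and Zsq: "square_integrable M Z"
    using L2_tendsto_square_integrable[OF ne] assms by blast+
  let ?n = "\<lambda>f. sqrt (\<integral>\<omega>. (cmod (f \<omega>))\<^sup>2 \<partial>M)"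
  let ?d = "\<lambda>i. ?n (\<lambda>\<omega>. Y \<omega> - S i \<omega>)" and ?e = "\<lambda>i. ?n (\<lambda>\<omega>. Z \<omega> - S' i \<omega>)"
  have d0: "(?d \<longlongrightarrow> 0) F" "(?e \<longlongrightarrow> 0) F"
    using tendsto_real_sqrt[OF L2_tendsto_norm[OF lim(1) Ysq sq(1)]]
      tendsto_real_sqrt[OF L2_tendsto_norm[OF lim(2) Zsq sq(2)]] by auto
  have "((\<lambda>i. ?d i * ?n Z + ?n Y * ?e i + ?d i * ?e i) \<longlongrightarrow> 0 * ?n Z + ?n Y * 0 + 0 * 0) F"
    by (intro tendsto_add tendsto_mult tendsto_const d0)
  then have up: "((\<lambda>i. ?d i * ?n Z + ?n Y * ?e i + ?d i * ?e i) \<longlongrightarrow> 0) F" by simp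
  have "\<forall>\<^sub>F i in F. norm ((\<integral>\<omega>. S i \<omega> * S' i \<omega> \<partial>M) - (\<integral>\<omega>. Y \<omega> * Z \<omega> \<partial>M)) \<le>
       ?d i * ?n Z + ?n Y * ?e i + ?d i * ?e i"
    using sq
  proof eventually_elim
    case (elim i)
    have D: "square_integrable M (\<lambda>\<omega>. Y \<omega> - S i \<omega>)" and E: "square_integrable M (\<lambda>\<omega>. Z \<omega> - S' i \<omega>)"
      using elim Ysq Zsq square_integrable_diff by auto
    have "(\<integral>\<omega>. Y \<omega> * Z \<omega> \<partial>M) - (\<integral>\<omega>. S i \<omega> * S' i \<omega> \<partial>M) =
       (\<integral>\<omega>. Y \<omega> * Z \<omega> - S i \<omega> * S' i \<omega> \<partial>M)"
      by (rule Bochner_Integration.integral_diff[symmetric]) (intro square_integrable_mult Ysq Zsq elim)+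
    \<comment> \<open>Every product on the right contains a difference that is small in mean square,
      so Cauchy-Schwarz bounds each of the three integrals.\<close>
    also have "\<dots> = (\<integral>\<omega>. ((Y \<omega> - S i \<omega>) * Z \<omega> + Y \<omega> * (Z \<omega> - S' i \<omega>)) - (Y \<omega> - S i \<omega>) * (Z \<omega> - S' i \<omega>) \<partial>M)"
      by (rule Bochner_Integration.integral_cong) (auto simp: algebra_simps)
    also have "\<dots> = (\<integral>\<omega>. (Y \<omega> - S i \<omega>) * Z \<omega> \<partial>M) + (\<integral>\<omega>. Y \<omega> * (Z \<omega> - S' i \<omega>) \<partial>M)
        - (\<integral>\<omega>. (Y \<omega> - S i \<omega>) * (Z \<omega> - S' i \<omega>) \<partial>M)"
      using square_integrable_mult[OF D Zsq] square_integrable_mult[OF Ysq E] square_integrable_mult[OF D E]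
      by (subst Bochner_Integration.integral_diff) (auto intro: Bochner_Integration.integrable_add)
    finally have eq: "(\<integral>\<omega>. Y \<omega> * Z \<omega> \<partial>M) - (\<integral>\<omega>. S i \<omega> * S' i \<omega> \<partial>M) = \<dots>" .
    have "norm ((\<integral>\<omega>. S i \<omega> * S' i \<omega> \<partial>M) - (\<integral>\<omega>. Y \<omega> * Z \<omega> \<partial>M)) \<le>
       norm (\<integral>\<omega>. (Y \<omega> - S i \<omega>) * Z \<omega> \<partial>M) + norm (\<integral>\<omega>. Y \<omega> * (Z \<omega> - S' i \<omega>) \<partial>M)
        + norm (\<integral>\<omega>. (Y \<omega> - S i \<omega>) * (Z \<omega> - S' i \<omega>) \<partial>M)"
      unfolding norm_minus_commute[of "\<integral>\<omega>. S i \<omega> * S' i \<omega> \<partial>M"] eq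
      by (meson add_right_mono norm_triangle_ineq norm_triangle_ineq4 order_trans)
    then show ?case
      using norm_integral_mult_le[OF D Zsq] norm_integral_mult_le[OF Ysq E] norm_integral_mult_le[OF D E] by linarith
  qed
  then have "((\<lambda>i. (\<integral>\<omega>. S i \<omega> * S' i \<omega> \<partial>M) - (\<integral>\<omega>. Y \<omega> * Z \<omega> \<partial>M)) \<longlongrightarrow> 0) F"
    using up by (rule Lim_null_comparison)
  then show ?thesis by (simp add: LIM_zero_iff)
qed

section \<open>Completeness and orthonormal series in mean square\<close>

lemma ennreal_le_of_square_le: "x\<^sup>2 \<le> y\<^sup>2 \<Longrightarrow> x \<le> y" for x y :: ennreal
  by (cases x; cases y) (auto simp: ennreal_power top_power_ennreal power2_le_iff_abs_le top_unique)

text \<open>The Riesz-Fischer argument with a prescribed rate. On a probability space the increments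
  have first moment at most \<open>(1/2)^n\<close>, the square root of the given bound, so they are
  almost surely summable and a pointwise limit exists; Fatou's lemma returns the original bound for
  the limit.\<close>

lemma (in prob_space) L2_complete:
  fixes f :: "nat \<Rightarrow> 'a \<Rightarrow> complex"
  assumes [measurable]: "\<And>n. f n \<in> borel_measurable M"
    and cauchy: "\<And>n m. n \<le> m \<Longrightarrow> (\<integral>\<^sup>+\<omega>. ennreal ((cmod (f m \<omega> - f n \<omega>))\<^sup>2) \<partial>M) \<le> ennreal ((1/4)^n)"
  shows "\<exists>Y\<in>borel_measurable M. \<forall>n. (\<integral>\<^sup>+\<omega>. ennreal ((cmod (Y \<omega> - f n \<omega>))\<^sup>2) \<partial>M) \<le> ennreal ((1/4)^n)"
proof -
  have step: "(\<integral>\<^sup>+\<omega>. ennreal (cmod (f (Suc n) \<omega> - f n \<omega>)) \<partial>M) \<le> ennreal ((1/2)^n)" for n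
  proof -
    have "(\<integral>\<^sup>+\<omega>. ennreal (cmod (f (Suc n) \<omega> - f n \<omega>)) * 1 \<partial>M)\<^sup>2 \<le>
       (\<integral>\<^sup>+\<omega>. ennreal (cmod (f (Suc n) \<omega> - f n \<omega>)) ^ 2 \<partial>M) * (\<integral>\<^sup>+\<omega>. 1 ^ 2 \<partial>M)"
      by (rule Cauchy_Schwarz_nn_integral) auto
    also have "\<dots> = (\<integral>\<^sup>+\<omega>. ennreal ((cmod (f (Suc n) \<omega> - f n \<omega>))\<^sup>2) \<partial>M)"
      by (simp add: emeasure_space_1 ennreal_power)
    also have "\<dots> \<le> ennreal ((1/4)^n)" by (rule cauchy) simp
    also have "\<dots> = (ennreal ((1/2)^n))\<^sup>2"
      by (simp add: power2_eq_square flip: power_mult_distrib ennreal_mult)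
    finally have "(\<integral>\<^sup>+\<omega>. ennreal (cmod (f (Suc n) \<omega> - f n \<omega>)) \<partial>M)\<^sup>2 \<le> (ennreal ((1/2)^n))\<^sup>2"
      by simp
    then show ?thesis by (rule ennreal_le_of_square_le)
  qed
  have "(\<integral>\<^sup>+\<omega>. (\<Sum>n. ennreal (cmod (f (Suc n) \<omega> - f n \<omega>))) \<partial>M) =
     (\<Sum>n. \<integral>\<^sup>+\<omega>. ennreal (cmod (f (Suc n) \<omega> - f n \<omega>)) \<partial>M)"
    by (rule nn_integral_suminf) auto
  also have "\<dots> \<le> (\<Sum>n. ennreal ((1/2)^n))" by (intro suminf_le step) auto
  also have "\<dots> = ennreal (\<Sum>n. (1/2)^n)" by (intro suminf_ennreal2) auto
  also have "\<dots> < \<infinity>" by simp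
  finally have "AE \<omega> in M. (\<Sum>n. ennreal (cmod (f (Suc n) \<omega> - f n \<omega>))) \<noteq> \<infinity>"
    by (intro nn_integral_PInf_AE) auto
  then have conv: "AE \<omega> in M. convergent (\<lambda>n. f n \<omega>)"
  proof (rule AE_mp, intro AE_I2 impI)
    fix \<omega> assume "(\<Sum>n. ennreal (cmod (f (Suc n) \<omega> - f n \<omega>))) \<noteq> \<infinity>"
    then have "summable (\<lambda>n. cmod (f (Suc n) \<omega> - f n \<omega>))"
      by (intro summable_suminf_not_top) auto
    then have "summable (\<lambda>n. f (Suc n) \<omega> - f n \<omega>)" by (rule summable_norm_cancel)
    then have "convergent (\<lambda>n. f n \<omega> - f 0 \<omega>)"
      unfolding summable_iff_convergent sum_lessThan_telescope[of "\<lambda>n. f n \<omega>"] .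
    then have "convergent (\<lambda>n. f n \<omega> - f 0 \<omega> + f 0 \<omega>)" by (intro convergent_add convergent_const)
    then show "convergent (\<lambda>n. f n \<omega>)" by simp
  qed
  define Y where "Y \<omega> = lim (\<lambda>n. f n \<omega>)" for \<omega>
  have [measurable]: "Y \<in> borel_measurable M"
    unfolding Y_def by (rule borel_measurable_lim_metric) auto
  have "(\<integral>\<^sup>+\<omega>. ennreal ((cmod (Y \<omega> - f n \<omega>))\<^sup>2) \<partial>M) \<le> ennreal ((1/4)^n)" for n
  proof -
    have "(\<integral>\<^sup>+\<omega>. ennreal ((cmod (Y \<omega> - f n \<omega>))\<^sup>2) \<partial>M) =
       (\<integral>\<^sup>+\<omega>. liminf (\<lambda>m. ennreal ((cmod (f m \<omega> - f n \<omega>))\<^sup>2)) \<partial>M)"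
    proof (rule nn_integral_cong_AE, rule AE_mp[OF conv], intro AE_I2 impI)
      fix \<omega> assume "convergent (\<lambda>n. f n \<omega>)"
      then have "(\<lambda>m. f m \<omega>) \<longlonglongrightarrow> Y \<omega>" unfolding Y_def by (simp add: convergent_LIMSEQ_iff)
      then have "(\<lambda>m. ennreal ((cmod (f m \<omega> - f n \<omega>))\<^sup>2)) \<longlonglongrightarrow> ennreal ((cmod (Y \<omega> - f n \<omega>))\<^sup>2)"
        by (intro tendsto_ennrealI tendsto_intros)
      then show "ennreal ((cmod (Y \<omega> - f n \<omega>))\<^sup>2) = liminf (\<lambda>m. ennreal ((cmod (f m \<omega> - f n \<omega>))\<^sup>2))"
        by (rule lim_imp_Liminf[OF trivial_limit_sequentially, symmetric])
    qed
    also have "\<dots> \<le> liminf (\<lambda>m. \<integral>\<^sup>+\<omega>. ennreal ((cmod (f m \<omega> - f n \<omega>))\<^sup>2) \<partial>M)"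
      by (rule nn_integral_liminf) auto
    also have "\<dots> \<le> limsup (\<lambda>m. \<integral>\<^sup>+\<omega>. ennreal ((cmod (f m \<omega> - f n \<omega>))\<^sup>2) \<partial>M)"
      by (rule Liminf_le_Limsup) simp
    also have "\<dots> \<le> ennreal ((1/4)^n)"
      by (rule Limsup_bounded) (auto intro!: eventually_sequentiallyI[of n] cauchy)
    finally show ?thesis .
  qed
  then show ?thesis by (intro bexI[of _ Y]) auto
qed

lemma integral_orthonormal_sums:
  fixes e :: "'i \<Rightarrow> 'w \<Rightarrow> complex"
  assumes sq: "\<And>i. i \<in> A \<Longrightarrow> square_integrable M (e i)"
    and orth: "\<And>i j. i \<in> A \<Longrightarrow> j \<in> A \<Longrightarrow> (\<integral>\<omega>. cnj (e i \<omega>) * e j \<omega> \<partial>M) = (if i = j then 1 else 0)"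
    and F: "finite F" "F \<subseteq> A"
  shows "(\<integral>\<omega>. cnj (\<Sum>i\<in>F. a i * e i \<omega>) * (\<Sum>i\<in>F. b i * e i \<omega>) \<partial>M) = (\<Sum>i\<in>F. cnj (a i) * b i)"
proof -
  have int: "integrable M (\<lambda>\<omega>. cnj (e i \<omega>) * e j \<omega>)" if "i \<in> F" "j \<in> F" for i j
    using that F sq square_integrable_mult square_integrable_cnj by blast
  have "(\<integral>\<omega>. cnj (\<Sum>i\<in>F. a i * e i \<omega>) * (\<Sum>i\<in>F. b i * e i \<omega>) \<partial>M) =
     (\<integral>\<omega>. (\<Sum>i\<in>F. \<Sum>j\<in>F. (cnj (a i) * b j) * (cnj (e i \<omega>) * e j \<omega>)) \<partial>M)"
    unfolding cnj_sum sum_product by (simp add: mult_ac)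
  also have "\<dots> = (\<Sum>i\<in>F. \<Sum>j\<in>F. (cnj (a i) * b j) * (\<integral>\<omega>. cnj (e i \<omega>) * e j \<omega> \<partial>M))"
    using int by (simp add: Bochner_Integration.integral_sum)
  also have "\<dots> = (\<Sum>i\<in>F. \<Sum>j\<in>F. if j = i then cnj (a i) * b i else 0)"
    using F(2) by (intro sum.cong refl) (auto simp: orth subset_iff)
  also have "\<dots> = (\<Sum>i\<in>F. cnj (a i) * b i)" using F(1) by simp
  finally show ?thesis .
qed

text \<open>Completeness is available for sequences, while convergence is wanted along the finite
  subsets of an arbitrary index set. Finite sets outside which the squared coefficients sum to at
  most \<open>(1/4)^n\<close> give a sequence with a limit, and every larger finite set yields a sum
  close to that limit.\<close>

lemma (in prob_space) L2_orthonormal_series: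
  fixes e :: "'i \<Rightarrow> 'a \<Rightarrow> complex" and a :: "'i \<Rightarrow> complex"
  assumes sq: "\<And>i. i \<in> A \<Longrightarrow> square_integrable M (e i)"
    and orth: "\<And>i j. i \<in> A \<Longrightarrow> j \<in> A \<Longrightarrow> (\<integral>\<omega>. cnj (e i \<omega>) * e j \<omega> \<partial>M) = (if i = j then 1 else 0)"
    and summ: "(\<lambda>i. (cmod (a i))\<^sup>2) summable_on A"
  shows "\<exists>Y\<in>borel_measurable M. L2_tendsto M (\<lambda>F \<omega>. \<Sum>i\<in>F. a i * e i \<omega>) Y (finite_subsets_at_top A)"
proof -
  let ?S = "\<lambda>F \<omega>. \<Sum>i\<in>F. a i * e i \<omega>"
  have Ssq: "square_integrable M (?S F)" if "F \<subseteq> A" for F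
    using that sq by (intro square_integrable_sum square_integrable_scale) auto
  have norm: "(\<integral>\<^sup>+\<omega>. ennreal ((cmod (?S F \<omega>))\<^sup>2) \<partial>M) = ennreal (\<Sum>i\<in>F. (cmod (a i))\<^sup>2)"
    if F: "finite F" "F \<subseteq> A" for F
  proof -
    have "complex_of_real (\<integral>\<omega>. (cmod (?S F \<omega>))\<^sup>2 \<partial>M) = (\<integral>\<omega>. cnj (?S F \<omega>) * ?S F \<omega> \<partial>M)"
      unfolding integral_complex_of_real[symmetric] complex_norm_square by (simp add: mult.commute)
    also have "\<dots> = (\<Sum>i\<in>F. cnj (a i) * a i)"
      by (rule integral_orthonormal_sums[OF sq orth F])
    also have "\<dots> = complex_of_real (\<Sum>i\<in>F. (cmod (a i))\<^sup>2)"
      by (simp add: complex_norm_square mult.commute del: of_real_power)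
    finally have "(\<integral>\<omega>. (cmod (?S F \<omega>))\<^sup>2 \<partial>M) = (\<Sum>i\<in>F. (cmod (a i))\<^sup>2)"
      by (simp only: of_real_eq_iff)
    then show ?thesis using Ssq[OF F(2)]
      by (subst nn_integral_eq_integral) (auto simp: square_integrable_def)
  qed
  obtain s where s: "((\<lambda>i. (cmod (a i))\<^sup>2) has_sum s) A" using summ by (auto simp: summable_on_def)
  have ex: "\<exists>F. finite F \<and> F \<subseteq> A \<and> (\<forall>G. finite G \<longrightarrow> F \<subseteq> G \<longrightarrow> G \<subseteq> A \<longrightarrow> (\<Sum>i\<in>G - F. (cmod (a i))\<^sup>2) \<le> e)"
    if "0 < e" for e
  proof -
    have "\<forall>\<^sub>F F in finite_subsets_at_top A. s - e < (\<Sum>i\<in>F. (cmod (a i))\<^sup>2)"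
      using s that unfolding has_sum_def by (intro order_tendstoD) auto
    then obtain F where F: "finite F" "F \<subseteq> A" "s - e < (\<Sum>i\<in>F. (cmod (a i))\<^sup>2)"
      unfolding eventually_finite_subsets_at_top by blast
    have "(\<Sum>i\<in>G - F. (cmod (a i))\<^sup>2) \<le> e" if G: "finite G" "F \<subseteq> G" "G \<subseteq> A" for G
    proof -
      have "(\<Sum>i\<in>G. (cmod (a i))\<^sup>2) \<le> s"
        by (rule has_sum_mono_neutral[OF has_sum_finite[OF G(1)] s]) (use G in auto)
      then show ?thesis using F(3) sum_diff[OF G(1,2), of "\<lambda>i. (cmod (a i))\<^sup>2"] by linarith
    qed
    then show ?thesis using F by blast
  qed
  have "\<forall>n. \<exists>F. finite F \<and> F \<subseteq> A \<and> (\<forall>G. finite G \<longrightarrow> F \<subseteq> G \<longrightarrow> G \<subseteq> A \<longrightarrow> (\<Sum>i\<in>G - F. (cmod (a i))\<^sup>2) \<le> (1/4)^n)"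
    by (intro allI ex) auto
  then obtain H where H: "\<And>n. finite (H n)" "\<And>n. H n \<subseteq> A"
    "\<And>n G. finite G \<Longrightarrow> H n \<subseteq> G \<Longrightarrow> G \<subseteq> A \<Longrightarrow> (\<Sum>i\<in>G - H n. (cmod (a i))\<^sup>2) \<le> (1/4)^n"
    by metis
  \<comment> \<open>The sets \<open>H n\<close> need not be nested; their finite unions are, and
    they inherit the tail bound.\<close>
  define K where "K n = (\<Union>k\<le>n. H k)" for n
  have K: "finite (K n)" "K n \<subseteq> A" "H n \<subseteq> K n" for n unfolding K_def using H by auto
  have Kmono: "K n \<subseteq> K m" if "n \<le> m" for n m unfolding K_def using that by force
  have Kbound: "(\<integral>\<^sup>+\<omega>. ennreal ((cmod (?S G \<omega> - ?S (K n) \<omega>))\<^sup>2) \<partial>M) \<le> ennreal ((1/4)^n)"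
    if G: "finite G" "K n \<subseteq> G" "G \<subseteq> A" for G n
  proof -
    have "?S G \<omega> - ?S (K n) \<omega> = ?S (G - K n) \<omega>" for \<omega>
      using sum_diff[OF G(1,2), of "\<lambda>i. a i * e i \<omega>"] by simp
    then have "(\<integral>\<^sup>+\<omega>. ennreal ((cmod (?S G \<omega> - ?S (K n) \<omega>))\<^sup>2) \<partial>M) = ennreal (\<Sum>i\<in>G - K n. (cmod (a i))\<^sup>2)"
      using norm[of "G - K n"] G by auto
    also have "(\<Sum>i\<in>G - K n. (cmod (a i))\<^sup>2) \<le> (\<Sum>i\<in>G - H n. (cmod (a i))\<^sup>2)"
      using G K(3) by (intro sum_mono2) auto
    also have "\<dots> \<le> (1/4)^n" using H(3)[OF G(1) _ G(3)] G(2) K(3) by blast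
    finally show ?thesis by (simp add: ennreal_leI)
  qed
  have Smeas: "?S G \<in> borel_measurable M" if "G \<subseteq> A" for G using Ssq[OF that] by (rule square_integrable_measurable)
  obtain Y where Y: "Y \<in> borel_measurable M"
    "\<And>n. (\<integral>\<^sup>+\<omega>. ennreal ((cmod (Y \<omega> - ?S (K n) \<omega>))\<^sup>2) \<partial>M) \<le> ennreal ((1/4)^n)"
    using L2_complete[of "\<lambda>n. ?S (K n)", OF Smeas[OF K(2)] Kbound[OF K(1) Kmono K(2)]] by blast
  \<comment> \<open>The factor 4 is 2 + 2 from \<open>nn_integral_norm_sq_add_le\<close>, both
    distances being at most \<open>(1/4)^n\<close>.\<close>
  have bound: "(\<integral>\<^sup>+\<omega>. ennreal ((cmod (Y \<omega> - ?S G \<omega>))\<^sup>2) \<partial>M) \<le> ennreal (4 * (1/4)^n)"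
    if G: "finite G" "K n \<subseteq> G" "G \<subseteq> A" for G n
  proof -
    have [measurable]: "?S G \<in> borel_measurable M" "?S (K n) \<in> borel_measurable M"
      "Y \<in> borel_measurable M" using Smeas G K(2) Y(1) by auto
    have "(\<integral>\<^sup>+\<omega>. ennreal ((cmod (Y \<omega> - ?S G \<omega>))\<^sup>2) \<partial>M) =
      (\<integral>\<^sup>+\<omega>. ennreal ((cmod ((Y \<omega> - ?S (K n) \<omega>) + (?S (K n) \<omega> - ?S G \<omega>)))\<^sup>2) \<partial>M)"
      by simp
    also have "\<dots> \<le> 2 * (\<integral>\<^sup>+\<omega>. ennreal ((cmod (Y \<omega> - ?S (K n) \<omega>))\<^sup>2) \<partial>M)
        + 2 * (\<integral>\<^sup>+\<omega>. ennreal ((cmod (?S (K n) \<omega> - ?S G \<omega>))\<^sup>2) \<partial>M)"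
      by (rule nn_integral_norm_sq_add_le) measurable
    also have "\<dots> \<le> 2 * ennreal ((1/4)^n) + 2 * ennreal ((1/4)^n)"
      using Y(2)[of n] Kbound[OF G] by (intro add_mono mult_left_mono) (auto simp: norm_minus_commute)
    also have "\<dots> = ennreal (2 * (1/4)^n + 2 * (1/4)^n)"
      by (subst ennreal_plus) (auto simp: ennreal_mult)
    finally show ?thesis by simp
  qed
  have "L2_tendsto M ?S Y (finite_subsets_at_top A)"
    unfolding L2_tendsto_def
  proof (rule order_tendstoI)
    fix x :: ennreal assume "0 < x"
    have "(\<lambda>n. ennreal (4 * (1/4)^n)) \<longlonglongrightarrow> ennreal (4 * 0)"
      by (intro tendsto_ennrealI tendsto_intros LIMSEQ_power_zero) auto
    from order_tendstoD(2)[OF this, of x] \<open>0 < x\<close> obtain n where lt: "ennreal (4 * (1/4)^n) < x"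
      by (auto simp: eventually_sequentially)
    show "\<forall>\<^sub>F G in finite_subsets_at_top A. (\<integral>\<^sup>+\<omega>. ennreal ((cmod (Y \<omega> - ?S G \<omega>))\<^sup>2) \<partial>M) < x"
      unfolding eventually_finite_subsets_at_top
      using K[of n] by (intro exI[of _ "K n"] conjI allI impI order_le_less_trans[OF bound lt]) auto
  qed simp
  then show ?thesis using Y(1) by blast
qed

section \<open>Gaussian variables\<close>

lemma real_distribution_centered_normal:
  "0 \<le> s \<Longrightarrow> real_distribution (centered_normal s)"
  unfolding centered_normal_def real_distribution_def real_distribution_axioms_def
  by (auto simp: prob_space_return intro!: prob_space_normal_density)

lemma char_centered_normal:
  assumes "0 \<le> s"
  shows "char (centered_normal s) t = complex_of_real (exp (- (t\<^sup>2 * s\<^sup>2) / 2))"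
proof (cases "s = 0")
  case True
  then show ?thesis by (simp add: centered_normal_def char_def integral_return)
next
  case False
  with assms have s: "0 < s" by simp
  have "char (centered_normal s) t = (\<integral>x. normal_density 0 s x *\<^sub>R iexp (t * x) \<partial>lborel)"
    unfolding char_def centered_normal_def using s by (simp add: integral_density)
  \<comment> \<open>Rescaling by \<open>s\<close> reduces the integral to the standard normal
    characteristic function at \<open>t * s\<close>; the factor \<open>\<bar>s\<bar>\<close> cancels
    the one in the density.\<close>
  also have "\<dots> = \<bar>s\<bar> *\<^sub>R (\<integral>x. normal_density 0 s (0 + s * x) *\<^sub>R iexp (t * (0 + s * x)) \<partial>lborel)"
    by (rule lborel_integral_real_affine) (use s in auto)
  also have "\<dots> = (\<integral>x. \<bar>s\<bar> *\<^sub>R (normal_density 0 s (0 + s * x) *\<^sub>R iexp (t * (0 + s * x))) \<partial>lborel)"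
    by (rule integral_scaleR_right[symmetric])
  also have "\<dots> = (\<integral>x. std_normal_density x *\<^sub>R iexp ((t * s) * x) \<partial>lborel)"
    using s by (intro Bochner_Integration.integral_cong)
      (auto simp: normal_density_def real_sqrt_mult power_mult_distrib field_simps)
  also have "\<dots> = char std_normal_distribution (t * s)"
    unfolding char_def by (simp add: integral_density)
  finally show ?thesis by (simp add: char_std_normal_distribution power_mult_distrib)
qed

lemma second_moment_centered_normal:
  assumes "0 \<le> s"
  shows "integrable (centered_normal s) (\<lambda>x. x\<^sup>2)" "(\<integral>x. x\<^sup>2 \<partial>centered_normal s) = s\<^sup>2"
proof -
  have "integrable (centered_normal s) (\<lambda>x. x\<^sup>2) \<and> (\<integral>x. x\<^sup>2 \<partial>centered_normal s) = s\<^sup>2"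
  proof (cases "s = 0")
    case True
    have "integrable (return borel 0) (\<lambda>x::real. x\<^sup>2)"
      by (rule integrableI_bounded) (auto simp: nn_integral_return)
    then show ?thesis using True by (simp add: centered_normal_def integral_return)
  next
    case False
    with assms have s: "0 < s" by simp
    have "has_bochner_integral lborel (\<lambda>x. normal_density 0 s x * (x - 0)^(2 * 1)) (fact (2 * 1) / ((2 / s\<^sup>2)^1 * fact 1))"
      by (rule normal_moment_even[OF s])
    then have "has_bochner_integral lborel (\<lambda>x. normal_density 0 s x * x\<^sup>2) (s\<^sup>2)"
      by simp
    then show ?thesis unfolding centered_normal_def using s
      by (simp add: integral_density integrable_density has_bochner_integral_iff)
  qed
  then show "integrable (centered_normal s) (\<lambda>x. x\<^sup>2)" "(\<integral>x. x\<^sup>2 \<partial>centered_normal s) = s\<^sup>2" by auto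
qed

lemma AE_real_eq_Re:
  "AE \<omega> in M. X \<omega> \<in> \<real> \<Longrightarrow> AE \<omega> in M. X \<omega> = complex_of_real (Re (X \<omega>))"
  by (rule AE_mp) (auto simp: complex_is_Real_iff complex_eq_iff)

text \<open>This makes the parameter \<open>s\<close> visible in the covariance: its square is the
  second moment, with or without a conjugate because the variable is almost surely real.\<close>

lemma centered_normal_real_variable:
  fixes X :: "'w \<Rightarrow> complex"
  assumes X: "X \<in> borel_measurable M" and real: "AE \<omega> in M. X \<omega> \<in> \<real>"
    and dist: "distr M borel (\<lambda>\<omega>. Re (X \<omega>)) = centered_normal s" and s: "0 \<le> s"
  shows "square_integrable M X" "(\<integral>\<omega>. X \<omega> * X \<omega> \<partial>M) = complex_of_real (s\<^sup>2)"
    "(\<integral>\<omega>. cnj (X \<omega>) * X \<omega> \<partial>M) = complex_of_real (s\<^sup>2)"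
proof -
  note [measurable] = X
  have "integrable M (\<lambda>\<omega>. (Re (X \<omega>))\<^sup>2)" "(\<integral>\<omega>. (Re (X \<omega>))\<^sup>2 \<partial>M) = s\<^sup>2"
    using second_moment_centered_normal[OF s] unfolding dist[symmetric]
    by (simp_all add: integrable_distr_eq integral_distr)
  note sq = this
  have AE: "AE \<omega> in M. X \<omega> = complex_of_real (Re (X \<omega>))" using real by (rule AE_real_eq_Re)
  have "integrable M (\<lambda>\<omega>. (cmod (complex_of_real (Re (X \<omega>))))\<^sup>2)" using sq(1) by simp
  then have "square_integrable M (\<lambda>\<omega>. complex_of_real (Re (X \<omega>)))"
    unfolding square_integrable_def by simp
  then show "square_integrable M X"
    by (rule square_integrable_AE_cong) (use AE in auto)
  have "(\<integral>\<omega>. X \<omega> * X \<omega> \<partial>M) = (\<integral>\<omega>. complex_of_real ((Re (X \<omega>))\<^sup>2) \<partial>M)"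
    by (rule integral_cong_AE) (use AE in \<open>auto simp: power2_eq_square\<close>)
  also have "\<dots> = complex_of_real (s\<^sup>2)" unfolding integral_complex_of_real sq(2) ..
  finally show "(\<integral>\<omega>. X \<omega> * X \<omega> \<partial>M) = complex_of_real (s\<^sup>2)" .
  have "(\<integral>\<omega>. cnj (X \<omega>) * X \<omega> \<partial>M) = (\<integral>\<omega>. X \<omega> * X \<omega> \<partial>M)"
    by (rule integral_cong_AE) (use real in \<open>auto simp: Reals_cnj_iff elim: AE_mp\<close>)
  then show "(\<integral>\<omega>. cnj (X \<omega>) * X \<omega> \<partial>M) = complex_of_real (s\<^sup>2)"
    using \<open>(\<integral>\<omega>. X \<omega> * X \<omega> \<partial>M) = complex_of_real (s\<^sup>2)\<close> by simp
qed

lemma norm_iexp_diff_le: "cmod (iexp x - iexp y) \<le> \<bar>x - y\<bar>"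
proof -
  have "iexp x - iexp y = iexp y * (iexp (x - y) - 1)"
    by (simp add: algebra_simps flip: exp_add)
  then have "cmod (iexp x - iexp y) = cmod (iexp (x - y) - 1)" by (simp add: norm_mult)
  also have "\<dots> \<le> \<bar>x - y\<bar>" using iexp_approx1[of "x - y" 0] by simp
  finally show ?thesis .
qed

text \<open>The form \<open>exp (- (t\<^sup>2 * v) / 2)\<close> of the characteristic function
  survives the limit: the second moments converge, and characteristic functions are Lipschitz with
  respect to mean square distance. The filter is arbitrary, so that the lemma applies directly to
  sums over finite sets of vertices.\<close>

lemma (in prob_space) gaussian_L2_limit:
  fixes X :: "'i \<Rightarrow> 'a \<Rightarrow> complex"
  assumes ne: "F \<noteq> bot" and lim: "L2_tendsto M X Y F" and Y[measurable]: "Y \<in> borel_measurable M"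
    and X: "\<forall>\<^sub>F i in F. X i \<in> borel_measurable M \<and> (AE \<omega> in M. X i \<omega> \<in> \<real>) \<and>
       (\<exists>s\<ge>0. distr M borel (\<lambda>\<omega>. Re (X i \<omega>)) = centered_normal s)"
  shows "AE \<omega> in M. Y \<omega> \<in> \<real>" "\<exists>s\<ge>0. distr M borel (\<lambda>\<omega>. Re (Y \<omega>)) = centered_normal s"
proof -
  have Xsq: "\<forall>\<^sub>F i in F. square_integrable M (X i)"
    using X by eventually_elim (auto intro: centered_normal_real_variable)
  have Ysq: "square_integrable M Y" by (rule L2_tendsto_square_integrable[OF ne lim Y Xsq])
  \<comment> \<open>The approximants are real, so their conjugates also tend to \<open>Y\<close>; on
    the other hand they tend to the conjugate of \<open>Y\<close>.\<close>
  have "L2_tendsto M (\<lambda>i \<omega>. cnj (X i \<omega>)) Y F"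
    unfolding L2_tendsto_def
  proof (rule Lim_transform_eventually)
    show "((\<lambda>i. \<integral>\<^sup>+\<omega>. ennreal ((cmod (Y \<omega> - X i \<omega>))\<^sup>2) \<partial>M) \<longlongrightarrow> 0) F"
      using lim unfolding L2_tendsto_def .
    show "\<forall>\<^sub>F i in F. (\<integral>\<^sup>+\<omega>. ennreal ((cmod (Y \<omega> - X i \<omega>))\<^sup>2) \<partial>M) = (\<integral>\<^sup>+\<omega>. ennreal ((cmod (Y \<omega> - cnj (X i \<omega>)))\<^sup>2) \<partial>M)"
      using X
    proof eventually_elim
      case (elim i)
      then have "AE \<omega> in M. cnj (X i \<omega>) = X i \<omega>" by (auto simp: Reals_cnj_iff)
      then show ?case by (intro nn_integral_cong_AE) auto
    qed
  qed
  from L2_tendsto_unique[OF ne L2_tendsto_cnj[OF lim] this]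
  have "AE \<omega> in M. cnj (Y \<omega>) = Y \<omega>"
  proof
    show "\<forall>\<^sub>F i in F. (\<lambda>\<omega>. cnj (X i \<omega>)) \<in> borel_measurable M" using X by eventually_elim auto
  qed (use Y in auto)
  then show real: "AE \<omega> in M. Y \<omega> \<in> \<real>" by (auto simp: Reals_cnj_iff)
  define v where "v = (\<integral>\<omega>. (cmod (Y \<omega>))\<^sup>2 \<partial>M)"
  have v: "0 \<le> v" unfolding v_def by simp
  have var: "((\<lambda>i. \<integral>\<omega>. cnj (X i \<omega>) * X i \<omega> \<partial>M) \<longlongrightarrow> complex_of_real v) F"
  proof -
    have "(\<integral>\<omega>. cnj (Y \<omega>) * Y \<omega> \<partial>M) = complex_of_real v"
      unfolding v_def integral_complex_of_real[symmetric] complex_norm_square by (simp add: mult.commute)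
    moreover have "((\<lambda>i. \<integral>\<omega>. cnj (X i \<omega>) * X i \<omega> \<partial>M) \<longlongrightarrow> (\<integral>\<omega>. cnj (Y \<omega>) * Y \<omega> \<partial>M)) F"
      by (rule L2_tendsto_integral_mult[OF ne L2_tendsto_cnj[OF lim] lim])
        (use Xsq in \<open>auto elim: eventually_mono intro: square_integrable_cnj\<close>)
    ultimately show ?thesis by simp
  qed
  have "distr M borel (\<lambda>\<omega>. Re (Y \<omega>)) = centered_normal (sqrt v)"
  proof (rule Levy_uniqueness)
    show "real_distribution (distr M borel (\<lambda>\<omega>. Re (Y \<omega>)))"
      by (rule real_distribution_distr) simp
    show "real_distribution (centered_normal (sqrt v))"
      using v by (intro real_distribution_centered_normal) simp
    show "char (distr M borel (\<lambda>\<omega>. Re (Y \<omega>))) = char (centered_normal (sqrt v))"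
    proof
      fix t
      let ?c = "\<lambda>Z. \<integral>\<omega>. iexp (t * Re (Z \<omega>)) \<partial>M"
      have lim1: "((\<lambda>i. ?c (X i)) \<longlongrightarrow> complex_of_real (exp (- (t\<^sup>2 * v) / 2))) F"
      proof (rule Lim_transform_eventually)
        show "((\<lambda>i. complex_of_real (exp (- (t\<^sup>2 * Re (\<integral>\<omega>. cnj (X i \<omega>) * X i \<omega> \<partial>M)) / 2)))
            \<longlongrightarrow> complex_of_real (exp (- (t\<^sup>2 * v) / 2))) F"
          using tendsto_Re[OF var] by (intro tendsto_of_real tendsto_exp tendsto_divide tendsto_minus tendsto_mult tendsto_const) auto
        show "\<forall>\<^sub>F i in F. complex_of_real (exp (- (t\<^sup>2 * Re (\<integral>\<omega>. cnj (X i \<omega>) * X i \<omega> \<partial>M)) / 2)) = ?c (X i)"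
          using X
        proof eventually_elim
          case (elim i)
          then obtain s where s: "0 \<le> s" "distr M borel (\<lambda>\<omega>. Re (X i \<omega>)) = centered_normal s" by blast
          have [measurable]: "X i \<in> borel_measurable M" using elim by blast
          have "?c (X i) = char (centered_normal s) t"
            unfolding s(2)[symmetric] char_def by (simp add: integral_distr)
          then show ?case
            using char_centered_normal[OF s(1), of t] centered_normal_real_variable(3)[OF _ _ s(2,1)] elim
            by simp
        qed
      qed
      have lim2: "((\<lambda>i. ?c (X i)) \<longlongrightarrow> ?c Y) F"
      proof -
        have "((\<lambda>i. \<bar>t\<bar> * sqrt (\<integral>\<omega>. (cmod (Y \<omega> - X i \<omega>))\<^sup>2 \<partial>M)) \<longlongrightarrow> \<bar>t\<bar> * sqrt 0) F"
          by (intro tendsto_mult tendsto_const tendsto_real_sqrt L2_tendsto_norm[OF lim Ysq Xsq])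
        then have up: "((\<lambda>i. \<bar>t\<bar> * sqrt (\<integral>\<omega>. (cmod (Y \<omega> - X i \<omega>))\<^sup>2 \<partial>M)) \<longlongrightarrow> 0) F" by simp
        have "\<forall>\<^sub>F i in F. norm (?c (X i) - ?c Y) \<le> \<bar>t\<bar> * sqrt (\<integral>\<omega>. (cmod (Y \<omega> - X i \<omega>))\<^sup>2 \<partial>M)"
          using Xsq
        proof eventually_elim
          case (elim i)
          have [measurable]: "X i \<in> borel_measurable M" using elim by (rule square_integrable_measurable)
          have dsq: "square_integrable M (\<lambda>\<omega>. complex_of_real (cmod (Y \<omega> - X i \<omega>)))"
            using square_integrable_diff[OF Ysq elim] by (auto simp: square_integrable_def)
          \<comment> \<open>Pairing with the constant 1 turns Cauchy-Schwarz into the bound of the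
            first moment by the root of the second.\<close>
          have one: "square_integrable M (\<lambda>\<omega>. 1)" by (simp add: square_integrable_def)
          have dint: "integrable M (\<lambda>\<omega>. cmod (Y \<omega> - X i \<omega>))"
            using integrable_norm[OF square_integrable_mult[OF dsq one]] by simp
          have i1: "integrable M (\<lambda>\<omega>. iexp (t * Re (Z \<omega>)))" if [measurable]: "Z \<in> borel_measurable M" for Z :: "'a \<Rightarrow> complex"
            by (rule integrable_const_bound[of _ 1]) auto
          have "?c (X i) - ?c Y = (\<integral>\<omega>. iexp (t * Re (X i \<omega>)) - iexp (t * Re (Y \<omega>)) \<partial>M)"
            by (rule Bochner_Integration.integral_diff[symmetric]) (intro i1; simp)+
          also have "norm \<dots> \<le> (\<integral>\<omega>. norm (iexp (t * Re (X i \<omega>)) - iexp (t * Re (Y \<omega>))) \<partial>M)"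
            by (rule integral_norm_bound)
          also have "\<dots> \<le> (\<integral>\<omega>. \<bar>t\<bar> * cmod (Y \<omega> - X i \<omega>) \<partial>M)"
          proof (rule integral_mono)
            show "integrable M (\<lambda>\<omega>. norm (iexp (t * Re (X i \<omega>)) - iexp (t * Re (Y \<omega>))))"
              by (intro integrable_norm Bochner_Integration.integrable_diff i1; simp)
            show "integrable M (\<lambda>\<omega>. \<bar>t\<bar> * cmod (Y \<omega> - X i \<omega>))" using dint by simp
            fix \<omega>
            have "norm (iexp (t * Re (X i \<omega>)) - iexp (t * Re (Y \<omega>))) \<le> \<bar>t * Re (X i \<omega>) - t * Re (Y \<omega>)\<bar>"
              by (rule norm_iexp_diff_le)
            also have "\<dots> = \<bar>t\<bar> * \<bar>Re (Y \<omega> - X i \<omega>)\<bar>"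
              by (simp add: abs_minus_commute[of "Re (X i \<omega>)"] abs_mult flip: right_diff_distrib)
            also have "\<dots> \<le> \<bar>t\<bar> * cmod (Y \<omega> - X i \<omega>)"
              by (intro mult_left_mono abs_Re_le_cmod) auto
            finally show "norm (iexp (t * Re (X i \<omega>)) - iexp (t * Re (Y \<omega>))) \<le> \<bar>t\<bar> * cmod (Y \<omega> - X i \<omega>)" .
          qed
          also have "\<dots> = \<bar>t\<bar> * cmod (\<integral>\<omega>. complex_of_real (cmod (Y \<omega> - X i \<omega>)) * 1 \<partial>M)"
            by (simp add: integral_complex_of_real)
          also have "\<dots> \<le> \<bar>t\<bar> * sqrt (\<integral>\<omega>. (cmod (Y \<omega> - X i \<omega>))\<^sup>2 \<partial>M)"
            using norm_integral_mult_le[OF dsq one] by (intro mult_left_mono) (auto simp: prob_space)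
          finally show ?case .
        qed
        then have "((\<lambda>i. ?c (X i) - ?c Y) \<longlongrightarrow> 0) F" using up by (rule Lim_null_comparison)
        then show ?thesis by (simp add: LIM_zero_iff)
      qed
      have "?c Y = complex_of_real (exp (- (t\<^sup>2 * v) / 2))"
        by (rule tendsto_unique[OF ne lim2 lim1])
      then show "char (distr M borel (\<lambda>\<omega>. Re (Y \<omega>))) t = char (centered_normal (sqrt v)) t"
        using v char_centered_normal[of "sqrt v" t]
        unfolding char_def by (simp add: integral_distr)
    qed
  qed
  then show "\<exists>s\<ge>0. distr M borel (\<lambda>\<omega>. Re (Y \<omega>)) = centered_normal s"
    using v by (intro exI[of _ "sqrt v"]) simp
qed

section \<open>Joint laws from the laws of linear combinations\<close>

text \<open>Divided by its total mass \<open>c\<close>, the weight is a probability density, and the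
  hypothesis equates the characteristic functions of the two image laws under \<open>X\<close>. The
  value \<open>t = 0\<close> shows that \<open>c\<close> is the same for both measures; for
  \<open>c = 0\<close> both sides vanish.\<close>

lemma integral_weighted_indicator_eq:
  fixes v X :: "'w \<Rightarrow> real"
  assumes "prob_space M" "prob_space N" and sets: "sets M = sets N"
    and [measurable]: "v \<in> borel_measurable M" "X \<in> borel_measurable M" "A \<in> sets borel"
    and v: "\<And>\<omega>. 0 \<le> v \<omega>" "\<And>\<omega>. v \<omega> \<le> b"
    and char: "\<And>t. (\<integral>\<omega>. v \<omega> *\<^sub>R iexp (t * X \<omega>) \<partial>M) = (\<integral>\<omega>. v \<omega> *\<^sub>R iexp (t * X \<omega>) \<partial>N)"
  shows "(\<integral>\<omega>. v \<omega> * indicator A (X \<omega>) \<partial>M) = (\<integral>\<omega>. v \<omega> * indicator A (X \<omega>) \<partial>N)"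
proof -
  interpret M: prob_space M by fact
  interpret N: prob_space N by fact
  have N[measurable]: "v \<in> borel_measurable N" "X \<in> borel_measurable N"
    using assms(4,5) sets by (auto cong: measurable_cong_sets)
  have int: "integrable M v" "integrable N v"
    by (rule M.integrable_const_bound[of _ b] N.integrable_const_bound[of _ b]; use v in auto)+
  define c where "c = (\<integral>\<omega>. v \<omega> \<partial>M)"
  have cN: "c = (\<integral>\<omega>. v \<omega> \<partial>N)"
  proof -
    have "complex_of_real (\<integral>\<omega>. v \<omega> \<partial>M) = complex_of_real (\<integral>\<omega>. v \<omega> \<partial>N)"
      using char[of 0] by (simp add: scaleR_conv_of_real)
    then show ?thesis unfolding c_def by (simp only: of_real_eq_iff)
  qed
  have c0: "0 \<le> c" unfolding c_def using v by simp
  show ?thesis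
  proof (cases "c = 0")
    case True
    have "AE \<omega> in M. v \<omega> = 0" "AE \<omega> in N. v \<omega> = 0"
      using True cN int v integral_nonneg_eq_0_iff_AE[of M v] integral_nonneg_eq_0_iff_AE[of N v]
      unfolding c_def by auto
    then have "(\<integral>\<omega>. v \<omega> * indicator A (X \<omega>) \<partial>M) = (\<integral>\<omega>. 0 \<partial>M)" "(\<integral>\<omega>. v \<omega> * indicator A (X \<omega>) \<partial>N) = (\<integral>\<omega>. 0 \<partial>N)"
      by (intro integral_cong_AE; auto)+
    then show ?thesis by simp
  next
    case False
    with c0 have c: "0 < c" by simp
    let ?d = "\<lambda>\<omega>. ennreal (v \<omega> / c)"
    have main: "real_distribution (distr (density Q ?d) borel X)"
      "char (distr (density Q ?d) borel X) t = (\<integral>\<omega>. v \<omega> *\<^sub>R iexp (t * X \<omega>) \<partial>Q) / c"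
      "measure (distr (density Q ?d) borel X) A = (\<integral>\<omega>. v \<omega> * indicator A (X \<omega>) \<partial>Q) / c"
      if [measurable]: "v \<in> borel_measurable Q" "X \<in> borel_measurable Q" and Q: "integrable Q v" "(\<integral>\<omega>. v \<omega> \<partial>Q) = c"
      for Q :: "'w measure" and t
    proof -
      have "(\<integral>\<^sup>+\<omega>. ennreal (v \<omega> / c) \<partial>Q) = ennreal (\<integral>\<omega>. v \<omega> / c \<partial>Q)"
        using Q v c by (intro nn_integral_eq_integral) auto
      also have "\<dots> = 1" using Q c by simp
      finally have "prob_space (density Q ?d)"
        by (intro prob_spaceI) (simp add: emeasure_density cong: nn_integral_cong)
      then interpret D: prob_space "density Q ?d" .
      show rd: "real_distribution (distr (density Q ?d) borel X)"
        by (rule D.real_distribution_distr) simp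
      then interpret R: real_distribution "distr (density Q ?d) borel X" .
      have "char (distr (density Q ?d) borel X) t = (\<integral>\<omega>. (v \<omega> / c) *\<^sub>R iexp (t * X \<omega>) \<partial>Q)"
        unfolding char_def using v c by (simp add: integral_distr integral_density)
      also have "\<dots> = (\<integral>\<omega>. (v \<omega> *\<^sub>R iexp (t * X \<omega>)) / c \<partial>Q)"
        by (intro Bochner_Integration.integral_cong) (auto simp: scaleR_conv_of_real)
      finally show "char (distr (density Q ?d) borel X) t = (\<integral>\<omega>. v \<omega> *\<^sub>R iexp (t * X \<omega>) \<partial>Q) / c" by simp
      have "measure (distr (density Q ?d) borel X) A = (\<integral>x. indicator A x \<partial>distr (density Q ?d) borel X)"
        by simp
      also have "\<dots> = (\<integral>\<omega>. (v \<omega> / c) *\<^sub>R indicator A (X \<omega>) \<partial>Q)"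
        using v c by (subst integral_distr) (auto simp: integral_density)
      finally show "measure (distr (density Q ?d) borel X) A = (\<integral>\<omega>. v \<omega> * indicator A (X \<omega>) \<partial>Q) / c"
        by simp
    qed
    have "distr (density M ?d) borel X = distr (density N ?d) borel X"
    proof (rule Levy_uniqueness)
      show "char (distr (density M ?d) borel X) = char (distr (density N ?d) borel X)"
        using main(2)[of M] main(2)[of N] int c_def cN char by (intro ext) simp
    qed (use main(1)[of M] main(1)[of N] int c_def cN in auto)
    then have "(\<integral>\<omega>. v \<omega> * indicator A (X \<omega>) \<partial>M) / c = (\<integral>\<omega>. v \<omega> * indicator A (X \<omega>) \<partial>N) / c"
      using main(3)[of M] main(3)[of N] int c_def cN by simp
    then show ?thesis using c by simp
  qed
qed

lemma (in prob_space) integrable_weighted_iexp: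
  fixes w X :: "'a \<Rightarrow> real"
  assumes [measurable]: "w \<in> borel_measurable M" "X \<in> borel_measurable M" and "\<And>x. 0 \<le> w x" "\<And>x. w x \<le> 1"
  shows "integrable M (\<lambda>x. w x *\<^sub>R iexp (X x))"
  by (rule integrable_const_bound[of _ 1]) (use assms in auto)

lemma Re_mult_iexp: "complex_of_real (Re (c * iexp y)) = c / 2 * iexp y + cnj c / 2 * iexp (- y)"
proof -
  have "complex_of_real (Re z) = z / 2 + cnj z / 2" for z by (simp add: complex_eq_iff)
  moreover have "cnj (iexp y) = iexp (- y)" by (simp add: exp_cnj)
  ultimately show ?thesis by (simp only: complex_cnj_mult) simp
qed

text \<open>The factors 0, 1 and -1 in front of \<open>Y x\<close> are kept explicit: all three
  exponents then have the form of a linear combination of \<open>Y\<close> and \<open>Z\<close>, for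
  which equality of the transforms under the two measures is the induction hypothesis.\<close>

lemma (in prob_space) integral_modulated_weight:
  fixes w Y Z :: "'a \<Rightarrow> real"
  assumes [measurable]: "w \<in> borel_measurable M" "Y \<in> borel_measurable M" "Z \<in> borel_measurable M"
    and w: "\<And>x. 0 \<le> w x" "\<And>x. w x \<le> 1"
  shows "(\<integral>x. (w x * (1 + Re (c * iexp (Y x)))) *\<^sub>R iexp (t * Z x) \<partial>M) =
    (\<integral>x. w x *\<^sub>R iexp (0 * Y x + t * Z x) \<partial>M) + c / 2 * (\<integral>x. w x *\<^sub>R iexp (1 * Y x + t * Z x) \<partial>M)
      + cnj c / 2 * (\<integral>x. w x *\<^sub>R iexp ((- 1) * Y x + t * Z x) \<partial>M)"
proof -
  have "(w x * (1 + Re (c * iexp (Y x)))) *\<^sub>R iexp (t * Z x) = w x *\<^sub>R iexp (0 * Y x + t * Z x)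
      + c / 2 * (w x *\<^sub>R iexp (1 * Y x + t * Z x)) + cnj c / 2 * (w x *\<^sub>R iexp ((- 1) * Y x + t * Z x))" for x
  proof -
    have "iexp (a * Y x + t * Z x) = iexp (a * Y x) * iexp (t * Z x)" for a
      by (simp add: distrib_left flip: exp_add)
    note exp = this
    show ?thesis
      unfolding scaleR_conv_of_real of_real_mult[of "w x"] of_real_add[of 1] Re_mult_iexp exp
      by (simp add: algebra_simps)
  qed
  moreover have "integrable M (\<lambda>x. w x *\<^sub>R iexp (a * Y x + t * Z x))" for a
    by (rule integrable_weighted_iexp[OF _ _ w]) auto
  ultimately show ?thesis
    by (simp only:) (intro has_bochner_integral_integral_eq has_bochner_integral_add
        has_bochner_integral_mult_right has_bochner_integral_integrable)
qed

text \<open>Because \<open>Re (- \<i> * z) = Im z\<close>, the values 1 and \<open>- \<i>\<close> of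
  \<open>c\<close> give the real and the imaginary part, while \<open>J 0\<close> removes the
  unmodulated mass.\<close>

lemma (in prob_space) integral_weighted_iexp:
  fixes w Y :: "'a \<Rightarrow> real"
  assumes [measurable]: "w \<in> borel_measurable M" "Y \<in> borel_measurable M" and w: "\<And>x. 0 \<le> w x" "\<And>x. w x \<le> 1"
  defines "J \<equiv> \<lambda>c. \<integral>x. w x * (1 + Re (c * iexp (Y x))) \<partial>M"
  shows "(\<integral>x. w x *\<^sub>R iexp (Y x) \<partial>M) = Complex (J 1 - J 0) (J (- \<i>) - J 0)"
proof -
  have int: "integrable M (\<lambda>x. w x *\<^sub>R iexp (Y x))" "integrable M w"
    using integrable_weighted_iexp[OF assms(1,2) w] integrable_weighted_iexp[OF assms(1) _ w, of "\<lambda>_. 0"]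
    by (simp_all add: scaleR_conv_of_real complex_of_real_integrable_eq)
  have "J c - J 0 = Re (c * (\<integral>x. w x *\<^sub>R iexp (Y x) \<partial>M))" for c
  proof -
    have "Re (c * (\<integral>x. w x *\<^sub>R iexp (Y x) \<partial>M)) = (\<integral>x. Re (c * (w x *\<^sub>R iexp (Y x))) \<partial>M)"
      unfolding integral_mult_right_zero[symmetric]
      by (rule integral_Re[OF integrable_mult_right[OF int(1)], symmetric])
    moreover have "J c = (\<integral>x. w x + Re (c * (w x *\<^sub>R iexp (Y x))) \<partial>M)"
      unfolding J_def by (intro Bochner_Integration.integral_cong refl) (simp add: algebra_simps)
    moreover have "\<dots> = (\<integral>x. w x \<partial>M) + (\<integral>x. Re (c * (w x *\<^sub>R iexp (Y x))) \<partial>M)"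
      by (intro Bochner_Integration.integral_add int(2) integrable_Re integrable_mult_right int(1))
    moreover have "J 0 = (\<integral>x. w x \<partial>M)" by (simp add: J_def)
    ultimately show ?thesis by (simp only: add_diff_cancel_left')
  qed
  then show ?thesis by (simp add: complex_eq_iff)
qed

text \<open>
  One coordinate is fixed at a time. The one-dimensional uniqueness theorem applies to the
  complex densities \<open>w exp (i Y)\<close> because they are combinations of the nonnegative weights
  \<open>w (1 + Re (c exp (i Y)))\<close> with \<open>c\<close> among \<open>0\<close>, \<open>1\<close> and \<open>-i\<close>.
\<close>

lemma joint_law_unique:
  fixes M N :: "'w measure" and H :: "('w \<Rightarrow> real) set"
  assumes M: "prob_space M" and N: "prob_space N" and sets: "sets M = sets N"
    and meas: "\<And>X. X \<in> H \<Longrightarrow> X \<in> borel_measurable M"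
    and lin: "\<And>X Y a b. X \<in> H \<Longrightarrow> Y \<in> H \<Longrightarrow> (\<lambda>x. a * X x + b * Y x) \<in> H"
    and law: "\<And>X. X \<in> H \<Longrightarrow> distr M borel X = distr N borel X"
    and K: "finite K" and X: "\<And>k. k \<in> K \<Longrightarrow> X k \<in> H" and A: "\<And>k. k \<in> K \<Longrightarrow> A k \<in> sets borel"
  shows "(\<integral>x. (\<Prod>k\<in>K. indicator (A k) (X k x)) \<partial>M) = (\<integral>x. (\<Prod>k\<in>K. indicator (A k) (X k x)) \<partial>N :: real)"
proof (cases "H = {}")
  case True
  then have "K = {}" using X by blast
  then show ?thesis using M N by (simp add: prob_space.prob_space)
next
  case False
  interpret M: prob_space M by fact
  interpret N: prob_space N by fact
  let ?w = "\<lambda>K x. (\<Prod>k\<in>K. indicator (A k) (X k x)) :: real"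
  let ?P = "\<lambda>w. \<forall>Y\<in>H. (\<integral>x. w x *\<^sub>R iexp (Y x) \<partial>M) = (\<integral>x. w x *\<^sub>R iexp (Y x) \<partial>N)"
  have measN: "f \<in> borel_measurable M \<Longrightarrow> f \<in> borel_measurable N" for f :: "'w \<Rightarrow> real"
    using sets by (simp cong: measurable_cong_sets)
  have zero: "(\<lambda>x. 0) \<in> H" using False lin[of _ _ 0 0] by auto
  have w01: "0 \<le> ?w K x" "?w K x \<le> 1" for K x by (auto intro: prod_nonneg prod_le_1)
  have step: "?P (\<lambda>x. w x * indicator B (Z x))"
    if P: "?P w" and w[measurable]: "w \<in> borel_measurable M" and w01: "\<And>x. 0 \<le> w x" "\<And>x. w x \<le> 1"
      and Z: "Z \<in> H" and B[measurable]: "B \<in> sets borel" for w Z B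
  proof
    fix Y assume Y: "Y \<in> H"
    note [measurable] = meas[OF Z] meas[OF Y] measN[OF w] measN[OF meas[OF Z]] measN[OF meas[OF Y]]
    have J: "(\<integral>x. (w x * indicator B (Z x)) * (1 + Re (c * iexp (Y x))) \<partial>M) =
        (\<integral>x. (w x * indicator B (Z x)) * (1 + Re (c * iexp (Y x))) \<partial>N)" if c: "cmod c \<le> 1" for c
    proof -
      have g: "\<bar>Re (c * iexp (Y x))\<bar> \<le> 1" for x
        using abs_Re_le_cmod[of "c * iexp (Y x)"] c by (simp add: norm_mult)
      have "(\<integral>x. (w x * (1 + Re (c * iexp (Y x)))) * indicator B (Z x) \<partial>M) =
          (\<integral>x. (w x * (1 + Re (c * iexp (Y x)))) * indicator B (Z x) \<partial>N)"
      \<comment> \<open>The bound is a product of bounds: \<open>w\<close> is at most 1 and, since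
        \<open>cmod c \<le> 1\<close>, the modulating factor lies between 0 and 2.\<close>
      proof (rule integral_weighted_indicator_eq[OF M N sets, where b = "1 * 2"])
        show "0 \<le> w x * (1 + Re (c * iexp (Y x)))" for x
          using g[of x] w01(1) by (intro mult_nonneg_nonneg) auto
        show "w x * (1 + Re (c * iexp (Y x))) \<le> 1 * 2" for x
          using g[of x] w01[of x] by (intro mult_mono) auto
        show "(\<integral>x. (w x * (1 + Re (c * iexp (Y x)))) *\<^sub>R iexp (t * Z x) \<partial>M) =
            (\<integral>x. (w x * (1 + Re (c * iexp (Y x)))) *\<^sub>R iexp (t * Z x) \<partial>N)" for t
          unfolding M.integral_modulated_weight[OF w meas[OF Y] meas[OF Z] w01]
            N.integral_modulated_weight[OF measN[OF w] measN[OF meas[OF Y]] measN[OF meas[OF Z]] w01]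
          by (simp only: bspec[OF P lin[OF Y Z]])
      qed measurable
      then show ?thesis by (simp add: mult_ac)
    qed
    have b: "0 \<le> w x * indicator B (Z x)" "w x * indicator B (Z x) \<le> 1" for x
      using w01[of x] by (auto simp: indicator_def)
    show "(\<integral>x. (w x * indicator B (Z x)) *\<^sub>R iexp (Y x) \<partial>M) = (\<integral>x. (w x * indicator B (Z x)) *\<^sub>R iexp (Y x) \<partial>N)"
      by (subst M.integral_weighted_iexp[OF _ _ b] N.integral_weighted_iexp[OF _ _ b], measurable)+
        (simp only: J norm_zero norm_one norm_minus_cancel norm_ii zero_le_one order_refl)
  qed
  have "?P (?w K) \<and> ?w K \<in> borel_measurable M"
    using K X A
  proof (induction K rule: finite_induct)
    case empty
    have "(\<integral>x. iexp (Y x) \<partial>M) = (\<integral>x. iexp (Y x) \<partial>N)" if "Y \<in> H" for Y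
      using integral_distr[OF meas[OF that], of iexp] integral_distr[OF measN[OF meas[OF that]], of iexp]
      by (simp add: law[OF that])
    then show ?case by simp
  next
    case (insert k K)
    then have P: "?P (?w K)" and [measurable]: "?w K \<in> borel_measurable M" "X k \<in> borel_measurable M" "A k \<in> sets borel"
      using meas by auto
    have "?P (\<lambda>x. ?w K x * indicator (A k) (X k x))"
      using insert by (intro step P w01) auto
    moreover have "(\<lambda>x. ?w K x * indicator (A k) (X k x)) \<in> borel_measurable M" by measurable
    ultimately show ?case using insert(1,2) by (simp add: mult.commute)
  qed
  \<comment> \<open>With the zero variable in the exponent the transform of the product weight is
    its plain integral.\<close>
  from bspec[OF conjunct1[OF this] zero]
  have "(\<integral>x. ?w K x *\<^sub>R iexp 0 \<partial>M) = (\<integral>x. ?w K x *\<^sub>R iexp 0 \<partial>N)" .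
  then have "complex_of_real (\<integral>x. ?w K x \<partial>M) = complex_of_real (\<integral>x. ?w K x \<partial>N)"
    by (simp only: integral_complex_of_real[symmetric] scaleR_conv_of_real of_real_0 mult_zero_right exp_zero mult_1_right)
  then show ?thesis by (simp only: of_real_eq_iff)
qed

section \<open>Balls and wavelet kernels\<close>

text \<open>The kernel of the orthogonal projection onto the wavelet space of \<open>I\<close>.\<close>

definition wavelet_kernel :: "'a::metric_space measure \<Rightarrow> 'a set \<Rightarrow> 'a \<Rightarrow> 'a \<Rightarrow> real" where
  "wavelet_kernel \<nu> I x y =
     (\<Sum>M\<in>max_subballs I. indicator M x * indicator M y / measure \<nu> M)
     - indicator I x * indicator I y / measure \<nu> I"

text \<open>By \<open>two\<close> every ball is a vertex: a ball of diameter zero is then a maximal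
  subball of a larger one. Vertices and balls coincide from here on. In the theorem this follows
  from the existence of the vertex \<open>R\<close>.\<close>

locale regular_ultrametric =
  fixes \<nu> :: "'a::metric_space measure"
  assumes ultra: "\<And>x y z :: 'a. dist x y \<le> max (dist x z) (dist y z)"
    and reg: "regular_balls TYPE('a)"
    and sets_eq: "sets \<nu> = sets borel"
    and ball_measure: "\<And>D. is_ball D \<Longrightarrow> 0 < emeasure \<nu> D \<and> emeasure \<nu> D < \<infinity>"
    and two: "\<exists>x y :: 'a. x \<noteq> y"
begin

lemma nested: "is_ball D \<Longrightarrow> is_ball E \<Longrightarrow> D \<inter> E \<noteq> {} \<Longrightarrow> D \<subseteq> E \<or> E \<subseteq> D" for D E :: "'a set"
  by (rule balls_nested[OF ultra reg])

lemma ball_nonempty: "is_ball D \<Longrightarrow> D \<noteq> {}" for D :: "'a set"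
  by (rule ball_props(1)[OF ultra reg])

lemma ball_in_ball_tree: "I \<in> ball_tree \<longleftrightarrow> is_ball I" for I :: "'a set"
  using ball_in_tree[OF ultra reg two] by (auto simp: ball_tree_def)

lemma nonminimal_iff: "I \<in> nonminimal \<longleftrightarrow> is_ball I \<and> (\<exists>J. is_ball J \<and> J \<subset> I)" for I :: "'a set"
  unfolding nonminimal_def Bex_def ball_in_ball_tree by blast

lemma nonminimal_ball: "I \<in> nonminimal \<Longrightarrow> is_ball I" for I :: "'a set"
  by (simp add: nonminimal_iff)

lemma nonminimal_diameter: "I \<in> nonminimal \<Longrightarrow> diameter I \<noteq> 0" for I :: "'a set"
  using diameter_nonzero[OF ultra reg] ball_nonempty by (auto simp: nonminimal_iff)

lemma ball_measurable [measurable]: "is_ball B \<Longrightarrow> B \<in> sets \<nu>"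
  using ball_props(3)[OF ultra reg, of B] by (simp add: sets_eq borel_closed)

lemma ball_fmeasurable: "is_ball B \<Longrightarrow> B \<in> fmeasurable \<nu>"
  using ball_measure by (auto simp: fmeasurable_def ball_measurable)

lemma ball_measure_pos: "is_ball B \<Longrightarrow> 0 < measure \<nu> B"
  using ball_measure[of B] by (simp add: measure_def enn2real_positive_iff)

lemma max_subball: "M \<in> max_subballs I \<Longrightarrow> is_ball M \<and> M \<subset> I" for M I :: "'a set"
  by (simp add: max_subballs_def)

lemma max_subball_maximal: "M \<in> max_subballs I \<Longrightarrow> is_ball K \<Longrightarrow> M \<subset> K \<Longrightarrow> \<not> K \<subset> I" for M K I :: "'a set"
  by (simp add: max_subballs_def)

lemma finite_max_subballs: "I \<in> nonminimal \<Longrightarrow> finite (max_subballs I)" for I :: "'a set"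
  using max_subballs_cover(1)[OF ultra reg] nonminimal_ball nonminimal_diameter by blast

lemma Union_max_subballs: "I \<in> nonminimal \<Longrightarrow> \<Union>(max_subballs I) = I" for I :: "'a set"
  using max_subballs_cover(2)[OF ultra reg] nonminimal_ball nonminimal_diameter by blast

lemma max_subball_unique:
  "M \<in> max_subballs I \<Longrightarrow> N \<in> max_subballs I \<Longrightarrow> x \<in> M \<Longrightarrow> x \<in> N \<Longrightarrow> M = N" for M N I :: "'a set"
proof (rule ccontr)
  assume M: "M \<in> max_subballs I" and N: "N \<in> max_subballs I" and "x \<in> M" "x \<in> N" "M \<noteq> N"
  then have "M \<subset> N \<or> N \<subset> M" using nested[of M N] max_subball[OF M] max_subball[OF N] by blast
  then show False
    using max_subball_maximal[OF M, of N] max_subball_maximal[OF N, of M] max_subball[OF M] max_subball[OF N] by auto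
qed

lemma sum_max_subballs:
  fixes c :: "'a set \<Rightarrow> 'b::comm_ring_1"
  assumes I: "I \<in> nonminimal" and M: "M \<in> max_subballs I" "x \<in> M"
  shows "(\<Sum>N\<in>max_subballs I. c N * indicator N x) = c M"
proof -
  have "(\<Sum>N\<in>max_subballs I. c N * indicator N x) = (\<Sum>N\<in>max_subballs I. if N = M then c M else 0)"
  proof (intro sum.cong refl)
    fix N assume N: "N \<in> max_subballs I"
    have "x \<in> N \<longleftrightarrow> N = M" using max_subball_unique[OF N M(1) _ M(2)] M(2) by metis
    then show "c N * indicator N x = (if N = M then c M else 0)" by (auto simp: indicator_def)
  qed
  then show ?thesis using finite_max_subballs[OF I] M(1) by simp
qed

lemma sum_max_subballs_outside:
  fixes c :: "'a set \<Rightarrow> 'b::comm_ring_1"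
  assumes "x \<notin> I"
  shows "(\<Sum>N\<in>max_subballs I. c N * indicator N x) = 0"
  using assms by (intro sum.neutral) (auto simp: indicator_def max_subballs_def)

lemma pred_vertex_eq:
  fixes I :: "'a set"
  assumes M: "M \<in> max_subballs I" and B: "B \<subseteq> M" "B \<noteq> {}"
  shows "pred_vertex I B = M"
  unfolding pred_vertex_def
proof (rule Greatest_equality)
  show "M \<in> ball_tree \<and> M \<subset> I \<and> B \<subseteq> M" using M B max_subball by (auto simp: ball_in_ball_tree)
  fix K assume K: "K \<in> ball_tree \<and> K \<subset> I \<and> B \<subseteq> K"
  then have "K \<inter> M \<noteq> {}" using B by blast
  then have "K \<subseteq> M \<or> M \<subseteq> K" using nested[of K M] K max_subball[OF M] by (simp add: ball_in_ball_tree)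
  then show "K \<subseteq> M" using K M by (auto simp: max_subballs_def ball_in_ball_tree)
qed

lemma ball_below_max_subball:
  fixes I B :: "'a set"
  assumes "is_ball I" "is_ball B" "B \<subset> I"
  shows "\<exists>M\<in>max_subballs I. B \<subseteq> M"
  using step_down[OF ultra reg assms(2,1,3)] by metis

lemma pred_vertex_max_subball:
  fixes I B :: "'a set"
  assumes "is_ball I" "is_ball B" "B \<subset> I"
  shows "pred_vertex I B \<in> max_subballs I" "B \<subseteq> pred_vertex I B"
proof -
  obtain M where M: "M \<in> max_subballs I" "B \<subseteq> M" using ball_below_max_subball[OF assms] by blast
  then have "pred_vertex I B = M" using ball_nonempty[OF assms(2)] by (intro pred_vertex_eq)
  then show "pred_vertex I B \<in> max_subballs I" "B \<subseteq> pred_vertex I B" using M by auto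
qed

section \<open>The smallest ball containing two points\<close>

lemma sup_ball_eq: "sup_ball x y = (if x = y then {x} else cball x (dist x y))" for x y :: 'a
proof (cases "x = y")
  case False
  have "is_ball (cball x (dist x y))" unfolding is_ball_def using False by (metis zero_less_dist_iff)
  moreover have "cball x (dist x y) \<subseteq> D" if D: "is_ball D" "x \<in> D" "y \<in> D" for D
  proof -
    obtain r where "D = cball x r"
      using D cball_recentre[OF ultra reg] unfolding is_ball_def by metis
    then show ?thesis using D by auto
  qed
  ultimately have "sup_ball x y = cball x (dist x y)" unfolding sup_ball_def by auto
  then show ?thesis using False by simp
next
  case True
  have "z = x" if "z \<in> sup_ball x x" for z
  proof (rule ccontr)
    assume "z \<noteq> x"
    then have d: "0 < dist x z / 2" by simp
    then have "is_ball (cball x (dist x z / 2))" unfolding is_ball_def by blast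
    moreover have "x \<in> cball x (dist x z / 2)" using d by simp
    ultimately have "z \<in> cball x (dist x z / 2)" using that unfolding sup_ball_def by blast
    then show False using d by auto
  qed
  moreover have "x \<in> sup_ball x x" unfolding sup_ball_def by blast
  ultimately show ?thesis using True by auto
qed

lemma sup_ball_ball: "x \<noteq> y \<Longrightarrow> is_ball (sup_ball x y)" for x y :: 'a
  unfolding sup_ball_eq is_ball_def by (auto intro!: exI[of _ x] exI[of _ "dist x y"])

lemma sup_ball_mem: "x \<in> sup_ball x y" "y \<in> sup_ball x y" for x y :: 'a
  unfolding sup_ball_def by auto

lemma sup_ball_least: "is_ball D \<Longrightarrow> x \<in> D \<Longrightarrow> y \<in> D \<Longrightarrow> sup_ball x y \<subseteq> D" for x y :: 'a
  unfolding sup_ball_def by auto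

lemma sup_ball_nonminimal: "x \<noteq> y \<Longrightarrow> sup_ball x y \<in> nonminimal" for x y :: 'a
proof -
  assume ne: "x \<noteq> y"
  have b: "is_ball (cball x (dist x y / 2))" unfolding is_ball_def
    using ne by (intro exI[of _ x] exI[of _ "dist x y / 2"]) simp
  have "x \<in> cball x (dist x y / 2)" "y \<notin> cball x (dist x y / 2)" using ne by auto
  moreover have "cball x (dist x y / 2) \<subseteq> sup_ball x y" using ne by (simp add: sup_ball_eq subset_cball)
  ultimately have "cball x (dist x y / 2) \<subset> sup_ball x y" using sup_ball_mem(2)[of y x] by blast
  then show ?thesis using b sup_ball_ball[OF ne] unfolding nonminimal_iff by blast
qed

lemma sup_ball_in_max_subball:
  fixes I :: "'a set"
  assumes I: "I \<in> nonminimal" and M: "M \<in> max_subballs I" and xy: "x \<in> M" "y \<in> M"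
  shows "sup_ball x y \<subseteq> M" "sup_ball x y \<subset> I"
  using sup_ball_least[of M x y] max_subball[OF M] xy by auto

text \<open>A common ball strictly inside \<open>I\<close> would lie in a single maximal subball;
  containing \<open>x\<close>, that subball would be \<open>M\<close>, which misses
  \<open>y\<close>.\<close>

lemma sup_ball_eq_vertex:
  fixes I :: "'a set"
  assumes I: "I \<in> nonminimal" and M: "M \<in> max_subballs I" "x \<in> M" and y: "y \<in> I" "y \<notin> M"
  shows "sup_ball x y = I"
proof (rule ccontr)
  assume ne: "sup_ball x y \<noteq> I"
  have "x \<in> I" using M max_subball by blast
  then have "sup_ball x y \<subset> I" using ne sup_ball_least[OF nonminimal_ball[OF I] _ y(1)] by blast
  moreover have "is_ball (sup_ball x y)" using sup_ball_ball M y by metis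
  ultimately obtain N where "N \<in> max_subballs I" "sup_ball x y \<subseteq> N"
    using ball_below_max_subball[OF nonminimal_ball[OF I]] by blast
  then show False using max_subball_unique[OF M(1) _ M(2)] y(2) sup_ball_mem[where x=x and y=y] by blast
qed

lemma max_subball_ex: "I \<in> nonminimal \<Longrightarrow> x \<in> I \<Longrightarrow> \<exists>M\<in>max_subballs I. x \<in> M" for x :: 'a
  using Union_max_subballs by blast

lemma wavelet_kernel_outside: "x \<notin> I \<or> y \<notin> I \<Longrightarrow> wavelet_kernel \<nu> I x y = 0"
proof -
  assume a: "x \<notin> I \<or> y \<notin> I"
  have "(\<Sum>M\<in>max_subballs I. indicator M x * indicator M y / measure \<nu> M) = (0::real)"
    using a by (intro sum.neutral) (auto simp: indicator_def max_subballs_def)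
  then show ?thesis using a by (auto simp: wavelet_kernel_def)
qed

lemma wavelet_kernel_inside:
  assumes I: "I \<in> nonminimal" and M: "M \<in> max_subballs I" "x \<in> M" and y: "y \<in> I"
  shows "wavelet_kernel \<nu> I x y = indicator M y / measure \<nu> M - 1 / measure \<nu> I"
proof -
  have "(\<Sum>N\<in>max_subballs I. indicator N x * indicator N y / measure \<nu> N) =
    (\<Sum>N\<in>max_subballs I. (indicator N y / measure \<nu> N) * indicator N x)"
    by (intro sum.cong) auto
  also have "\<dots> = indicator M y / measure \<nu> M" by (rule sum_max_subballs[OF I M])
  finally show ?thesis using M y max_subball[OF M(1)] by (auto simp: wavelet_kernel_def)
qed

lemma wavelet_kernel_sym: "wavelet_kernel \<nu> I x y = wavelet_kernel \<nu> I y x"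
  by (simp add: wavelet_kernel_def mult.commute)

text \<open>The cases of \<open>covariation_term\<close> record the position of the points relative
  to the maximal subballs of \<open>I\<close>. In different ones only the term
  \<open>- 1 / \<nu>(I)\<close> of the kernel survives; in a common one, \<open>M\<close>, this
  \<open>M\<close> is the predecessor vertex and contributes \<open>1 / \<nu>(M)\<close> as well.
  The diagonal belongs to the second case.\<close>

lemma covariation_term_eq:
  assumes I: "I \<in> nonminimal"
  shows "covariation_term \<nu> T I x y = (inverse (psd_eigenvalue \<nu> T I))\<^sup>2 * wavelet_kernel \<nu> I x y"
proof (cases "x \<in> I \<and> y \<in> I")
  case False
  then have "I \<noteq> sup_ball x y" "\<not> sup_ball x y \<subset> I" using sup_ball_mem by blast+
  then show ?thesis using False wavelet_kernel_outside[of x I y] by (auto simp: covariation_term_def)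
next
  case True
  obtain M where M: "M \<in> max_subballs I" "x \<in> M" using max_subball_ex[OF I] True by blast
  show ?thesis
  proof (cases "y \<in> M")
    case yM: True
    have s: "sup_ball x y \<subseteq> M" "sup_ball x y \<subset> I" using sup_ball_in_max_subball[OF I M yM] by auto
    have "pred_vertex I (sup_ball x y) = M"
      using pred_vertex_eq[OF M(1) s(1)] sup_ball_mem by blast
    then show ?thesis using s yM wavelet_kernel_inside[OF I M] True
      by (auto simp: covariation_term_def divide_inverse)
  next
    case yM: False
    have "sup_ball x y = I" using sup_ball_eq_vertex[OF I M _ yM] True by blast
    then show ?thesis using yM wavelet_kernel_inside[OF I M] True
      by (auto simp: covariation_term_def divide_inverse)
  qed
qed

section \<open>Test functions\<close>

text \<open>Padding with zero coefficients up to a full subtree allows test functions to be treated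
  as arbitrary finite combinations of indicators of balls.\<close>

lemma test_functionsI:
  assumes "finite F" "\<And>B. B \<in> F \<Longrightarrow> is_ball B"
  shows "(\<lambda>x::'a. \<Sum>B\<in>F. c B * indicator B x) \<in> test_functions"
proof -
  obtain S where S: "full_subtree S" "F \<subseteq> S"
    using ex_full_subtree[OF ultra reg two assms(1)] assms(2) by blast
  have "finite S" using S(1) by (simp add: full_subtree_def)
  then have "(\<Sum>B\<in>F. c B * indicator B x) = (\<Sum>B\<in>S. (if B \<in> F then c B else 0) * indicator B x)" for x
    using S(2) by (intro sum.mono_neutral_cong_left) auto
  then have "(\<lambda>x. \<Sum>B\<in>F. c B * indicator B x) \<in> subtree_functions S"
    unfolding subtree_functions_def by (auto intro!: exI[of _ "\<lambda>B. if B \<in> F then c B else 0"])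
  then show ?thesis using S unfolding test_functions_def by blast
qed

lemma test_functionsE:
  assumes "f \<in> test_functions"
  obtains F c where "finite F" "\<forall>B\<in>F. is_ball B" "f = (\<lambda>x::'a. \<Sum>B\<in>F. c B * indicator B x)"
proof -
  obtain S c where S: "full_subtree S" and f: "f = (\<lambda>x. \<Sum>J\<in>S. c J * indicator J x)"
    using assms unfolding test_functions_def subtree_functions_def by blast
  have "finite S" "S \<subseteq> ball_tree" using S by (simp_all add: full_subtree_def)
  then have "\<forall>B\<in>S. is_ball B" by (metis ball_in_ball_tree subsetD)
  from that[OF \<open>finite S\<close> this f] show thesis .
qed

lemma test_indicator: "is_ball B \<Longrightarrow> (\<lambda>x::'a. c * indicator B x) \<in> test_functions"
  using test_functionsI[of "{B}" "\<lambda>_. c"]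
  by (simp only: sum.insert finite.emptyI empty_iff sum.empty not_False_eq_True add_0_right) simp

lemma test_indicator': "is_ball B \<Longrightarrow> indicator B \<in> test_functions" for B :: "'a set"
  using test_indicator[of B 1] by simp

lemma test_zero: "(\<lambda>x::'a. 0) \<in> test_functions"
  using test_functionsI[of "{}" "\<lambda>_. 0"] by simp

lemma test_lincomb:
  assumes "f \<in> test_functions" "g \<in> test_functions"
  shows "(\<lambda>x::'a. a * f x + b * g x) \<in> test_functions"
proof -
  obtain F c where F: "finite F" "\<forall>B\<in>F. is_ball B" "f = (\<lambda>x::'a. \<Sum>B\<in>F. c B * indicator B x)"
    using assms(1) by (rule test_functionsE)
  obtain G d where G: "finite G" "\<forall>B\<in>G. is_ball B" "g = (\<lambda>x::'a. \<Sum>B\<in>G. d B * indicator B x)"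
    using assms(2) by (rule test_functionsE)
  let ?e = "\<lambda>B. a * (if B \<in> F then c B else 0) + b * (if B \<in> G then d B else 0)"
  have "f x = (\<Sum>B\<in>F \<union> G. (if B \<in> F then c B else 0) * indicator B x)" for x
    unfolding F(3) using F(1) G(1) by (intro sum.mono_neutral_cong_left) auto
  moreover have "g x = (\<Sum>B\<in>F \<union> G. (if B \<in> G then d B else 0) * indicator B x)" for x
    unfolding G(3) using F(1) G(1) by (intro sum.mono_neutral_cong_left) auto
  ultimately have "(\<lambda>x. a * f x + b * g x) = (\<lambda>x. \<Sum>B\<in>F \<union> G. ?e B * indicator B x)"
    by (simp add: sum_distrib_left sum.distrib distrib_right mult.assoc)
  moreover have "\<dots> \<in> test_functions" using F G by (intro test_functionsI) auto
  ultimately show ?thesis by simp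
qed

lemma test_add: "f \<in> test_functions \<Longrightarrow> g \<in> test_functions \<Longrightarrow> (\<lambda>x::'a. f x + g x) \<in> test_functions"
  using test_lincomb[of f g 1 1] by simp

lemma test_scale: "f \<in> test_functions \<Longrightarrow> (\<lambda>x::'a. a * f x) \<in> test_functions"
  using test_lincomb[of f f a 0] by simp

lemma test_sum:
  "(\<And>i. i \<in> A \<Longrightarrow> f i \<in> test_functions) \<Longrightarrow> (\<lambda>x::'a. \<Sum>i\<in>A. f i x) \<in> test_functions"
  by (induction A rule: infinite_finite_induct) (auto intro: test_zero test_add)

lemma test_functions_induct [consumes 1, case_names zero indicator add]:
  assumes "f \<in> test_functions" and zero: "P (\<lambda>x::'a. 0)"
    and ind: "\<And>B c. is_ball B \<Longrightarrow> P (\<lambda>x. c * indicator B x)"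
    and add: "\<And>f g. f \<in> test_functions \<Longrightarrow> g \<in> test_functions \<Longrightarrow> P f \<Longrightarrow> P g \<Longrightarrow> P (\<lambda>x. f x + g x)"
  shows "P f"
proof -
  obtain F c where F: "finite F" "\<forall>B\<in>F. is_ball B" "f = (\<lambda>x::'a. \<Sum>B\<in>F. c B * indicator B x)"
    using assms(1) by (rule test_functionsE)
  from F(1,2) have "P (\<lambda>x. \<Sum>B\<in>F. c B * indicator B x)"
  proof (induction F rule: finite_induct)
    case (insert B F)
    have "(\<lambda>x. \<Sum>B\<in>insert B F. c B * indicator B x) = (\<lambda>x. c B * indicator B x + (\<Sum>B\<in>F. c B * indicator B x))"
      by (intro ext sum.insert insert(1,2))
    moreover have "P (\<lambda>x. c B * indicator B x + (\<Sum>B\<in>F. c B * indicator B x))"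
      by (rule add[OF test_indicator test_functionsI ind]) (use insert in auto)
    ultimately show ?case by (simp only:)
  qed (simp add: zero)
  then show ?thesis using F(3) by simp
qed

text \<open>Balls are disjoint or nested, so a product of two indicators is zero or again the
  indicator of a ball.\<close>

lemma test_mult:
  assumes f: "f \<in> test_functions" and g: "g \<in> test_functions"
  shows "(\<lambda>x::'a. f x * g x) \<in> test_functions"
proof -
  obtain F c where F: "finite F" "\<forall>B\<in>F. is_ball B" "f = (\<lambda>x::'a. \<Sum>B\<in>F. c B * indicator B x)"
    using f by (rule test_functionsE)
  obtain G d where G: "finite G" "\<forall>B\<in>G. is_ball B" "g = (\<lambda>x::'a. \<Sum>B\<in>G. d B * indicator B x)"
    using g by (rule test_functionsE)
  have "(\<lambda>x. c B * indicator B x * (d C * indicator C x)) \<in> test_functions" if "B \<in> F" "C \<in> G" for B C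
  proof (cases "B \<inter> C = {}")
    case True
    then have "(\<lambda>x. c B * indicator B x * (d C * indicator C x)) = (\<lambda>x. 0)"
      by (auto simp: indicator_def fun_eq_iff)
    then show ?thesis using test_zero by simp
  next
    case False
    then have "B \<inter> C = B \<or> B \<inter> C = C" using nested F(2) G(2) that by blast
    then have "is_ball (B \<inter> C)" using F(2) G(2) that by auto
    moreover have "(\<lambda>x. c B * indicator B x * (d C * indicator C x)) = (\<lambda>x. (c B * d C) * indicator (B \<inter> C) x)"
      by (auto simp: indicator_def fun_eq_iff)
    ultimately show ?thesis using test_indicator by simp
  qed
  then show ?thesis unfolding F(3) G(3) sum_product by (intro test_sum)
qed

lemma test_cnj: "f \<in> test_functions \<Longrightarrow> (\<lambda>x::'a. cnj (f x)) \<in> test_functions"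
proof (induction rule: test_functions_induct)
  case (indicator B c)
  have "(\<lambda>x. cnj (c * indicator B x)) = (\<lambda>x. cnj c * indicator B x)"
    by (intro ext) (simp add: indicator_def)
  then show ?case using test_indicator[OF indicator, of "cnj c"] by (simp only:)
qed (auto intro: test_zero test_add)

lemma test_Re_Im:
  assumes "f \<in> test_functions"
  shows "(\<lambda>x::'a. complex_of_real (Re (f x))) \<in> test_functions"
    "(\<lambda>x::'a. complex_of_real (Im (f x))) \<in> test_functions"
proof -
  have "(\<lambda>x. complex_of_real (Re (f x))) = (\<lambda>x. (1/2) * f x + (1/2) * cnj (f x))"
    by (auto simp: complex_eq_iff)
  then show "(\<lambda>x::'a. complex_of_real (Re (f x))) \<in> test_functions"
    using test_lincomb[OF assms test_cnj[OF assms]] by (simp only:)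
  have "(\<lambda>x. complex_of_real (Im (f x))) = (\<lambda>x. (- \<i>/2) * f x + (\<i>/2) * cnj (f x))"
    by (auto simp: complex_eq_iff)
  then show "(\<lambda>x::'a. complex_of_real (Im (f x))) \<in> test_functions"
    using test_lincomb[OF assms test_cnj[OF assms]] by (simp only:)
qed

lemma integral_indicator_complex:
  "is_ball B \<Longrightarrow> has_bochner_integral \<nu> (\<lambda>x. c * indicator B x) (c * complex_of_real (measure \<nu> B))"
proof -
  assume B: "is_ball B"
  have "has_bochner_integral \<nu> (\<lambda>x. indicator B x *\<^sub>R c) (measure \<nu> B *\<^sub>R c)"
    using ball_measure[OF B] ball_measurable[OF B] by (intro has_bochner_integral_indicator) auto
  moreover have "(\<lambda>x. indicator B x *\<^sub>R c) = (\<lambda>x. c * indicator B x)" by (auto simp: indicator_def)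
  ultimately show ?thesis by (simp add: scaleR_conv_of_real mult.commute)
qed

lemma test_integrable: "f \<in> test_functions \<Longrightarrow> integrable \<nu> f"
  by (induction rule: test_functions_induct)
    (auto dest: integral_indicator_complex integrable.intros)

section \<open>Wavelet spaces\<close>

lemma wavelet_space_test: "I \<in> nonminimal \<Longrightarrow> f \<in> wavelet_space \<nu> I \<Longrightarrow> f \<in> test_functions"
  unfolding wavelet_space_def using test_functionsI[OF finite_max_subballs] max_subball by auto

lemma wavelet_space_const:
  assumes "I \<in> nonminimal" "f \<in> wavelet_space \<nu> I" "M \<in> max_subballs I" "x \<in> M" "y \<in> M"
  shows "f x = f y"
proof -
  obtain c where f: "f = (\<lambda>x. \<Sum>M\<in>max_subballs I. c M * indicator M x)"
    using assms unfolding wavelet_space_def by blast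
  show ?thesis unfolding f by (simp add: sum_max_subballs[OF assms(1,3)] assms(4,5))
qed

lemma wavelet_space_outside: "f \<in> wavelet_space \<nu> I \<Longrightarrow> x \<notin> I \<Longrightarrow> f x = 0"
  unfolding wavelet_space_def by (auto simp: sum_max_subballs_outside)

lemma wavelet_space_cnj:
  assumes "I \<in> nonminimal" "f \<in> wavelet_space \<nu> I"
  shows "(\<lambda>x. cnj (f x)) \<in> wavelet_space \<nu> I"
proof -
  obtain c where f: "f = (\<lambda>x. \<Sum>M\<in>max_subballs I. c M * indicator M x)" "(\<integral>x. f x \<partial>\<nu>) = 0"
    using assms unfolding wavelet_space_def by blast
  have "(\<lambda>x. cnj (f x)) = (\<lambda>x. \<Sum>M\<in>max_subballs I. cnj (c M) * indicator M x)"
    unfolding f(1) by (auto simp: indicator_def intro!: ext sum.cong)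
  then have "\<exists>c. (\<lambda>x. cnj (f x)) = (\<lambda>x. \<Sum>M\<in>max_subballs I. c M * indicator M x)"
    by (rule exI[where x = "\<lambda>M. cnj (c M)"])
  moreover have "(\<integral>x. cnj (f x) \<partial>\<nu>) = 0" using f(2) by simp
  ultimately show ?thesis unfolding wavelet_space_def by simp
qed

text \<open>If \<open>I\<close> is strictly inside \<open>J\<close>, it lies in one maximal subball
  of \<open>J\<close>, where \<open>g\<close> is constant, and \<open>f\<close> has mean zero. The
  pairing is bilinear; for the inner product it is combined with
  \<open>wavelet_space_cnj\<close>.\<close>

lemma wavelet_space_orthogonal:
  assumes I: "I \<in> nonminimal" "f \<in> wavelet_space \<nu> I" and J: "J \<in> nonminimal" "g \<in> wavelet_space \<nu> J"
    and ne: "I \<noteq> J"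
  shows "(\<integral>x. f x * g x \<partial>\<nu>) = 0"
proof -
  have sub: "(\<integral>x. f x * g x \<partial>\<nu>) = 0"
    if I: "I \<in> nonminimal" "f \<in> wavelet_space \<nu> I" and J: "J \<in> nonminimal" "g \<in> wavelet_space \<nu> J"
      and IJ: "I \<subset> J" for I J f g
  proof -
    obtain M where M: "M \<in> max_subballs J" "I \<subseteq> M"
      using ball_below_max_subball[OF nonminimal_ball[OF J(1)] nonminimal_ball[OF I(1)] IJ] by blast
    obtain z where z: "z \<in> I" using ball_nonempty nonminimal_ball[OF I(1)] by blast
    have "f x * g x = f x * g z" for x
      using wavelet_space_const[OF J M(1), of x z] wavelet_space_outside[OF I(2), of x] M(2) z by (cases "x \<in> I") auto
    then have "(\<integral>x. f x * g x \<partial>\<nu>) = (\<integral>x. f x * g z \<partial>\<nu>)" by (rule Bochner_Integration.integral_cong[OF refl])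
    moreover have "(\<integral>x. f x \<partial>\<nu>) = 0" using I(2) by (simp add: wavelet_space_def)
    ultimately show ?thesis by simp
  qed
  show ?thesis
  proof (cases "I \<inter> J = {}")
    case True
    then have "f x * g x = 0" for x
      using wavelet_space_outside[OF I(2), of x] wavelet_space_outside[OF J(2), of x] by auto
    then have "(\<integral>x. f x * g x \<partial>\<nu>) = (\<integral>x. 0 \<partial>\<nu>)" by (rule Bochner_Integration.integral_cong[OF refl])
    then show ?thesis by simp
  next
    case False
    then have "I \<subset> J \<or> J \<subset> I" using nested[of I J] nonminimal_ball I J ne by blast
    then show ?thesis using sub[OF I J] sub[OF J I] by (auto simp: mult.commute)
  qed
qed

lemma wavelet_kernel_as_sum:
  assumes I: "I \<in> nonminimal" and M: "M \<in> max_subballs I" "y \<in> M"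
  shows "complex_of_real (wavelet_kernel \<nu> I x y) =
    (\<Sum>N\<in>max_subballs I. complex_of_real ((if N = M then 1 / measure \<nu> M else 0) - 1 / measure \<nu> I) * indicator N x)"
proof (cases "x \<in> I")
  case False
  then show ?thesis by (simp add: wavelet_kernel_outside sum_max_subballs_outside)
next
  case True
  then obtain N where N: "N \<in> max_subballs I" "x \<in> N" using max_subball_ex[OF I] by blast
  have "y \<in> N \<longleftrightarrow> N = M" using max_subball_unique[OF N(1) M(1), of y] M(2) by auto
  moreover have "y \<in> I" using M max_subball by blast
  ultimately show ?thesis
    unfolding sum_max_subballs[OF I N] by (auto simp: wavelet_kernel_inside[OF I N] indicator_def)
qed

lemma integral_max_subballs:
  assumes "I \<in> nonminimal"
  shows "(\<integral>x. (\<Sum>N\<in>max_subballs I. c N * indicator N x) \<partial>\<nu>) = (\<Sum>N\<in>max_subballs I. c N * complex_of_real (measure \<nu> N))"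
proof -
  have "has_bochner_integral \<nu> (\<lambda>x. c N * indicator N x) (c N * complex_of_real (measure \<nu> N))"
    if "N \<in> max_subballs I" for N
    using integral_indicator_complex max_subball[OF that] by blast
  then show ?thesis
    by (intro has_bochner_integral_integral_eq has_bochner_integral_sum)
qed

lemma measure_max_subballs:
  assumes I: "I \<in> nonminimal"
  shows "measure \<nu> I = (\<Sum>N\<in>max_subballs I. measure \<nu> N)"
proof -
  have "measure \<nu> (\<Union>(max_subballs I)) = (\<Sum>N\<in>max_subballs I. measure \<nu> N)"
  proof (intro measure_Union' finite_max_subballs[OF I])
    show "pairwise disjnt (max_subballs I)"
      unfolding pairwise_def disjnt_def using max_subball_unique[of _ I] by (metis disjoint_iff)
  qed (use max_subball ball_fmeasurable in blast)
  then show ?thesis by (simp add: Union_max_subballs[OF I])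
qed

lemma wavelet_kernel_wavelet_space:
  assumes I: "I \<in> nonminimal"
  shows "(\<lambda>x. complex_of_real (wavelet_kernel \<nu> I x y)) \<in> wavelet_space \<nu> I"
proof (cases "y \<in> I")
  case False
  then have "(\<lambda>x. complex_of_real (wavelet_kernel \<nu> I x y)) = (\<lambda>x. \<Sum>N\<in>max_subballs I. 0 * indicator N x)"
    by (simp add: wavelet_kernel_outside)
  then have "\<exists>c. (\<lambda>x. complex_of_real (wavelet_kernel \<nu> I x y)) = (\<lambda>x. \<Sum>N\<in>max_subballs I. c N * indicator N x)"
    by (rule exI[where x = "\<lambda>N. 0"])
  moreover have "(\<integral>x. complex_of_real (wavelet_kernel \<nu> I x y) \<partial>\<nu>) = 0"
    using False by (simp add: wavelet_kernel_outside)
  ultimately show ?thesis unfolding wavelet_space_def by simp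
next
  case True
  then obtain M where M: "M \<in> max_subballs I" "y \<in> M" using max_subball_ex[OF I] by blast
  let ?c = "\<lambda>N. (if N = M then 1 / measure \<nu> M else 0) - 1 / measure \<nu> I"
  have eq: "(\<lambda>x. complex_of_real (wavelet_kernel \<nu> I x y)) = (\<lambda>x. \<Sum>N\<in>max_subballs I. complex_of_real (?c N) * indicator N x)"
    using wavelet_kernel_as_sum[OF I M] by auto
  \<comment> \<open>The subball \<open>M\<close> contributes \<open>\<nu>(M) / \<nu>(M) = 1\<close>;
    the constant part takes away the total measure of the subballs divided by
    \<open>\<nu>(I)\<close>, which is also 1.\<close>
  have "(\<Sum>N\<in>max_subballs I. ?c N * measure \<nu> N) =
    (\<Sum>N\<in>max_subballs I. if N = M then 1 else 0) - (\<Sum>N\<in>max_subballs I. measure \<nu> N) / measure \<nu> I"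
    using ball_measure_pos[of M] max_subball[OF M(1)]
    by (simp add: sum_subtractf[symmetric] sum_divide_distrib left_diff_distrib) (intro sum.cong, auto)
  also have "\<dots> = 0"
    using finite_max_subballs[OF I] M(1) ball_measure_pos[OF nonminimal_ball[OF I]]
    by (simp add: measure_max_subballs[OF I, symmetric])
  finally have "(\<Sum>N\<in>max_subballs I. complex_of_real (?c N) * complex_of_real (measure \<nu> N)) = 0"
    unfolding of_real_mult[symmetric] of_real_sum[symmetric] by (simp only: of_real_0)
  then have "(\<integral>x. complex_of_real (wavelet_kernel \<nu> I x y) \<partial>\<nu>) = 0"
    unfolding eq integral_max_subballs[OF I] .
  moreover have "\<exists>c. (\<lambda>x. complex_of_real (wavelet_kernel \<nu> I x y)) = (\<lambda>x. \<Sum>N\<in>max_subballs I. c N * indicator N x)"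
    by (rule exI[where x = "\<lambda>N. complex_of_real (?c N)"]) (rule eq)
  ultimately show ?thesis unfolding wavelet_space_def by simp
qed

text \<open>Averaging over the maximal subball containing \<open>y\<close> returns
  \<open>g y\<close>, as \<open>g\<close> is constant there, and the subtracted average over
  \<open>I\<close> vanishes because \<open>g\<close> has mean zero.\<close>

lemma wavelet_kernel_reproducing:
  assumes I: "I \<in> nonminimal" and g: "g \<in> wavelet_space \<nu> I"
  shows "(\<integral>x. complex_of_real (wavelet_kernel \<nu> I x y) * g x \<partial>\<nu>) = g y"
proof (cases "y \<in> I")
  case False
  then show ?thesis using wavelet_space_outside[OF g] by (simp add: wavelet_kernel_outside)
next
  case True
  then obtain M where M: "M \<in> max_subballs I" "y \<in> M" using max_subball_ex[OF I] by blast
  have Mb: "is_ball M" using max_subball M by blast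
  have pt: "complex_of_real (wavelet_kernel \<nu> I x y) * g x =
     (g y / complex_of_real (measure \<nu> M)) * indicator M x - g x / complex_of_real (measure \<nu> I)" for x
  proof (cases "x \<in> I")
    case False
    then show ?thesis using wavelet_space_outside[OF g False] M(1) max_subball[of M I] by (auto simp: indicator_def)
  next
    case True
    have "wavelet_kernel \<nu> I x y = indicator M x / measure \<nu> M - 1 / measure \<nu> I"
      using wavelet_kernel_inside[OF I M True] by (simp add: wavelet_kernel_sym)
    moreover have "x \<in> M \<Longrightarrow> g x = g y" using wavelet_space_const[OF I g M(1) _ M(2)] by blast
    ultimately show ?thesis by (cases "x \<in> M") (simp_all add: left_diff_distrib)
  qed
  have int: "integrable \<nu> g" using test_integrable wavelet_space_test[OF I g] by blast
  have g0: "(\<integral>x. g x \<partial>\<nu>) = 0" using g by (simp add: wavelet_space_def)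
  have "(\<integral>x. complex_of_real (wavelet_kernel \<nu> I x y) * g x \<partial>\<nu>) =
     (g y / complex_of_real (measure \<nu> M)) * complex_of_real (measure \<nu> M) - (\<integral>x. g x \<partial>\<nu>) / complex_of_real (measure \<nu> I)"
    unfolding pt using integral_indicator_complex[OF Mb, of "g y / complex_of_real (measure \<nu> M)"] int
    by (subst Bochner_Integration.integral_diff) (auto simp: has_bochner_integral_iff)
  then show ?thesis using g0 ball_measure_pos[OF Mb] by simp
qed

text \<open>For fixed \<open>y\<close> the kernel lies in the wavelet space and so has an expansion
  in the basis; the coefficient at \<open>\<Psi> I k\<close> is an inner product that the
  reproducing property evaluates to \<open>cnj (\<Psi> I k y)\<close>. The right-hand side is real
  and the same for every choice of wavelets.\<close>

lemma wavelet_sum_eq_kernel: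
  assumes wb: "wavelet_basis \<nu> \<Psi>" and I: "I \<in> nonminimal"
  shows "(\<Sum>j = 1..card (max_subballs I) - 1. \<Psi> I j x * cnj (\<Psi> I j y)) = complex_of_real (wavelet_kernel \<nu> I x y)"
proof -
  let ?J = "{1..card (max_subballs I) - 1}"
  have V: "\<Psi> I j \<in> wavelet_space \<nu> I" if "j \<in> ?J" for j using wb I that unfolding wavelet_basis_def by blast
  have orth: "(\<integral>x. cnj (\<Psi> I j x) * \<Psi> I k x \<partial>\<nu>) = (if j = k then 1 else 0)" if "j \<in> ?J" "k \<in> ?J" for j k
    using wb I that unfolding wavelet_basis_def by blast
  obtain c where c: "(\<lambda>x. complex_of_real (wavelet_kernel \<nu> I x y)) = (\<lambda>x. \<Sum>j\<in>?J. c j * \<Psi> I j x)"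
    using wb I wavelet_kernel_wavelet_space[OF I] unfolding wavelet_basis_def by blast
  have "c k = cnj (\<Psi> I k y)" if k: "k \<in> ?J" for k
  proof -
    have test: "(\<lambda>x. cnj (\<Psi> I k x) * \<Psi> I j x) \<in> test_functions" if "j \<in> ?J" for j
      using V[OF k] V[OF that] wavelet_space_test[OF I] test_cnj test_mult by blast
    have "cnj (\<Psi> I k y) = (\<integral>x. complex_of_real (wavelet_kernel \<nu> I x y) * cnj (\<Psi> I k x) \<partial>\<nu>)"
      by (rule wavelet_kernel_reproducing[OF I wavelet_space_cnj[OF I V[OF k]], symmetric])
    also have "\<dots> = (\<integral>x. (\<Sum>j\<in>?J. c j * (cnj (\<Psi> I k x) * \<Psi> I j x)) \<partial>\<nu>)"
      unfolding fun_cong[OF c] by (simp add: sum_distrib_left sum_distrib_right mult_ac)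
    also have "\<dots> = (\<Sum>j\<in>?J. c j * (\<integral>x. cnj (\<Psi> I k x) * \<Psi> I j x \<partial>\<nu>))"
      using test_integrable[OF test] by (subst Bochner_Integration.integral_sum) auto
    also have "\<dots> = (\<Sum>j\<in>?J. if j = k then c k else 0)"
      using orth[OF k] by (intro sum.cong) auto
    also have "\<dots> = c k" using k by simp
    finally show ?thesis by simp
  qed
  then show ?thesis unfolding fun_cong[OF c] by (simp add: mult.commute)
qed


lemma countable_nonminimal: "countable (nonminimal :: 'a set set)"
proof (rule countable_subset)
  show "nonminimal \<subseteq> {D :: 'a set. is_ball D \<and> diameter D \<noteq> 0}"
    using nonminimal_ball nonminimal_diameter by blast
  show "countable {D :: 'a set. is_ball D \<and> diameter D \<noteq> 0}"
    using reg by (simp add: regular_balls_def)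
qed

lemma nonminimalI: "is_ball B \<Longrightarrow> is_ball J \<Longrightarrow> B \<subset> J \<Longrightarrow> J \<in> nonminimal" for B J :: "'a set"
  unfolding nonminimal_iff by blast

lemma ball_tree_above: "{J \<in> ball_tree. I \<subset> J} = {J. is_ball J \<and> I \<subset> J}" for I :: "'a set"
  by (simp add: ball_in_ball_tree)

section \<open>Series along the increasing path above a ball\<close>

lemma ball_join:
  assumes "is_ball A" "is_ball B"
  shows "\<exists>J. is_ball J \<and> A \<subseteq> J \<and> B \<subseteq> (J :: 'a set)"
  using balls_bounded_above[OF ultra reg, of "{A, B}" undefined undefined] assms by auto

lemma pred_vertex_above:
  fixes A C K :: "'a set"
  assumes "is_ball A" "A \<subseteq> C" "is_ball C" "is_ball K" "C \<subset> K"
  shows "pred_vertex K A = pred_vertex K C"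
  using pred_vertex_max_subball[OF assms(4,3,5)] assms(2) ball_nonempty[OF assms(1)]
  by (intro pred_vertex_eq) auto

text \<open>The path above \<open>A\<close> is a finite piece up to \<open>C\<close> followed by the
  path above \<open>C\<close>, along which both balls have the same predecessor vertices.
  Abstracting the summand to a function \<open>h\<close> of a vertex and its predecessor lets one
  lemma serve both series of the theorem.\<close>

lemma series_transfer_above:
  fixes h :: "'a set \<Rightarrow> 'a set \<Rightarrow> real"
  assumes A: "is_ball A" and C: "is_ball C" and AC: "A \<subseteq> C"
  shows "(\<lambda>K. h K (pred_vertex K A)) summable_on {K \<in> ball_tree. A \<subset> K} \<longleftrightarrow>
     (\<lambda>K. h K (pred_vertex K C)) summable_on {K \<in> ball_tree. C \<subset> K}"
proof -
  let ?F = "{K. is_ball K \<and> A \<subset> K \<and> K \<subseteq> C}" and ?U = "{K. is_ball K \<and> C \<subset> K}"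
  have fin: "finite ?F" by (rule finite_subset[OF _ finite_path[OF ultra reg A C AC]]) auto
  have "K \<subseteq> C \<or> C \<subset> K" if "is_ball K" "A \<subset> K" for K
    using nested[OF that(1) C] that(2) AC ball_nonempty[OF A] by blast
  then have eq: "{K \<in> ball_tree. A \<subset> K} = ?F \<union> ?U" unfolding ball_tree_above using AC by blast
  have "(\<lambda>K. h K (pred_vertex K A)) summable_on {K \<in> ball_tree. A \<subset> K} \<longleftrightarrow>
     (\<lambda>K. h K (pred_vertex K A)) summable_on ?U"
    unfolding eq
  proof
    assume "(\<lambda>K. h K (pred_vertex K A)) summable_on ?F \<union> ?U"
    then show "(\<lambda>K. h K (pred_vertex K A)) summable_on ?U" by (rule summable_on_subset_banach) auto
  next
    assume "(\<lambda>K. h K (pred_vertex K A)) summable_on ?U"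
    then show "(\<lambda>K. h K (pred_vertex K A)) summable_on ?F \<union> ?U"
      using summable_on_finite[OF fin] by (intro summable_on_Un_disjoint) auto
  qed
  also have "\<dots> \<longleftrightarrow> (\<lambda>K. h K (pred_vertex K C)) summable_on ?U"
    using pred_vertex_above[OF A AC C] by (intro summable_on_cong) auto
  finally show ?thesis unfolding ball_tree_above .
qed

lemma series_transfer:
  fixes h :: "'a set \<Rightarrow> 'a set \<Rightarrow> real"
  assumes "is_ball A" "is_ball C" "(\<lambda>K. h K (pred_vertex K A)) summable_on {K \<in> ball_tree. A \<subset> K}"
  shows "(\<lambda>K. h K (pred_vertex K C)) summable_on {K \<in> ball_tree. C \<subset> K}"
proof -
  obtain J where J: "is_ball J" "A \<subseteq> J" "C \<subseteq> J" using ball_join assms by blast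
  show ?thesis
    using assms(3) series_transfer_above[OF assms(1) J(1,2), of h] series_transfer_above[OF assms(2) J(1,3), of h] by simp
qed

text \<open>Seen from outside, the points of a ball are indistinguishable: a ball that meets
  \<open>B\<close> and contains a point outside must contain all of \<open>B\<close>. Kernels
  depending only on \<open>sup_ball\<close> are therefore constant on products of disjoint
  balls.\<close>

lemma sup_ball_outside:
  fixes B :: "'a set"
  assumes B: "is_ball B" and x: "x \<notin> B" and y: "y \<in> B" "z \<in> B"
  shows "sup_ball x y = sup_ball x z" "B \<subset> sup_ball x y"
proof -
  have sub: "B \<subset> sup_ball x w" if w: "w \<in> B" for w
  proof -
    have "is_ball (sup_ball x w)" using x w by (intro sup_ball_ball) auto
    then have "B \<subseteq> sup_ball x w \<or> sup_ball x w \<subseteq> B" using nested[OF B] sup_ball_mem(2)[of w x] w by blast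
    then show ?thesis using sup_ball_mem(1)[of x w] x by blast
  qed
  then show "B \<subset> sup_ball x y" using y by blast
  have "sup_ball x v \<subseteq> sup_ball x w" if "v \<in> B" "w \<in> B" for v w
    by (rule sup_ball_least) (use that x sub sup_ball_mem in \<open>auto intro!: sup_ball_ball\<close>)
  then show "sup_ball x y = sup_ball x z" using y by blast
qed

lemma sup_ball_sym: "sup_ball x y = sup_ball y (x::'a)"
  unfolding sup_ball_def by (auto simp: conj_commute)

section \<open>Decomposition of test functions over disjoint balls\<close>

text \<open>The partition consists of the leaves of a full subtree, the members none of whose
  maximal subballs belong to it. Distinct leaves cannot be nested, since convexity of the subtree
  would put a maximal subball of the larger one into it. A member that is not a leaf has all its
  maximal subballs in the subtree, and these cover it.\<close>

lemma leaf_partition: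
  fixes F :: "'a set set"
  assumes F: "finite F" "\<forall>B\<in>F. is_ball B"
  obtains L where "finite L" "\<forall>A\<in>L. is_ball A" "\<forall>A\<in>L. \<forall>A'\<in>L. A \<noteq> A' \<longrightarrow> A \<inter> A' = {}"
    "\<forall>B\<in>F. B = \<Union>{A\<in>L. A \<subseteq> B}"
proof -
  obtain S where S: "full_subtree S" "F \<subseteq> S" using ex_full_subtree[OF ultra reg two F] by blast
  have fin: "finite S" and tree: "S \<subseteq> ball_tree"
    and conv: "\<And>I J K. I \<in> S \<Longrightarrow> J \<in> S \<Longrightarrow> K \<in> ball_tree \<Longrightarrow> I \<subseteq> K \<and> K \<subseteq> J \<Longrightarrow> K \<in> S"
    and full: "\<And>I. I \<in> S \<Longrightarrow> max_subballs I \<inter> S \<noteq> {} \<Longrightarrow> max_subballs I \<subseteq> S"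
    using S(1) unfolding full_subtree_def by meson+
  have ball: "is_ball B" if "B \<in> S" for B using that tree ball_in_ball_tree[of B] by auto
  define L where "L = {A\<in>S. max_subballs A \<inter> S = {}}"
  have "A \<inter> A' = {}" if A: "A \<in> L" "A' \<in> L" "A \<noteq> A'" for A A'
  proof (rule ccontr)
    assume "A \<inter> A' \<noteq> {}"
    moreover have AS: "A \<in> S" "A' \<in> S" using A by (auto simp: L_def)
    ultimately have "A \<subset> A' \<or> A' \<subset> A" using nested[OF ball ball] A(3) by blast
    moreover have "\<not> A \<subset> A'" if A: "A \<in> L" "A' \<in> L" for A A'
    proof
      assume sub: "A \<subset> A'"
      have AS: "A \<in> S" "A' \<in> S" using A by (auto simp: L_def)
      obtain M where M: "M \<in> max_subballs A'" "A \<subseteq> M"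
        using ball_below_max_subball[OF ball[OF AS(2)] ball[OF AS(1)] sub] by blast
      then have "M \<in> S" using conv[OF AS, of M] max_subball[OF M(1)] by (auto simp: ball_in_ball_tree)
      then show False using A(2) M(1) by (auto simp: L_def)
    qed
    ultimately show False using A by blast
  qed
  moreover have "B = \<Union>{A\<in>L. A \<subseteq> B}" if "B \<in> S" for B
    using that
  \<comment> \<open>Passing to a maximal subball lowers the number of members strictly
    below.\<close>
  proof (induction "card {K\<in>S. K \<subset> B}" arbitrary: B rule: less_induct)
    case (less B)
    show ?case
    proof (cases "B \<in> L")
      case True
      then show ?thesis by blast
    next
      case False
      then have ne: "max_subballs B \<inter> S \<noteq> {}" using less(2) by (simp add: L_def)
      then have sub: "max_subballs B \<subseteq> S" by (rule full[OF less(2)])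
      from ne have "B \<in> nonminimal" using max_subball nonminimalI ball[OF less(2)] by blast
      then have UB: "\<Union>(max_subballs B) = B" by (rule Union_max_subballs)
      have "M = \<Union>{A\<in>L. A \<subseteq> M}" if M: "M \<in> max_subballs B" for M
      proof (rule less(1))
        show "M \<in> S" using M sub by blast
        show "card {K\<in>S. K \<subset> M} < card {K\<in>S. K \<subset> B}"
        proof (rule psubset_card_mono)
          show "finite {K\<in>S. K \<subset> B}" using fin by simp
          have "M \<subset> B" using max_subball[OF M] by blast
          then show "{K\<in>S. K \<subset> M} \<subset> {K\<in>S. K \<subset> B}" using \<open>M \<in> S\<close> by blast
        qed
      qed
      note IH = this
      show ?thesis
      proof (intro equalityI subsetI)
        fix x assume "x \<in> B"
        then obtain M where M: "M \<in> max_subballs B" "x \<in> M" using UB by blast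
        obtain A where "A \<in> L" "A \<subseteq> M" "x \<in> A" using IH[OF M(1)] M(2) by auto
        then show "x \<in> \<Union>{A\<in>L. A \<subseteq> B}" using max_subball[OF M(1)] by auto
      qed auto
    qed
  qed
  ultimately have cover: "\<And>A A'. A \<in> L \<Longrightarrow> A' \<in> L \<Longrightarrow> A \<noteq> A' \<Longrightarrow> A \<inter> A' = {}"
    "\<And>B. B \<in> S \<Longrightarrow> B = \<Union>{A\<in>L. A \<subseteq> B}" by presburger+
  show thesis
  proof (rule that[of L])
    show "finite L" "\<forall>A\<in>L. is_ball A" using fin ball by (simp_all add: L_def)
    show "\<forall>A\<in>L. \<forall>A'\<in>L. A \<noteq> A' \<longrightarrow> A \<inter> A' = {}" by (intro ballI impI cover(1))
    show "\<forall>B\<in>F. B = \<Union>{A\<in>L. A \<subseteq> B}" by (intro ballI cover(2) subsetD[OF S(2)])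
  qed
qed

lemma test_functions_common_partition:
  assumes f: "f \<in> test_functions" and g: "g \<in> test_functions"
  obtains L c d where "finite L" "\<forall>A\<in>L. is_ball A" "\<forall>A\<in>L. \<forall>A'\<in>L. A \<noteq> A' \<longrightarrow> A \<inter> A' = {}"
    "f = (\<lambda>x::'a. \<Sum>A\<in>L. c A * indicator A x)" "g = (\<lambda>x. \<Sum>A\<in>L. d A * indicator A x)"
proof -
  obtain F a where F: "finite F" "\<forall>B\<in>F. is_ball B" "f = (\<lambda>x::'a. \<Sum>B\<in>F. a B * indicator B x)"
    using f by (rule test_functionsE)
  obtain G b where G: "finite G" "\<forall>B\<in>G. is_ball B" "g = (\<lambda>x::'a. \<Sum>B\<in>G. b B * indicator B x)"
    using g by (rule test_functionsE)
  obtain L where L: "finite L" "\<forall>A\<in>L. is_ball A" "\<forall>A\<in>L. \<forall>A'\<in>L. A \<noteq> A' \<longrightarrow> A \<inter> A' = {}"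
    "\<forall>B\<in>F \<union> G. B = \<Union>{A\<in>L. A \<subseteq> B}"
    by (rule leaf_partition[of "F \<union> G"]) (use F G in auto)
  have ind: "indicator B x = (\<Sum>A\<in>L. (if A \<subseteq> B then 1 else 0) * indicator A x :: complex)" if B: "B \<in> F \<union> G" for B x
  proof (cases "\<exists>A\<in>L. A \<subseteq> B \<and> x \<in> A")
    case True
    then obtain A where A: "A \<in> L" "A \<subseteq> B" "x \<in> A" by blast
    have "(\<Sum>A'\<in>L. (if A' \<subseteq> B then 1 else 0) * indicator A' x :: complex) = (\<Sum>A'\<in>L. if A' = A then 1 else 0)"
    proof (rule sum.cong[OF refl])
      fix A' assume "A' \<in> L"
      then have "x \<in> A' \<longleftrightarrow> A' = A" using L(3) A by blast
      then show "(if A' \<subseteq> B then 1 else 0) * indicator A' x = (if A' = A then 1 else 0 :: complex)" using A by auto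
    qed
    then show ?thesis using A L(1) by auto
  next
    case False
    then have "x \<notin> B" using L(4) B by blast
    moreover have "(\<Sum>A'\<in>L. (if A' \<subseteq> B then 1 else 0) * indicator A' x :: complex) = 0"
      using False by (intro sum.neutral) auto
    ultimately show ?thesis by simp
  qed
  have decomp: "(\<Sum>B\<in>F'. a B * indicator B x) = (\<Sum>A\<in>L. (\<Sum>B\<in>F'. a B * (if A \<subseteq> B then 1 else 0)) * indicator A x)"
    if "F' \<subseteq> F \<union> G" for F' x and a :: "'a set \<Rightarrow> complex"
  proof -
    have "(\<Sum>B\<in>F'. a B * indicator B x) = (\<Sum>B\<in>F'. \<Sum>A\<in>L. a B * (if A \<subseteq> B then 1 else 0) * indicator A x)"
    proof (rule sum.cong[OF refl])
      fix B assume "B \<in> F'"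
      then have "B \<in> F \<union> G" using that by blast
      then show "a B * indicator B x = (\<Sum>A\<in>L. a B * (if A \<subseteq> B then 1 else 0) * indicator A x)"
        by (simp only: ind sum_distrib_left mult.assoc)
    qed
    also have "\<dots> = (\<Sum>A\<in>L. (\<Sum>B\<in>F'. a B * (if A \<subseteq> B then 1 else 0)) * indicator A x)"
      by (subst sum.swap) (simp only: sum_distrib_right)
    finally show ?thesis .
  qed
  have "f = (\<lambda>x. \<Sum>A\<in>L. (\<Sum>B\<in>F. a B * (if A \<subseteq> B then 1 else 0)) * indicator A x)"
    unfolding F(3) by (intro ext decomp) simp
  moreover have "g = (\<lambda>x. \<Sum>A\<in>L. (\<Sum>B\<in>G. b B * (if A \<subseteq> B then 1 else 0)) * indicator A x)"
    unfolding G(3) by (intro ext decomp) simp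
  ultimately show thesis by (rule that[OF L(1-3)])
qed

section \<open>Test functions of mean zero as finite sums of wavelets\<close>

text \<open>Summands are added one at a time so that the stochastic equation can be proved by rule
  induction.\<close>

inductive_set wavelet_span :: "('a \<Rightarrow> complex) set" where
  zero: "(\<lambda>x. 0) \<in> wavelet_span"
| step: "I \<in> nonminimal \<Longrightarrow> g \<in> wavelet_space \<nu> I \<Longrightarrow> f \<in> wavelet_span \<Longrightarrow> (\<lambda>x. a * g x + f x) \<in> wavelet_span"

lemma wavelet_span_add:
  assumes "f \<in> wavelet_span" "h \<in> wavelet_span"
  shows "(\<lambda>x. a * f x + h x) \<in> wavelet_span"
  using assms
proof induction
  case zero
  then show ?case by simp
next
  case (step I g f b)
  have "(\<lambda>x. (a * b) * g x + (a * f x + h x)) \<in> wavelet_span"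
    by (rule wavelet_span.step[OF step(1,2)]) (use step in blast)
  then show ?case by (simp add: algebra_simps)
qed

lemma wavelet_span_test: "f \<in> wavelet_span \<Longrightarrow> f \<in> test_functions"
proof (induction rule: wavelet_span.induct)
  case zero
  then show ?case by (rule test_zero)
next
  case (step I g f a)
  then show ?case using test_lincomb[OF wavelet_space_test, of I g f a 1] by simp
qed

text \<open>The difference telescopes along the path from \<open>B\<close> to \<open>J\<close>. The
  last step, from the maximal subball \<open>M\<close> of \<open>J\<close> containing
  \<open>B\<close> to \<open>J\<close> itself, is the wavelet kernel of \<open>J\<close> at a point
  of \<open>M\<close>; the rest is the induction hypothesis for \<open>M\<close>.\<close>

lemma normalized_indicator_diff:
  assumes B: "is_ball B"
  shows "is_ball J \<Longrightarrow> B \<subseteq> J \<Longrightarrow>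
    (\<lambda>x. indicator B x / complex_of_real (measure \<nu> B) - indicator J x / complex_of_real (measure \<nu> J)) \<in> wavelet_span"
proof (induction J rule: wf_induct_rule[OF wf_balls_above[OF ultra reg B]])
  case (1 J)
  show ?case
  proof (cases "B = J")
    case True
    then show ?thesis using wavelet_span.zero by simp
  next
    case False
    then have BJ: "B \<subset> J" using 1 by blast
    obtain M where M: "M \<in> max_subballs J" "B \<subseteq> M"
      using ball_below_max_subball[OF 1(2) B BJ] by blast
    obtain y where y: "y \<in> M" using M max_subball ball_nonempty by blast
    have J: "J \<in> nonminimal" using nonminimalI B 1(2) BJ by blast
    have "complex_of_real (wavelet_kernel \<nu> J x y) =
        indicator M x / complex_of_real (measure \<nu> M) - indicator J x / complex_of_real (measure \<nu> J)" for x
    proof (cases "x \<in> J")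
      case True
      then show ?thesis
        using wavelet_kernel_inside[OF J M(1) y True] by (auto simp: wavelet_kernel_sym[of J x y] indicator_def)
    next
      case False
      then show ?thesis using wavelet_kernel_outside[of x J y] max_subball[OF M(1)] by (auto simp: indicator_def)
    qed
    then have V: "(\<lambda>x. indicator M x / complex_of_real (measure \<nu> M) - indicator J x / complex_of_real (measure \<nu> J)) \<in> wavelet_space \<nu> J"
      using wavelet_kernel_wavelet_space[OF J, of y] by simp
    have "(\<lambda>x. indicator B x / complex_of_real (measure \<nu> B) - indicator M x / complex_of_real (measure \<nu> M)) \<in> wavelet_span"
      using 1(1)[of M] 1(2) M max_subball[OF M(1)] by auto
    from wavelet_span.step[OF J V this, of 1] show ?thesis by simp
  qed
qed

text \<open>In a ball \<open>J\<close> containing all balls of the representation, each indicator is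
  compared with the normalized indicator of \<open>J\<close>. The subtracted multiples of the latter
  add up to the mean of \<open>f\<close>, hence to zero.\<close>

lemma mean_zero_wavelet_span:
  assumes f: "f \<in> test_functions" and mean: "(\<integral>x. f x \<partial>\<nu>) = 0"
  shows "f \<in> wavelet_span"
proof -
  obtain F c where F: "finite F" "\<forall>B\<in>F. is_ball B" "f = (\<lambda>x::'a. \<Sum>B\<in>F. c B * indicator B x)"
    using f by (rule test_functionsE)
  obtain J where J: "is_ball J" "\<Union>F \<subseteq> J"
    using balls_bounded_above[OF ultra reg F(1,2)] by blast
  define h where "h G x = (\<Sum>B\<in>G. (c B * complex_of_real (measure \<nu> B)) *
      (indicator B x / complex_of_real (measure \<nu> B) - indicator J x / complex_of_real (measure \<nu> J)))" for G x
  have "h G \<in> wavelet_span" if "finite G" "G \<subseteq> F" for G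
    using that
  proof (induction G rule: finite_induct)
    case empty
    then show ?case unfolding h_def using wavelet_span.zero by simp
  next
    case (insert B G)
    have "h (insert B G) = (\<lambda>x. (c B * complex_of_real (measure \<nu> B)) *
      (indicator B x / complex_of_real (measure \<nu> B) - indicator J x / complex_of_real (measure \<nu> J)) + h G x)"
      unfolding h_def by (intro ext sum.insert insert)
    moreover have "B \<subseteq> J" "is_ball B" using insert F J by auto
    ultimately show ?case
      using wavelet_span_add[OF normalized_indicator_diff[OF _ J(1)]] insert by simp
  qed
  then have "h F \<in> wavelet_span" using F by blast
  moreover have "h F = f"
  proof
    fix x
    have "(\<Sum>B\<in>F. c B * complex_of_real (measure \<nu> B)) = (\<integral>x. f x \<partial>\<nu>)"
      unfolding F(3) using F(2) integral_indicator_complex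
      by (intro has_bochner_integral_integral_eq[symmetric] has_bochner_integral_sum) auto
    then have "(\<Sum>B\<in>F. c B * complex_of_real (measure \<nu> B)) = 0" using mean by simp
    then have "(\<Sum>B\<in>F. (c B * complex_of_real (measure \<nu> B)) * (indicator J x / complex_of_real (measure \<nu> J))) = 0"
      by (simp only: sum_distrib_right[symmetric] mult_zero_left)
    moreover have "(\<Sum>B\<in>F. (c B * complex_of_real (measure \<nu> B)) * (indicator B x / complex_of_real (measure \<nu> B))) =
       (\<Sum>B\<in>F. c B * indicator B x)"
      using F(2) ball_measure_pos by (intro sum.cong refl) force
    ultimately show "h F x = f x"
      unfolding h_def F(3) right_diff_distrib sum_subtractf by simp
  qed
  ultimately show ?thesis by simp
qed

end

section \<open>The operator\<close>

lemma borel_measurable_nn_integral_count_space: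
  fixes f :: "'i \<Rightarrow> 'w \<Rightarrow> ennreal"
  assumes "countable I" and [measurable]: "\<And>i. i \<in> I \<Longrightarrow> f i \<in> borel_measurable M"
  shows "(\<lambda>x. \<integral>\<^sup>+i. f i x \<partial>count_space I) \<in> borel_measurable M"
proof (cases "finite I")
  case True
  then show ?thesis by (simp add: nn_integral_count_space_finite)
next
  case False
  then have [simp]: "I \<noteq> {}" by auto
  have "(\<integral>\<^sup>+i. f i x \<partial>count_space I) = (\<Sum>n. f (from_nat_into I n) x)" for x
    by (simp add: nn_integral_count_space_nat
        flip: nn_integral_bij_count_space[OF bij_betw_from_nat_into[OF \<open>countable I\<close> False]])
  then show ?thesis by (simp add: from_nat_into)
qed

text \<open>As an integral over the counting measure the series can be exchanged with the integral
  over \<open>\<nu>\<close>.\<close>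

lemma nn_integral_count_space_infsum:
  fixes f :: "'i \<Rightarrow> real"
  assumes "f summable_on A" "\<And>i. i \<in> A \<Longrightarrow> 0 \<le> f i"
  shows "(\<integral>\<^sup>+i. ennreal (f i) \<partial>count_space A) = ennreal (infsum f A)"
proof -
  have "Infinite_Sum.abs_summable_on f A"
    by (rule summable_on_iff_abs_summable_on_real[THEN iffD1, OF assms(1)])
  then have abs: "Infinite_Set_Sum.abs_summable_on f A" by (rule abs_summable_equivalent[THEN iffD1])
  then have "integrable (count_space A) f" by (simp add: Infinite_Set_Sum.abs_summable_on_def)
  then have "(\<integral>\<^sup>+i. ennreal (f i) \<partial>count_space A) = ennreal (\<integral>i. f i \<partial>count_space A)"
    using assms(2) by (intro nn_integral_eq_integral) (auto simp: AE_count_space)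
  also have "(\<integral>i. f i \<partial>count_space A) = infsum f A"
    using infsetsum_infsum[OF abs] by (simp add: infsetsum_def)
  finally show ?thesis .
qed

locale ultrametric_operator = regular_ultrametric \<nu> for \<nu> :: "'a::metric_space measure" +
  fixes T :: "'a set \<Rightarrow> real" and R :: "'a set"
  assumes T_nonneg: "\<And>I. I \<in> ball_tree \<Longrightarrow> 0 \<le> T I"
    and R_ball: "is_ball R"
    and series_T: "(\<lambda>J. T J * (measure \<nu> J - measure \<nu> (pred_vertex J R))) summable_on {J\<in>ball_tree. R \<subset> J}"
begin

text \<open>The part of the eigenvalue contributed by points outside \<open>I\<close>: for any
  \<open>x\<close> in \<open>I\<close> it is the integral of \<open>T (sup_ball x y)\<close> over
  all \<open>y\<close> outside \<open>I\<close>.\<close>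

definition outer_mass :: "'a set \<Rightarrow> real" where
  "outer_mass I = (\<Sum>\<^sub>\<infinity>J\<in>{J\<in>ball_tree. I \<subset> J}. T J * (measure \<nu> J - measure \<nu> (pred_vertex J I)))"

lemma psd_eigenvalue_eq: "psd_eigenvalue \<nu> T I = T I * measure \<nu> I + outer_mass I"
  by (simp add: psd_eigenvalue_def outer_mass_def)

lemma measure_pred_vertex_le:
  assumes "is_ball B" "is_ball J" "B \<subset> J"
  shows "measure \<nu> (pred_vertex J B) \<le> measure \<nu> J"
proof -
  have "pred_vertex J B \<subseteq> J" using pred_vertex_max_subball(1)[OF assms(2,1,3)] max_subball by blast
  then show ?thesis
    using ball_fmeasurable[OF assms(2)] pred_vertex_max_subball(1)[OF assms(2,1,3)] max_subball ball_measurable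
    by (intro measure_mono_fmeasurable) auto
qed

text \<open>The complement of \<open>B\<close> is the disjoint union of the shells between
  consecutive vertices \<open>pred_vertex J B\<close> and \<open>J\<close>. On the shell of
  \<open>J\<close> the ball \<open>sup_ball x y\<close> is \<open>J\<close>, so the integral is the
  defining series term by term.\<close>

lemma has_integral_outer_mass:
  assumes B: "is_ball B" and x: "x \<in> B"
  shows "has_bochner_integral \<nu> (\<lambda>y. T (sup_ball x y) * indicator (- B) y) (outer_mass B)"
proof -
  let ?J = "{J\<in>ball_tree. B \<subset> J}"
  let ?f = "\<lambda>J. T J * (measure \<nu> J - measure \<nu> (pred_vertex J B))"
  let ?g = "\<lambda>J y. ennreal (T J) * indicator (J - pred_vertex J B) y"
  have ball: "is_ball J" "B \<subset> J" "pred_vertex J B \<in> max_subballs J" "B \<subseteq> pred_vertex J B" "is_ball (pred_vertex J B)"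
    "pred_vertex J B \<subset> J" "J \<in> nonminimal" "0 \<le> T J"
    if "J \<in> ?J" for J
  proof -
    show J: "is_ball J" "B \<subset> J" using that by (auto simp: ball_in_ball_tree)
    show p: "pred_vertex J B \<in> max_subballs J" "B \<subseteq> pred_vertex J B"
      by (rule pred_vertex_max_subball[OF J(1) B J(2)])+
    show "is_ball (pred_vertex J B)" "pred_vertex J B \<subset> J" using max_subball[OF p(1)] by auto
    show "J \<in> nonminimal" using nonminimalI B J by blast
    show "0 \<le> T J" using that T_nonneg by blast
  qed
  have "?J \<subseteq> nonminimal" using ball(7) by blast
  then have count: "countable ?J" using countable_nonminimal countable_subset by blast
  have summ: "?f summable_on ?J"
    by (rule series_transfer[OF R_ball B, of "\<lambda>J M. T J * (measure \<nu> J - measure \<nu> M)"]) (rule series_T)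
  have nonneg: "0 \<le> ?f J" if "J \<in> ?J" for J
    using ball[OF that] measure_pred_vertex_le[OF B, of J] by simp
  have [measurable]: "J - pred_vertex J B \<in> sets \<nu>" if "J \<in> ?J" for J
    using ball[OF that] ball_measurable by blast
  have pt: "(\<integral>\<^sup>+J. ?g J y \<partial>count_space ?J) = ennreal (T (sup_ball x y) * indicator (- B) y)" for y
  proof (cases "y \<in> B")
    case True
    then have "?g J y = 0" if "J \<in> ?J" for J using ball(4)[OF that] by (auto simp: indicator_def)
    then have "(\<integral>\<^sup>+J. ?g J y \<partial>count_space ?J) = (\<integral>\<^sup>+J. 0 \<partial>count_space ?J)" by (intro nn_integral_cong) simp
    then show ?thesis using True by simp
  next
    case False
    let ?S = "sup_ball x y"
    have BS: "B \<subset> ?S" using sup_ball_outside(2)[OF B False x x] by (simp add: sup_ball_sym)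
    have Sb: "is_ball ?S" using False x by (intro sup_ball_ball) auto
    have SJ: "?S \<in> ?J" using BS Sb by (simp add: ball_in_ball_tree)
    have "?g J y = ennreal (T ?S) * indicator {?S} J" if J: "J \<in> ?J" for J
    proof (cases "y \<in> J - pred_vertex J B")
      case True
      have "x \<in> pred_vertex J B" using ball(4)[OF J] x by blast
      then have "?S = J" using sup_ball_eq_vertex[OF ball(7,3)[OF J], of x y] True by blast
      then show ?thesis using True by simp
    next
      case y: False
      have "J \<noteq> ?S"
      proof
        assume JS: "J = ?S"
        then have "y \<in> pred_vertex J B" using y sup_ball_mem(2)[of y x] by blast
        moreover have "x \<in> pred_vertex J B" using ball(4)[OF J] x by blast
        ultimately show False using sup_ball_in_max_subball(2)[OF ball(7,3)[OF J]] JS by blast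
      qed
      then show ?thesis using y by simp
    qed
    then have "(\<integral>\<^sup>+J. ?g J y \<partial>count_space ?J) = (\<integral>\<^sup>+J. ennreal (T ?S) * indicator {?S} J \<partial>count_space ?J)"
      by (intro nn_integral_cong) simp
    also have "\<dots> = ennreal (T ?S)"
      using SJ by (subst nn_integral_cmult_indicator) auto
    finally show ?thesis using False by simp
  qed
  have Tnn: "0 \<le> T (sup_ball x y) * indicator (- B) y" for y
  proof (cases "y \<in> B")
    case False
    then have "is_ball (sup_ball x y)" using x by (intro sup_ball_ball) auto
    then show ?thesis using T_nonneg by (simp add: ball_in_ball_tree)
  qed simp
  \<comment> \<open>Measurability of the kernel in \<open>y\<close> is read off from its
    representation as a countable sum over shells.\<close>
  have "(\<lambda>y. \<integral>\<^sup>+J. ?g J y \<partial>count_space ?J) \<in> borel_measurable \<nu>"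
    by (intro borel_measurable_nn_integral_count_space count) simp
  then have meas: "(\<lambda>y. ennreal (T (sup_ball x y) * indicator (- B) y)) \<in> borel_measurable \<nu>"
    unfolding pt .
  have meas': "(\<lambda>y. T (sup_ball x y) * indicator (- B) y) \<in> borel_measurable \<nu>"
    using borel_measurable_enn2real[OF meas] Tnn by simp
  have "(\<integral>\<^sup>+y. ennreal (T (sup_ball x y) * indicator (- B) y) \<partial>\<nu>) = (\<integral>\<^sup>+J. \<integral>\<^sup>+y. ?g J y \<partial>\<nu> \<partial>count_space ?J)"
    unfolding pt[symmetric] using count by (intro nn_integral_count_space_nn_integral) simp_all
  also have "\<dots> = (\<integral>\<^sup>+J. ennreal (?f J) \<partial>count_space ?J)"
  proof (rule nn_integral_cong)
    fix J assume "J \<in> space (count_space ?J)"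
    then have J: "J \<in> ?J" by simp
    have "(\<integral>\<^sup>+y. ?g J y \<partial>\<nu>) = ennreal (T J) * emeasure \<nu> (J - pred_vertex J B)"
      using J by (intro nn_integral_cmult_indicator) simp
    also have "emeasure \<nu> (J - pred_vertex J B) = ennreal (measure \<nu> (J - pred_vertex J B))"
      using ball[OF J] ball_fmeasurable by (intro emeasure_eq_measure2 fmeasurableD2 fmeasurable.Diff)
    also have "measure \<nu> (J - pred_vertex J B) = measure \<nu> J - measure \<nu> (pred_vertex J B)"
      using ball[OF J] ball_measure[OF ball(1)[OF J]] ball_measurable by (intro measure_Diff) auto
    finally show "(\<integral>\<^sup>+y. ?g J y \<partial>\<nu>) = ennreal (?f J)"
      using ball(8)[OF J] by (simp add: ennreal_mult')
  qed
  also have "\<dots> = ennreal (outer_mass B)"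
    unfolding outer_mass_def by (rule nn_integral_count_space_infsum[OF summ nonneg])
  finally show ?thesis
    using Tnn meas' unfolding outer_mass_def
    by (intro has_bochner_integral_nn_integral) (auto intro!: infsum_nonneg nonneg)
qed

text \<open>For \<open>x\<close> in \<open>B\<close> only points outside \<open>B\<close>
  contribute, which gives the outer mass. For \<open>x\<close> outside, only points of
  \<open>B\<close> contribute, and \<open>sup_ball x y\<close> is the same for all of them;
  \<open>SOME\<close> picks a representative.\<close>

lemma integrable_psd_indicator:
  assumes B: "is_ball B"
  shows "integrable \<nu> (\<lambda>y. complex_of_real (T (sup_ball x y)) * (c * indicator B x - c * indicator B y))"
    and "(\<integral>y. complex_of_real (T (sup_ball x y)) * (c * indicator B x - c * indicator B y) \<partial>\<nu>) =
      (if x \<in> B then c * complex_of_real (outer_mass B)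
       else - c * complex_of_real (T (sup_ball x (SOME y. y \<in> B)) * measure \<nu> B))"
proof -
  have "has_bochner_integral \<nu> (\<lambda>y. complex_of_real (T (sup_ball x y)) * (c * indicator B x - c * indicator B y))
     (if x \<in> B then c * complex_of_real (outer_mass B)
       else - c * complex_of_real (T (sup_ball x (SOME y. y \<in> B)) * measure \<nu> B))"
  proof (cases "x \<in> B")
    case True
    have "has_bochner_integral \<nu> (\<lambda>y. c * complex_of_real (T (sup_ball x y) * indicator (- B) y)) (c * complex_of_real (outer_mass B))"
      by (intro has_bochner_integral_mult_right has_bochner_integral_of_real has_integral_outer_mass B True)
    moreover have "(\<lambda>y. c * complex_of_real (T (sup_ball x y) * indicator (- B) y)) =
       (\<lambda>y. complex_of_real (T (sup_ball x y)) * (c * indicator B x - c * indicator B y))"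
      using True by (auto simp: indicator_def)
    ultimately show ?thesis using True by (simp only: if_True)
  next
    case False
    define z where "z = (SOME y. y \<in> B)"
    have z: "z \<in> B" unfolding z_def using ball_nonempty[OF B] by (simp add: some_in_eq)
    have "has_bochner_integral \<nu> (\<lambda>y. (- c * complex_of_real (T (sup_ball x z))) * indicator B y)
        ((- c * complex_of_real (T (sup_ball x z))) * complex_of_real (measure \<nu> B))"
      by (rule integral_indicator_complex[OF B])
    moreover have "(\<lambda>y. (- c * complex_of_real (T (sup_ball x z))) * indicator B y) =
       (\<lambda>y. complex_of_real (T (sup_ball x y)) * (c * indicator B x - c * indicator B y))"
      using False sup_ball_outside(1)[OF B False _ z] by (auto simp: indicator_def)
    ultimately show ?thesis using False unfolding z_def by (simp only: if_False of_real_mult mult.assoc)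
  qed
  then show "integrable \<nu> (\<lambda>y. complex_of_real (T (sup_ball x y)) * (c * indicator B x - c * indicator B y))"
    and "(\<integral>y. complex_of_real (T (sup_ball x y)) * (c * indicator B x - c * indicator B y) \<partial>\<nu>) =
      (if x \<in> B then c * complex_of_real (outer_mass B)
       else - c * complex_of_real (T (sup_ball x (SOME y. y \<in> B)) * measure \<nu> B))"
    by (auto simp: has_bochner_integral_iff)
qed

lemma integrable_psd:
  "f \<in> test_functions \<Longrightarrow> integrable \<nu> (\<lambda>y. complex_of_real (T (sup_ball x y)) * (f x - f y))"
proof (induction rule: test_functions_induct)
  case (add f g)
  then have "integrable \<nu> (\<lambda>y. complex_of_real (T (sup_ball x y)) * (f x - f y) + complex_of_real (T (sup_ball x y)) * (g x - g y))"
    by (intro Bochner_Integration.integrable_add)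
  then show ?case by (simp add: algebra_simps)
qed (auto intro: integrable_psd_indicator)

lemma psd_op_lincomb:
  assumes f: "f \<in> test_functions" and g: "g \<in> test_functions"
  shows "psd_op \<nu> T (\<lambda>x. a * f x + b * g x) = (\<lambda>x. a * psd_op \<nu> T f x + b * psd_op \<nu> T g x)"
proof
  fix x
  have "psd_op \<nu> T (\<lambda>x. a * f x + b * g x) x =
     (\<integral>y. a * (complex_of_real (T (sup_ball x y)) * (f x - f y)) + b * (complex_of_real (T (sup_ball x y)) * (g x - g y)) \<partial>\<nu>)"
    unfolding psd_op_def by (intro Bochner_Integration.integral_cong) (auto simp: algebra_simps)
  also have "\<dots> = a * psd_op \<nu> T f x + b * psd_op \<nu> T g x"
    unfolding psd_op_def using integrable_psd[OF f, of x] integrable_psd[OF g, of x]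
    by (subst Bochner_Integration.integral_add) auto
  finally show "psd_op \<nu> T (\<lambda>x. a * f x + b * g x) x = a * psd_op \<nu> T f x + b * psd_op \<nu> T g x" .
qed

text \<open>For \<open>x\<close> in \<open>I\<close> the factor \<open>T (sup_ball x y)\<close> may
  be replaced by \<open>T I\<close> for every \<open>y\<close> in \<open>I\<close>: in other
  subballs the two agree, and in the subball of \<open>x\<close> the difference
  \<open>g x - g y\<close> is zero. Mean zero of \<open>g\<close> then leaves
  \<open>T I * measure \<nu> I\<close> from inside, and the outer mass comes from outside. For
  \<open>x\<close> outside \<open>I\<close> the kernel is constant on \<open>I\<close> and mean zero
  gives 0.\<close>

lemma psd_op_wavelet:
  assumes I: "I \<in> nonminimal" and g: "g \<in> wavelet_space \<nu> I"
  shows "psd_op \<nu> T g = (\<lambda>x. complex_of_real (psd_eigenvalue \<nu> T I) * g x)"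
proof
  fix x
  have Ib: "is_ball I" using I by (rule nonminimal_ball)
  have gint: "integrable \<nu> g" using test_integrable wavelet_space_test[OF I g] by blast
  have g0: "(\<integral>y. g y \<partial>\<nu>) = 0" using g by (simp add: wavelet_space_def)
  show "psd_op \<nu> T g x = complex_of_real (psd_eigenvalue \<nu> T I) * g x"
  proof (cases "x \<in> I")
    case True
    then obtain M where M: "M \<in> max_subballs I" "x \<in> M" using max_subball_ex[OF I] by blast
    have "complex_of_real (T (sup_ball x y)) * (g x - g y) =
       complex_of_real (T I) * (g x * indicator I y) - complex_of_real (T I) * g y + g x * complex_of_real (T (sup_ball x y) * indicator (- I) y)" for y
    proof (cases "y \<in> I")
      case y: True
      show ?thesis
      proof (cases "y \<in> M")
        case True
        then show ?thesis using wavelet_space_const[OF I g M(1) M(2), of y] y by simp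
      next
        case False
        then show ?thesis using sup_ball_eq_vertex[OF I M y] y by (simp add: right_diff_distrib)
      qed
    next
      case False
      then show ?thesis using wavelet_space_outside[OF g False] by simp
    qed
    then have "psd_op \<nu> T g x = (\<integral>y. complex_of_real (T I) * (g x * indicator I y) - complex_of_real (T I) * g y + g x * complex_of_real (T (sup_ball x y) * indicator (- I) y) \<partial>\<nu>)"
      unfolding psd_op_def by simp
    also have "\<dots> = complex_of_real (T I) * (g x * complex_of_real (measure \<nu> I)) - complex_of_real (T I) * 0 + g x * complex_of_real (outer_mass I)"
    proof (intro has_bochner_integral_integral_eq has_bochner_integral_add has_bochner_integral_diff has_bochner_integral_mult_right
        has_bochner_integral_of_real has_integral_outer_mass integral_indicator_complex Ib True)
      show "has_bochner_integral \<nu> g 0" using gint g0 by (simp add: has_bochner_integral_iff)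
      show "has_bochner_integral \<nu> (indicator I) (complex_of_real (measure \<nu> I))"
        using integral_indicator_complex[OF Ib, of 1] by simp
    qed
    also have "\<dots> = complex_of_real (psd_eigenvalue \<nu> T I) * g x"
      by (simp add: psd_eigenvalue_eq algebra_simps)
    finally show ?thesis .
  next
    case False
    obtain z where z: "z \<in> I" using ball_nonempty[OF Ib] by blast
    have "complex_of_real (T (sup_ball x y)) * (g x - g y) = - complex_of_real (T (sup_ball x z)) * g y" for y
      using wavelet_space_outside[OF g False] wavelet_space_outside[OF g, of y] sup_ball_outside(1)[OF Ib False _ z, of y]
      by (cases "y \<in> I") auto
    then have "psd_op \<nu> T g x = (\<integral>y. - complex_of_real (T (sup_ball x z)) * g y \<partial>\<nu>)" unfolding psd_op_def by simp
    also have "\<dots> = 0" using g0 by simp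
    finally show ?thesis using wavelet_space_outside[OF g False] by simp
  qed
qed

end

section \<open>Gaussian fields\<close>

context regular_ultrametric
begin

lemma gaussian_field_measurable:
  "gaussian_field P \<phi> \<Longrightarrow> f \<in> test_functions \<Longrightarrow> \<phi> f \<in> borel_measurable P" for f :: "'a \<Rightarrow> complex"
  by (simp add: gaussian_field_def)

lemma gaussian_field_lincomb:
  "gaussian_field P \<phi> \<Longrightarrow> f \<in> test_functions \<Longrightarrow> g \<in> test_functions \<Longrightarrow>
    AE \<omega> in P. \<phi> (\<lambda>x. a * f x + b * g x) \<omega> = a * \<phi> f \<omega> + b * \<phi> g \<omega>" for f g :: "'a \<Rightarrow> complex"
  by (simp add: gaussian_field_def)

lemma gaussian_field_real:
  fixes f :: "'a \<Rightarrow> complex"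
  assumes "gaussian_field P \<phi>" "f \<in> test_functions" "range f \<subseteq> \<real>"
  shows "AE \<omega> in P. \<phi> f \<omega> \<in> \<real>" "\<exists>s\<ge>0. distr P borel (\<lambda>\<omega>. Re (\<phi> f \<omega>)) = centered_normal s"
  using assms by (simp_all add: gaussian_field_def)

lemma gaussian_field_sum:
  fixes f :: "'i \<Rightarrow> 'a \<Rightarrow> complex"
  assumes \<phi>: "gaussian_field P \<phi>" and "finite F" "\<And>i. i \<in> F \<Longrightarrow> f i \<in> test_functions"
  shows "AE \<omega> in P. \<phi> (\<lambda>x. \<Sum>i\<in>F. a i * f i x) \<omega> = (\<Sum>i\<in>F. a i * \<phi> (f i) \<omega>)"
  using assms(2,3)
proof (induction F rule: finite_induct)
  case empty
  show ?case using gaussian_field_lincomb[OF \<phi> test_zero test_zero, of 0 0] by simp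
next
  case (insert i F)
  have t: "f i \<in> test_functions" "(\<lambda>x. \<Sum>i\<in>F. a i * f i x) \<in> test_functions"
    using insert test_sum[of F "\<lambda>i x. a i * f i x"] by (auto intro: test_scale)
  from insert have "AE \<omega> in P. \<phi> (\<lambda>x. \<Sum>i\<in>F. a i * f i x) \<omega> = (\<Sum>i\<in>F. a i * \<phi> (f i) \<omega>)" by simp
  with gaussian_field_lincomb[OF \<phi> t, of "a i" 1] show ?case
    by eventually_elim (simp add: insert(1,2))
qed

lemma gaussian_field_Re_Im:
  fixes f :: "'a \<Rightarrow> complex"
  assumes \<phi>: "gaussian_field P \<phi>" and f: "f \<in> test_functions"
  shows "AE \<omega> in P. \<phi> f \<omega> = \<phi> (\<lambda>x. complex_of_real (Re (f x))) \<omega> + \<i> * \<phi> (\<lambda>x. complex_of_real (Im (f x))) \<omega>"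
proof -
  have "(\<lambda>x. 1 * complex_of_real (Re (f x)) + \<i> * complex_of_real (Im (f x))) = f"
    by (auto simp: complex_eq_iff)
  then show ?thesis using gaussian_field_lincomb[OF \<phi> test_Re_Im[OF f], of 1 \<i>] by simp
qed

lemma gaussian_field_square_integrable:
  fixes f :: "'a \<Rightarrow> complex"
  assumes \<phi>: "gaussian_field P \<phi>" and f: "f \<in> test_functions"
  shows "square_integrable P (\<phi> f)"
proof -
  have real: "square_integrable P (\<phi> g)" if g: "g \<in> test_functions" "range g \<subseteq> \<real>" for g
    using gaussian_field_real[OF \<phi> g] centered_normal_real_variable(1)[OF gaussian_field_measurable[OF \<phi> g(1)]] by blast
  have "square_integrable P (\<lambda>\<omega>. \<phi> (\<lambda>x. complex_of_real (Re (f x))) \<omega> + \<i> * \<phi> (\<lambda>x. complex_of_real (Im (f x))) \<omega>)"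
    by (intro square_integrable_add square_integrable_scale real test_Re_Im[OF f]) auto
  then show ?thesis
    by (rule square_integrable_AE_cong) (use gaussian_field_Re_Im[OF \<phi> f] gaussian_field_measurable[OF \<phi> f] in \<open>auto simp: eq_commute\<close>)
qed

text \<open>The field is complex linear, and real almost surely on real test functions, so
  conjugation acts on the test function. This is how covariances with a conjugate are derived from
  bilinear ones.\<close>

lemma gaussian_field_cnj:
  fixes f :: "'a \<Rightarrow> complex"
  assumes \<phi>: "gaussian_field P \<phi>" and f: "f \<in> test_functions"
  shows "AE \<omega> in P. cnj (\<phi> f \<omega>) = \<phi> (\<lambda>x. cnj (f x)) \<omega>"
proof -
  have "(\<lambda>x. 1 * complex_of_real (Re (f x)) + (- \<i>) * complex_of_real (Im (f x))) = (\<lambda>x. cnj (f x))"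
    by (auto simp: complex_eq_iff)
  with gaussian_field_lincomb[OF \<phi> test_Re_Im[OF f], of 1 "- \<i>"]
  have "AE \<omega> in P. \<phi> (\<lambda>x. cnj (f x)) \<omega> =
     \<phi> (\<lambda>x. complex_of_real (Re (f x))) \<omega> - \<i> * \<phi> (\<lambda>x. complex_of_real (Im (f x))) \<omega>" by simp
  moreover have "AE \<omega> in P. \<phi> (\<lambda>x. complex_of_real (Re (f x))) \<omega> \<in> \<real>" "AE \<omega> in P. \<phi> (\<lambda>x. complex_of_real (Im (f x))) \<omega> \<in> \<real>"
    using test_Re_Im[OF f] by (auto intro!: gaussian_field_real[OF \<phi>])
  ultimately show ?thesis using gaussian_field_Re_Im[OF \<phi> f]
    by eventually_elim (auto simp: Reals_cnj_iff)
qed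

lemma white_noise_covariance:
  assumes \<phi>: "white_noise \<nu> P \<phi>" and f: "f \<in> test_functions" and g: "g \<in> test_functions"
  shows "(\<integral>\<omega>. cnj (\<phi> f \<omega>) * \<phi> g \<omega> \<partial>P) = (\<integral>x. cnj (f x) * g x \<partial>\<nu>)"
proof -
  have G: "gaussian_field P \<phi>" using \<phi> by (simp add: white_noise_def)
  note [measurable] = gaussian_field_measurable[OF G f] gaussian_field_measurable[OF G g] gaussian_field_measurable[OF G test_cnj[OF f]]
  have "(\<integral>\<omega>. cnj (\<phi> f \<omega>) * \<phi> g \<omega> \<partial>P) = (\<integral>\<omega>. \<phi> (\<lambda>x. cnj (f x)) \<omega> * \<phi> g \<omega> \<partial>P)"
    using gaussian_field_cnj[OF G f] by (intro integral_cong_AE) auto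
  also have "\<dots> = (\<integral>x. cnj (f x) * g x \<partial>\<nu>)"
    using \<phi> test_cnj[OF f] g by (simp add: white_noise_def)
  finally show ?thesis .
qed

abbreviation wavelet_numbers :: "'a set \<Rightarrow> nat set" where
  "wavelet_numbers I \<equiv> {1..card (max_subballs I) - 1}"

end

locale wavelet_system = ultrametric_operator \<nu> T R
  for \<nu> :: "'a::metric_space measure" and T :: "'a set \<Rightarrow> real" and R :: "'a set" +
  fixes \<Psi> :: "'a set \<Rightarrow> nat \<Rightarrow> 'a \<Rightarrow> complex"
  assumes T_positive: "\<And>I. I \<in> nonminimal \<Longrightarrow> 0 < psd_eigenvalue \<nu> T I"
    and series_eigenvalue: "(\<lambda>I. (inverse (psd_eigenvalue \<nu> T I))\<^sup>2
            * (inverse (measure \<nu> (pred_vertex I R)) - inverse (measure \<nu> I)))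
          summable_on {I\<in>ball_tree. R \<subset> I}"
    and basis: "wavelet_basis \<nu> \<Psi>"
begin

abbreviation lam :: "'a set \<Rightarrow> real" where "lam I \<equiv> psd_eigenvalue \<nu> T I"

lemma wavelet_in_space: "I \<in> nonminimal \<Longrightarrow> j \<in> wavelet_numbers I \<Longrightarrow> \<Psi> I j \<in> wavelet_space \<nu> I"
  using basis unfolding wavelet_basis_def by blast

lemma wavelet_test: "I \<in> nonminimal \<Longrightarrow> j \<in> wavelet_numbers I \<Longrightarrow> \<Psi> I j \<in> test_functions"
  using wavelet_in_space wavelet_space_test by blast

lemma wavelet_orthonormal:
  assumes i: "(I, j) \<in> wavelet_index" and k: "(K, l) \<in> wavelet_index"
  shows "(\<integral>x. cnj (\<Psi> I j x) * \<Psi> K l x \<partial>\<nu>) = (if (I, j) = (K, l) then 1 else 0)"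
proof (cases "I = K")
  case True
  then show ?thesis using i k basis unfolding wavelet_basis_def wavelet_index_def by auto
next
  case False
  then show ?thesis
    using i k wavelet_space_orthogonal[OF _ wavelet_space_cnj, of I "\<Psi> I j" K "\<Psi> K l"] wavelet_in_space
    by (auto simp: wavelet_index_def)
qed

text \<open>The wavelet carries no conjugate here because the field is paired bilinearly with
  \<open>f\<close>; the conjugate sits in the random coefficient \<open>noise_coeff\<close>.\<close>

definition coeff :: "('a \<Rightarrow> complex) \<Rightarrow> 'a set \<times> nat \<Rightarrow> complex" where
  "coeff f = (\<lambda>(I, j). complex_of_real (inverse (lam I)) * (\<integral>x. \<Psi> I j x * f x \<partial>\<nu>))"

lemma wavelet_times_test:
  "(I, j) \<in> wavelet_index \<Longrightarrow> f \<in> test_functions \<Longrightarrow> integrable \<nu> (\<lambda>x. \<Psi> I j x * f x)"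
  using wavelet_test by (intro test_integrable test_mult) (auto simp: wavelet_index_def)

lemma coeff_lincomb:
  assumes "i \<in> wavelet_index" "f \<in> test_functions" "g \<in> test_functions"
  shows "coeff (\<lambda>x. a * f x + b * g x) i = a * coeff f i + b * coeff g i"
proof -
  obtain I j where i: "i = (I, j)" by fastforce
  have "(\<integral>x. \<Psi> I j x * (a * f x + b * g x) \<partial>\<nu>) = (\<integral>x. a * (\<Psi> I j x * f x) + b * (\<Psi> I j x * g x) \<partial>\<nu>)"
    by (simp add: algebra_simps)
  also have "\<dots> = a * (\<integral>x. \<Psi> I j x * f x \<partial>\<nu>) + b * (\<integral>x. \<Psi> I j x * g x \<partial>\<nu>)"
    using wavelet_times_test[of I j f] wavelet_times_test[of I j g] assms i
    by (subst Bochner_Integration.integral_add) auto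
  finally show ?thesis by (simp add: coeff_def i algebra_simps)
qed

text \<open>A ball strictly inside \<open>I\<close> lies in one maximal subball, where the wavelet
  is constant. Otherwise it is disjoint from \<open>I\<close> or contains \<open>I\<close>, and in
  the latter case the integral is the mean of the wavelet.\<close>

lemma wavelet_integral_indicator:
  assumes I: "I \<in> nonminimal" and j: "j \<in> wavelet_numbers I" and B: "is_ball B"
  shows "B \<subset> I \<Longrightarrow> b \<in> B \<Longrightarrow> (\<integral>x. \<Psi> I j x * indicator B x \<partial>\<nu>) = \<Psi> I j b * complex_of_real (measure \<nu> B)"
    and "\<not> B \<subset> I \<Longrightarrow> (\<integral>x. \<Psi> I j x * indicator B x \<partial>\<nu>) = 0"
proof -
  note V = wavelet_in_space[OF I j]
  assume BI: "B \<subset> I" and b: "b \<in> B"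
  obtain M where M: "M \<in> max_subballs I" "B \<subseteq> M"
    using ball_below_max_subball[OF nonminimal_ball[OF I] B BI] by blast
  have "\<Psi> I j x * indicator B x = \<Psi> I j b * indicator B x" for x
    using wavelet_space_const[OF I V M(1), of x b] M(2) b by (auto simp: indicator_def)
  then have "(\<integral>x. \<Psi> I j x * indicator B x \<partial>\<nu>) = (\<integral>x. \<Psi> I j b * indicator B x \<partial>\<nu>)"
    by (rule Bochner_Integration.integral_cong[OF refl])
  then show "(\<integral>x. \<Psi> I j x * indicator B x \<partial>\<nu>) = \<Psi> I j b * complex_of_real (measure \<nu> B)"
    using integral_indicator_complex[OF B, of "\<Psi> I j b"] by (simp only: has_bochner_integral_iff)
next
  note V = wavelet_in_space[OF I j]
  assume nB: "\<not> B \<subset> I"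
  show "(\<integral>x. \<Psi> I j x * indicator B x \<partial>\<nu>) = 0"
  proof (cases "B \<inter> I = {}")
    case True
    then have "\<Psi> I j x * indicator B x = 0" for x using wavelet_space_outside[OF V, of x] by (auto simp: indicator_def)
    then have "(\<integral>x. \<Psi> I j x * indicator B x \<partial>\<nu>) = (\<integral>x. 0 \<partial>\<nu>)" by (rule Bochner_Integration.integral_cong[OF refl])
    then show ?thesis by simp
  next
    case False
    then have "I \<subseteq> B" using nested[OF B nonminimal_ball[OF I]] nB by blast
    then have "\<Psi> I j x * indicator B x = \<Psi> I j x" for x using wavelet_space_outside[OF V, of x] by (auto simp: indicator_def)
    then have "(\<integral>x. \<Psi> I j x * indicator B x \<partial>\<nu>) = (\<integral>x. \<Psi> I j x \<partial>\<nu>)" by (rule Bochner_Integration.integral_cong[OF refl])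
    then show ?thesis using V by (simp add: wavelet_space_def)
  qed
qed

lemma coeff_indicator_summable:
  assumes B: "is_ball B"
  shows "(\<lambda>i. (cmod (coeff (indicator B) i))\<^sup>2) summable_on wavelet_index"
proof -
  let ?g = "\<lambda>I. (inverse (lam I))\<^sup>2 * (inverse (measure \<nu> (pred_vertex I B)) - inverse (measure \<nu> I))"
  let ?U = "{I\<in>ball_tree. B \<subset> I}"
  obtain b where b: "b \<in> B" using ball_nonempty[OF B] by blast
  have summ: "?g summable_on ?U"
    by (rule series_transfer[OF R_ball B, of "\<lambda>I M. (inverse (lam I))\<^sup>2 * (inverse (measure \<nu> M) - inverse (measure \<nu> I))"])
      (rule series_eigenvalue)
  then have "(\<lambda>I. (measure \<nu> B)\<^sup>2 * ?g I) summable_on ?U" by (rule summable_on_cmult_right)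
  \<comment> \<open>Extension by zero from the path above \<open>B\<close> to all non-minimal
    vertices, the base of the index set of wavelets.\<close>
  also have "?this \<longleftrightarrow> (\<lambda>I. if B \<subset> I then (measure \<nu> B)\<^sup>2 * ?g I else 0) summable_on nonminimal"
    using nonminimal_ball by (intro summable_on_cong_neutral) (auto simp: ball_in_ball_tree intro: nonminimalI[OF B])
  finally have summ': "(\<lambda>I. if B \<subset> I then (measure \<nu> B)\<^sup>2 * ?g I else 0) summable_on nonminimal" .
  show ?thesis unfolding wavelet_index_def
  proof (rule summable_on_SigmaI[OF _ summ'])
    fix I :: "'a set" assume I: "I \<in> nonminimal"
    have "(\<Sum>j\<in>wavelet_numbers I. (cmod (coeff (indicator B) (I, j)))\<^sup>2) = (if B \<subset> I then (measure \<nu> B)\<^sup>2 * ?g I else 0)"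
    proof (cases "B \<subset> I")
      case False
      then have "coeff (indicator B) (I, j) = 0" if "j \<in> wavelet_numbers I" for j
        using wavelet_integral_indicator(2)[OF I that B] by (simp add: coeff_def)
      then have "(\<Sum>j\<in>wavelet_numbers I. (cmod (coeff (indicator B) (I, j)))\<^sup>2) = 0"
        by (intro sum.neutral ballI) simp
      then show ?thesis using False by simp
    next
      case True
      note p = pred_vertex_max_subball[OF nonminimal_ball[OF I] B True]
      have "complex_of_real (\<Sum>j\<in>wavelet_numbers I. (cmod (coeff (indicator B) (I, j)))\<^sup>2) =
         (\<Sum>j\<in>wavelet_numbers I. complex_of_real ((inverse (lam I))\<^sup>2 * (measure \<nu> B)\<^sup>2) * (\<Psi> I j b * cnj (\<Psi> I j b)))"
        unfolding of_real_sum
      proof (rule sum.cong[OF refl])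
        fix j assume j: "j \<in> wavelet_numbers I"
        have "coeff (indicator B) (I, j) = complex_of_real (inverse (lam I)) * (\<Psi> I j b * complex_of_real (measure \<nu> B))"
          using wavelet_integral_indicator(1)[OF I j B True b] by (simp add: coeff_def)
        then show "complex_of_real ((cmod (coeff (indicator B) (I, j)))\<^sup>2) =
           complex_of_real ((inverse (lam I))\<^sup>2 * (measure \<nu> B)\<^sup>2) * (\<Psi> I j b * cnj (\<Psi> I j b))"
          unfolding complex_norm_square by (simp add: power2_eq_square)
      qed
      also have "\<dots> = complex_of_real ((inverse (lam I))\<^sup>2 * (measure \<nu> B)\<^sup>2 * wavelet_kernel \<nu> I b b)"
        unfolding sum_distrib_left[symmetric] wavelet_sum_eq_kernel[OF basis I] by simp
      \<comment> \<open>On the diagonal at a point of \<open>B\<close> the relevant maximal subball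
        is the predecessor vertex, which produces the term of the second series.\<close>
      also have "wavelet_kernel \<nu> I b b = inverse (measure \<nu> (pred_vertex I B)) - inverse (measure \<nu> I)"
        using wavelet_kernel_inside[OF I p(1), of b b] b p(2) True by (auto simp: divide_inverse indicator_def)
      finally show ?thesis using True by (simp only: of_real_eq_iff if_True mult_ac)
    qed
    then show "((\<lambda>j. (cmod (coeff (indicator B) (I, j)))\<^sup>2) has_sum (if B \<subset> I then (measure \<nu> B)\<^sup>2 * ?g I else 0)) (wavelet_numbers I)"
      using has_sum_finite[of "wavelet_numbers I" "\<lambda>j. (cmod (coeff (indicator B) (I, j)))\<^sup>2"] by simp
  qed auto
qed

lemma coeff_summable:
  "f \<in> test_functions \<Longrightarrow> (\<lambda>i. (cmod (coeff f i))\<^sup>2) summable_on wavelet_index"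
proof (induction rule: test_functions_induct)
  case zero
  have "coeff (\<lambda>x. 0) i = 0" for i by (simp add: coeff_def split: prod.split)
  then show ?case by simp
next
  case (indicator B c)
  have "(cmod (coeff (\<lambda>x. c * indicator B x) i))\<^sup>2 = (cmod c)\<^sup>2 * (cmod (coeff (indicator B) i))\<^sup>2"
    if "i \<in> wavelet_index" for i
    using coeff_lincomb[OF that test_indicator'[OF indicator] test_zero, of c 0]
    by (simp add: norm_mult power_mult_distrib)
  then have "(\<lambda>i. (cmod (coeff (\<lambda>x. c * indicator B x) i))\<^sup>2) summable_on wavelet_index \<longleftrightarrow>
     (\<lambda>i. (cmod c)\<^sup>2 * (cmod (coeff (indicator B) i))\<^sup>2) summable_on wavelet_index"
    by (rule summable_on_cong)
  then show ?case using summable_on_cmult_right[OF coeff_indicator_summable[OF indicator], of "(cmod c)\<^sup>2"] by simp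
next
  case (add f g)
  have "(\<lambda>i. 2 * (cmod (coeff f i))\<^sup>2 + 2 * (cmod (coeff g i))\<^sup>2) summable_on wavelet_index"
    using add by (intro summable_on_add summable_on_cmult_right)
  then show ?case
  proof (rule summable_on_comparison_test)
    fix i :: "'a set \<times> nat" assume "i \<in> wavelet_index"
    from coeff_lincomb[OF this add(1,2), of 1 1]
    show "(cmod (coeff (\<lambda>x. f x + g x) i))\<^sup>2 \<le> 2 * (cmod (coeff f i))\<^sup>2 + 2 * (cmod (coeff g i))\<^sup>2"
      by (simp add: norm_sq_add_le)
  qed auto
qed

text \<open>The kernel is a finite sum of products, so the double integral factors. Its symmetry
  allows the conjugated wavelet to go with \<open>x\<close>, where \<open>f\<close> is conjugated
  too.\<close>

lemma wavelet_parseval: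
  assumes I: "I \<in> nonminimal" and f: "f \<in> test_functions" and g: "g \<in> test_functions"
  shows "(\<integral>x. (\<integral>x'. complex_of_real (covariation_term \<nu> T I x x') * cnj (f x) * g x' \<partial>\<nu>) \<partial>\<nu>) =
    (\<Sum>j\<in>wavelet_numbers I. cnj (coeff f (I, j)) * coeff g (I, j))"
proof -
  let ?c = "complex_of_real ((inverse (lam I))\<^sup>2)"
  let ?F = "\<lambda>j. \<integral>x. cnj (\<Psi> I j x * f x) \<partial>\<nu>" and ?G = "\<lambda>j. \<integral>x. \<Psi> I j x * g x \<partial>\<nu>"
  have idx: "(I, j) \<in> wavelet_index" if "j \<in> wavelet_numbers I" for j using that I by (simp add: wavelet_index_def)
  have pt: "complex_of_real (covariation_term \<nu> T I x x') * cnj (f x) * g x' =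
     (\<Sum>j\<in>wavelet_numbers I. (?c * cnj (\<Psi> I j x * f x)) * (\<Psi> I j x' * g x'))" for x x'
  proof -
    have "complex_of_real (wavelet_kernel \<nu> I x x') = (\<Sum>j\<in>wavelet_numbers I. \<Psi> I j x' * cnj (\<Psi> I j x))"
      unfolding wavelet_sum_eq_kernel[OF basis I] by (simp add: wavelet_kernel_sym)
    then show ?thesis unfolding covariation_term_eq[OF I] of_real_mult
      by (simp add: sum_distrib_left sum_distrib_right mult_ac)
  qed
  have gint: "integrable \<nu> (\<lambda>x. \<Psi> I j x * g x)" if "j \<in> wavelet_numbers I" for j
    by (rule wavelet_times_test[OF idx[OF that] g])
  have fint: "integrable \<nu> (\<lambda>x. cnj (\<Psi> I j x * f x))" if "j \<in> wavelet_numbers I" for j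
    by (rule integrable_cnj[OF wavelet_times_test[OF idx[OF that] f]])
  have "(\<integral>x'. complex_of_real (covariation_term \<nu> T I x x') * cnj (f x) * g x' \<partial>\<nu>) =
     (\<Sum>j\<in>wavelet_numbers I. (?c * ?G j) * cnj (\<Psi> I j x * f x))" for x
    unfolding pt using gint by (subst Bochner_Integration.integral_sum) (auto intro!: sum.cong)
  then have "(\<integral>x. (\<integral>x'. complex_of_real (covariation_term \<nu> T I x x') * cnj (f x) * g x' \<partial>\<nu>) \<partial>\<nu>) =
    (\<integral>x. (\<Sum>j\<in>wavelet_numbers I. (?c * ?G j) * cnj (\<Psi> I j x * f x)) \<partial>\<nu>)" by (simp only:)
  also have "\<dots> = (\<Sum>j\<in>wavelet_numbers I. \<integral>x. (?c * ?G j) * cnj (\<Psi> I j x * f x) \<partial>\<nu>)"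
    using fint by (intro Bochner_Integration.integral_sum integrable_mult_right) auto
  also have "\<dots> = (\<Sum>j\<in>wavelet_numbers I. (?c * ?G j) * ?F j)"
    by (simp only: integral_mult_right_zero)
  also have "\<dots> = (\<Sum>j\<in>wavelet_numbers I. cnj (coeff f (I, j)) * coeff g (I, j))"
    unfolding Bochner_Integration.integral_cnj by (intro sum.cong refl) (simp add: coeff_def power2_eq_square)
  finally show ?thesis .
qed

end

section \<open>The solution\<close>

locale wavelet_noise = wavelet_system \<nu> T R \<Psi> + prob_space P
  for \<nu> :: "'a::metric_space measure" and T R \<Psi> and P :: "'w measure" +
  fixes \<phi> :: "('a \<Rightarrow> complex) \<Rightarrow> 'w \<Rightarrow> complex"
  assumes noise: "white_noise \<nu> P \<phi>"
begin

lemma noise_gaussian: "gaussian_field P \<phi>"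
  using noise by (simp add: white_noise_def)

definition noise_coeff :: "'a set \<times> nat \<Rightarrow> 'w \<Rightarrow> complex" where
  "noise_coeff = (\<lambda>(I, j). \<phi> (\<lambda>x. cnj (\<Psi> I j x)))"

definition partial_sum :: "('a \<Rightarrow> complex) \<Rightarrow> ('a set \<times> nat) set \<Rightarrow> 'w \<Rightarrow> complex" where
  "partial_sum f F \<omega> = (\<Sum>i\<in>F. coeff f i * noise_coeff i \<omega>)"

lemma is_solution_iff:
  "is_solution \<nu> T \<Psi> P \<phi> \<psi> \<longleftrightarrow> (\<forall>f\<in>test_functions. \<psi> f \<in> borel_measurable P \<and>
     L2_tendsto P (partial_sum f) (\<psi> f) (finite_subsets_at_top wavelet_index))"
proof -
  have "(\<lambda>(I, j). complex_of_real (inverse (lam I)) * \<phi> (\<lambda>x. cnj (\<Psi> I j x)) \<omega> * (\<integral>x. \<Psi> I j x * f x \<partial>\<nu>)) =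
    (\<lambda>i. coeff f i * noise_coeff i \<omega>)" for f \<omega>
    by (auto simp: coeff_def noise_coeff_def)
  then show ?thesis unfolding is_solution_def L2_tendsto_def partial_sum_def by (simp only:)
qed

lemma wavelet_cnj_test: "(I, j) \<in> wavelet_index \<Longrightarrow> (\<lambda>x. cnj (\<Psi> I j x)) \<in> test_functions"
  by (rule test_cnj[OF wavelet_test]) (auto simp: wavelet_index_def)

lemma noise_coeff_square_integrable: "i \<in> wavelet_index \<Longrightarrow> square_integrable P (noise_coeff i)"
  using gaussian_field_square_integrable[OF noise_gaussian wavelet_cnj_test]
  by (cases i) (simp add: noise_coeff_def)

lemma noise_coeff_orthonormal:
  assumes i: "i \<in> wavelet_index" and k: "k \<in> wavelet_index"
  shows "(\<integral>\<omega>. cnj (noise_coeff i \<omega>) * noise_coeff k \<omega> \<partial>P) = (if i = k then 1 else 0)"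
proof -
  obtain I j K l where eq: "i = (I, j)" "k = (K, l)" by fastforce
  have "(\<integral>\<omega>. cnj (noise_coeff i \<omega>) * noise_coeff k \<omega> \<partial>P) = (\<integral>x. cnj (cnj (\<Psi> I j x)) * cnj (\<Psi> K l x) \<partial>\<nu>)"
    using white_noise_covariance[OF noise wavelet_cnj_test wavelet_cnj_test, of I j K l] i k
    by (simp add: eq noise_coeff_def)
  also have "\<dots> = cnj (\<integral>x. cnj (\<Psi> I j x) * \<Psi> K l x \<partial>\<nu>)"
    by (simp flip: Bochner_Integration.integral_cnj)
  also have "\<dots> = (if i = k then 1 else 0)"
    using wavelet_orthonormal[of I j K l] i k by (simp add: eq)
  finally show ?thesis .
qed

lemma partial_sum_square_integrable: "F \<subseteq> wavelet_index \<Longrightarrow> square_integrable P (partial_sum f F)"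
  unfolding partial_sum_def
  by (intro square_integrable_sum square_integrable_scale noise_coeff_square_integrable) auto

lemma eventually_partial_sum_square_integrable:
  "\<forall>\<^sub>F F in finite_subsets_at_top wavelet_index. square_integrable P (partial_sum f F)"
  by (rule eventually_finite_subsets_at_top_weakI) (rule partial_sum_square_integrable)

lemma eventually_partial_sum_measurable:
  "\<forall>\<^sub>F F in finite_subsets_at_top wavelet_index. partial_sum f F \<in> borel_measurable P"
  using eventually_partial_sum_square_integrable by eventually_elim (rule square_integrable_measurable)

text \<open>A limit is chosen separately for each test function, so linearity can be expected only
  almost surely; it is established afterwards for every solution.\<close>

lemma solution_exists: "\<exists>\<psi>. is_solution \<nu> T \<Psi> P \<phi> \<psi>"
proof -
  have "\<exists>Y\<in>borel_measurable P. L2_tendsto P (partial_sum f) Y (finite_subsets_at_top wavelet_index)"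
    if "f \<in> test_functions" for f
    using L2_orthonormal_series[OF noise_coeff_square_integrable noise_coeff_orthonormal coeff_summable[OF that]]
    unfolding partial_sum_def by blast
  then show ?thesis unfolding is_solution_iff by metis
qed

text \<open>A partial sum is almost surely the noise at one test function, from which it inherits
  its normal law.\<close>

lemma noise_coeff_sum:
  assumes F: "finite F" "F \<subseteq> wavelet_index"
  shows "AE \<omega> in P. \<phi> (\<lambda>x. \<Sum>i\<in>F. coeff f i * cnj (case_prod \<Psi> i x)) \<omega> = partial_sum f F \<omega>"
proof -
  have "AE \<omega> in P. \<phi> (\<lambda>x. \<Sum>i\<in>F. coeff f i * cnj (case_prod \<Psi> i x)) \<omega> =
     (\<Sum>i\<in>F. coeff f i * \<phi> (\<lambda>x. cnj (case_prod \<Psi> i x)) \<omega>)"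
    using F wavelet_cnj_test by (intro gaussian_field_sum noise_gaussian) auto
  moreover have "\<phi> (\<lambda>x. cnj (case_prod \<Psi> i x)) = noise_coeff i" for i
    by (cases i) (simp add: noise_coeff_def)
  ultimately show ?thesis by (simp add: partial_sum_def)
qed

text \<open>Summation over all wavelets of a vertex replaces the complex wavelets by the real
  kernel, which makes the partial sums for real \<open>f\<close> real.\<close>

lemma fibre_sum_kernel:
  assumes I: "I \<in> nonminimal" and f: "f \<in> test_functions"
  shows "(\<Sum>j\<in>wavelet_numbers I. coeff f (I, j) * cnj (\<Psi> I j y)) =
    complex_of_real (inverse (lam I)) * (\<integral>x. complex_of_real (wavelet_kernel \<nu> I x y) * f x \<partial>\<nu>)"
proof -
  have int: "integrable \<nu> (\<lambda>x. \<Psi> I j x * f x)" if "j \<in> wavelet_numbers I" for j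
    using that I by (intro wavelet_times_test[OF _ f]) (simp add: wavelet_index_def)
  have "(\<integral>x. complex_of_real (wavelet_kernel \<nu> I x y) * f x \<partial>\<nu>) =
    (\<integral>x. (\<Sum>j\<in>wavelet_numbers I. cnj (\<Psi> I j y) * (\<Psi> I j x * f x)) \<partial>\<nu>)"
    unfolding wavelet_sum_eq_kernel[OF basis I, symmetric] by (simp add: sum_distrib_left mult_ac)
  also have "\<dots> = (\<Sum>j\<in>wavelet_numbers I. cnj (\<Psi> I j y) * (\<integral>x. \<Psi> I j x * f x \<partial>\<nu>))"
    using int by (subst Bochner_Integration.integral_sum) auto
  finally show ?thesis by (simp add: coeff_def sum_distrib_left mult_ac)
qed

context
  fixes \<psi> assumes sol: "is_solution \<nu> T \<Psi> P \<phi> \<psi>"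
begin

lemma solution_measurable: "f \<in> test_functions \<Longrightarrow> \<psi> f \<in> borel_measurable P"
  using sol by (simp add: is_solution_iff)

lemma solution_L2: "f \<in> test_functions \<Longrightarrow> L2_tendsto P (partial_sum f) (\<psi> f) (finite_subsets_at_top wavelet_index)"
  using sol by (simp add: is_solution_iff)

lemma solution_lincomb:
  assumes f: "f \<in> test_functions" and g: "g \<in> test_functions"
  shows "AE \<omega> in P. \<psi> (\<lambda>x. a * f x + b * g x) \<omega> = a * \<psi> f \<omega> + b * \<psi> g \<omega>"
proof -
  note h = test_lincomb[OF f g, of a b]
  let ?F = "finite_subsets_at_top (wavelet_index :: ('a set \<times> nat) set)"
  have "L2_tendsto P (\<lambda>F \<omega>. a * partial_sum f F \<omega> + b * partial_sum g F \<omega>) (\<lambda>\<omega>. a * \<psi> f \<omega> + b * \<psi> g \<omega>) ?F"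
    by (intro L2_tendsto_lincomb solution_L2 solution_measurable f g eventually_partial_sum_measurable)
  moreover have "\<forall>\<^sub>F F in ?F. (\<lambda>\<omega>. a * partial_sum f F \<omega> + b * partial_sum g F \<omega>) = partial_sum (\<lambda>x. a * f x + b * g x) F"
  proof (rule eventually_finite_subsets_at_top_weakI)
    fix F :: "('a set \<times> nat) set" assume "F \<subseteq> wavelet_index"
    then have "coeff (\<lambda>x. a * f x + b * g x) i = a * coeff f i + b * coeff g i" if "i \<in> F" for i
      using coeff_lincomb[OF _ f g] that by blast
    then show "(\<lambda>\<omega>. a * partial_sum f F \<omega> + b * partial_sum g F \<omega>) = partial_sum (\<lambda>x. a * f x + b * g x) F"
      unfolding partial_sum_def
      by (intro ext) (simp add: sum_distrib_left sum.distrib distrib_right mult.assoc cong: sum.cong)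
  qed
  then have "\<forall>\<^sub>F F in ?F. (\<integral>\<^sup>+\<omega>. ennreal ((cmod (a * \<psi> f \<omega> + b * \<psi> g \<omega> - (a * partial_sum f F \<omega> + b * partial_sum g F \<omega>)))\<^sup>2) \<partial>P) =
     (\<integral>\<^sup>+\<omega>. ennreal ((cmod (a * \<psi> f \<omega> + b * \<psi> g \<omega> - partial_sum (\<lambda>x. a * f x + b * g x) F \<omega>))\<^sup>2) \<partial>P)"
    by eventually_elim (simp add: fun_eq_iff)
  ultimately have "L2_tendsto P (partial_sum (\<lambda>x. a * f x + b * g x)) (\<lambda>\<omega>. a * \<psi> f \<omega> + b * \<psi> g \<omega>) ?F"
    unfolding L2_tendsto_def by (rule Lim_transform_eventually)
  moreover have "(\<lambda>\<omega>. a * \<psi> f \<omega> + b * \<psi> g \<omega>) \<in> borel_measurable P"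
    using solution_measurable[OF f] solution_measurable[OF g] by measurable
  ultimately show ?thesis
    using L2_tendsto_unique[OF _ solution_L2[OF h] _ solution_measurable[OF h] _ eventually_partial_sum_measurable]
    by simp
qed

text \<open>By orthogonality only the wavelets of \<open>I\<close> have nonzero coefficients, so the
  partial sums are eventually constant and the limit is a finite sum, which the reproducing property
  identifies.\<close>

lemma solution_wavelet:
  assumes I: "I \<in> nonminimal" and g: "g \<in> wavelet_space \<nu> I"
  shows "AE \<omega> in P. \<psi> g \<omega> = complex_of_real (inverse (lam I)) * \<phi> g \<omega>"
proof -
  let ?F = "finite_subsets_at_top (wavelet_index :: ('a set \<times> nat) set)"
  let ?N = "Pair I ` wavelet_numbers I"
  have gt: "g \<in> test_functions" by (rule wavelet_space_test[OF I g])
  have N: "finite ?N" "?N \<subseteq> wavelet_index" using I by (auto simp: wavelet_index_def)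
  have other: "coeff g i = 0" if "i \<in> wavelet_index - ?N" for i
  proof -
    obtain J j where i: "i = (J, j)" by fastforce
    then have "J \<in> nonminimal" "j \<in> wavelet_numbers J" "J \<noteq> I" using that by (auto simp: wavelet_index_def)
    then show ?thesis
      using wavelet_space_orthogonal[OF _ wavelet_in_space I g, of J j] by (simp add: coeff_def i)
  qed
  have "partial_sum g F = partial_sum g ?N" if "finite F" "?N \<subseteq> F" "F \<subseteq> wavelet_index" for F
    unfolding partial_sum_def using that other by (intro ext sum.mono_neutral_right) auto
  then have "\<forall>\<^sub>F F in ?F. partial_sum g F = partial_sum g ?N"
    unfolding eventually_finite_subsets_at_top using N by blast
  then have "\<forall>\<^sub>F F in ?F. 0 = (\<integral>\<^sup>+\<omega>. ennreal ((cmod (partial_sum g ?N \<omega> - partial_sum g F \<omega>))\<^sup>2) \<partial>P)"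
    by eventually_elim simp
  then have "L2_tendsto P (partial_sum g) (partial_sum g ?N) ?F"
    unfolding L2_tendsto_def by (rule Lim_transform_eventually[OF tendsto_const])
  then have "AE \<omega> in P. \<psi> g \<omega> = partial_sum g ?N \<omega>"
    using square_integrable_measurable[OF partial_sum_square_integrable[OF N(2)]]
    by (intro L2_tendsto_unique[OF _ solution_L2[OF gt] _ solution_measurable[OF gt] _ eventually_partial_sum_measurable]) auto
  moreover have "AE \<omega> in P. \<phi> (\<lambda>x. \<Sum>i\<in>?N. coeff g i * cnj (case_prod \<Psi> i x)) \<omega> = partial_sum g ?N \<omega>"
    by (rule noise_coeff_sum[OF N])
  \<comment> \<open>The summand with coefficient 0 gives the scalar multiple the shape of a linear
    combination of two test functions.\<close>
  moreover have "(\<lambda>x. \<Sum>i\<in>?N. coeff g i * cnj (case_prod \<Psi> i x)) = (\<lambda>x. complex_of_real (inverse (lam I)) * g x + 0 * g x)"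
  proof
    fix x
    have "(\<Sum>i\<in>?N. coeff g i * cnj (case_prod \<Psi> i x)) = (\<Sum>j\<in>wavelet_numbers I. coeff g (I, j) * cnj (\<Psi> I j x))"
      by (subst sum.reindex) (auto simp: inj_on_def)
    then show "(\<Sum>i\<in>?N. coeff g i * cnj (case_prod \<Psi> i x)) = complex_of_real (inverse (lam I)) * g x + 0 * g x"
      unfolding fibre_sum_kernel[OF I gt] wavelet_kernel_reproducing[OF I g] by simp
  qed
  moreover have "AE \<omega> in P. \<phi> (\<lambda>x. complex_of_real (inverse (lam I)) * g x + 0 * g x) \<omega> = complex_of_real (inverse (lam I)) * \<phi> g \<omega> + 0 * \<phi> g \<omega>"
    by (rule gaussian_field_lincomb[OF noise_gaussian gt gt])
  ultimately show ?thesis by auto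
qed

text \<open>On the wavelet space of \<open>I\<close> the operator multiplies by \<open>lam I\<close>
  and the solution divides by it; positivity of the eigenvalue lets them cancel. Induction over sums
  of wavelets does the rest and also shows that the operator does not leave the space of test
  functions.\<close>

lemma solution_equation:
  assumes "f \<in> test_functions" "(\<integral>x. f x \<partial>\<nu>) = 0"
  shows "psd_op \<nu> T f \<in> test_functions" "AE \<omega> in P. \<psi> (psd_op \<nu> T f) \<omega> = \<phi> f \<omega>"
proof -
  have "f \<in> wavelet_span" using assms by (rule mean_zero_wavelet_span)
  then have "psd_op \<nu> T f \<in> test_functions \<and> (AE \<omega> in P. \<psi> (psd_op \<nu> T f) \<omega> = \<phi> f \<omega>)"
  proof (induction rule: wavelet_span.induct)
    case zero
    have "psd_op \<nu> T (\<lambda>x. 0) = (\<lambda>x. 0)" by (simp add: psd_op_def fun_eq_iff)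
    moreover have "AE \<omega> in P. \<psi> (\<lambda>x. 0) \<omega> = 0" "AE \<omega> in P. \<phi> (\<lambda>x. 0) \<omega> = 0"
      using solution_lincomb[OF test_zero test_zero, of 0 0]
        gaussian_field_lincomb[OF noise_gaussian test_zero test_zero, of 0 0] by simp_all
    ultimately show ?case using test_zero by auto
  next
    case (step I g f a)
    have gt: "g \<in> test_functions" and ft: "f \<in> test_functions"
      using wavelet_space_test step wavelet_span_test by blast+
    have op: "psd_op \<nu> T (\<lambda>x. a * g x + f x) = (\<lambda>x. (a * complex_of_real (lam I)) * g x + 1 * psd_op \<nu> T f x)"
      using psd_op_lincomb[OF gt ft, of a 1] psd_op_wavelet[OF step(1,2)] by (simp add: mult_ac)
    have "AE \<omega> in P. \<psi> (\<lambda>x. (a * complex_of_real (lam I)) * g x + 1 * psd_op \<nu> T f x) \<omega> =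
       (a * complex_of_real (lam I)) * \<psi> g \<omega> + 1 * \<psi> (psd_op \<nu> T f) \<omega>"
      using step by (intro solution_lincomb gt) auto
    moreover have "AE \<omega> in P. \<phi> (\<lambda>x. a * g x + 1 * f x) \<omega> = a * \<phi> g \<omega> + 1 * \<phi> f \<omega>"
      by (rule gaussian_field_lincomb[OF noise_gaussian gt ft])
    moreover have "AE \<omega> in P. \<psi> (psd_op \<nu> T f) \<omega> = \<phi> f \<omega>" using step by blast
    ultimately have "AE \<omega> in P. \<psi> (psd_op \<nu> T (\<lambda>x. a * g x + f x)) \<omega> = \<phi> (\<lambda>x. a * g x + f x) \<omega>"
      unfolding op using solution_wavelet[OF step(1,2)]
      by eventually_elim (use T_positive[OF step(1)] in simp)
    moreover have "psd_op \<nu> T (\<lambda>x. a * g x + f x) \<in> test_functions"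
      unfolding op using step by (intro test_lincomb gt) auto
    ultimately show ?case by blast
  qed
  then show "psd_op \<nu> T f \<in> test_functions" "AE \<omega> in P. \<psi> (psd_op \<nu> T f) \<omega> = \<phi> f \<omega>" by blast+
qed

text \<open>Index sets made of complete fibres are cofinal, so convergence along all finite index
  sets implies convergence along these, where the partial sums are real.\<close>

lemma filterlim_fibres:
  "filterlim (\<lambda>G. Sigma G wavelet_numbers) (finite_subsets_at_top wavelet_index) (finite_subsets_at_top (nonminimal :: 'a set set))"
  unfolding filterlim_iff
proof (intro allI impI)
  fix Q assume "\<forall>\<^sub>F F in finite_subsets_at_top (wavelet_index :: ('a set \<times> nat) set). Q F"
  then obtain X where X': "finite X \<and> X \<subseteq> wavelet_index \<and> (\<forall>Y. finite Y \<and> X \<subseteq> Y \<and> Y \<subseteq> wavelet_index \<longrightarrow> Q Y)"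
    unfolding eventually_finite_subsets_at_top by (rule exE)
  then have X: "finite X" "X \<subseteq> wavelet_index"
    "\<And>Y. finite Y \<Longrightarrow> X \<subseteq> Y \<Longrightarrow> Y \<subseteq> wavelet_index \<Longrightarrow> Q Y" by simp_all
  show "\<forall>\<^sub>F G in finite_subsets_at_top nonminimal. Q (Sigma G wavelet_numbers)"
    unfolding eventually_finite_subsets_at_top
  proof (intro exI[of _ "fst ` X"] conjI allI impI)
    show "finite (fst ` X)" using X by simp
    show "fst ` X \<subseteq> nonminimal" using X(2) by (auto simp: wavelet_index_def)
    fix G :: "'a set set" assume G: "finite G \<and> fst ` X \<subseteq> G \<and> G \<subseteq> nonminimal"
    show "Q (Sigma G wavelet_numbers)"
    proof (rule X(3))
      show "finite (Sigma G wavelet_numbers)" using G by auto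
      show "X \<subseteq> Sigma G wavelet_numbers" using G X(2) by (force simp: wavelet_index_def)
      show "Sigma G wavelet_numbers \<subseteq> wavelet_index" using G by (auto simp: wavelet_index_def)
    qed
  qed
qed

lemma solution_real_normal:
  assumes f: "f \<in> test_functions" and real: "range f \<subseteq> \<real>"
  shows "AE \<omega> in P. \<psi> f \<omega> \<in> \<real>" "\<exists>s\<ge>0. distr P borel (\<lambda>\<omega>. Re (\<psi> f \<omega>)) = centered_normal s"
proof -
  let ?S = "\<lambda>G. partial_sum f (Sigma G wavelet_numbers)"
  have lim: "L2_tendsto P ?S (\<psi> f) (finite_subsets_at_top nonminimal)"
    using filterlim_compose[OF solution_L2[OF f, unfolded L2_tendsto_def] filterlim_fibres]
    unfolding L2_tendsto_def by simp
  have ev: "\<forall>\<^sub>F G in finite_subsets_at_top (nonminimal :: 'a set set).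
     ?S G \<in> borel_measurable P \<and> (AE \<omega> in P. ?S G \<omega> \<in> \<real>) \<and>
     (\<exists>s\<ge>0. distr P borel (\<lambda>\<omega>. Re (?S G \<omega>)) = centered_normal s)"
  proof (rule eventually_finite_subsets_at_top_weakI)
    fix G :: "'a set set" assume G: "finite G" "G \<subseteq> nonminimal"
    let ?N = "Sigma G wavelet_numbers"
    let ?h = "\<lambda>x. \<Sum>i\<in>?N. coeff f i * cnj (case_prod \<Psi> i x)"
    have N: "finite ?N" "?N \<subseteq> wavelet_index" using G by (auto simp: wavelet_index_def)
    have h: "?h \<in> test_functions" using N wavelet_cnj_test by (intro test_sum test_scale) auto
    \<comment> \<open>Grouped by vertices, the test function behind the partial sum involves only
      real kernels and the real function \<open>f\<close>.\<close>
    have hx: "?h x = complex_of_real (\<Sum>I\<in>G. inverse (lam I) * (\<integral>y. wavelet_kernel \<nu> I y x * Re (f y) \<partial>\<nu>))" for x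
    proof -
      have "?h x = (\<Sum>I\<in>G. \<Sum>j\<in>wavelet_numbers I. coeff f (I, j) * cnj (\<Psi> I j x))"
        using G by (subst sum.Sigma) (auto intro!: sum.cong)
      also have "\<dots> = (\<Sum>I\<in>G. complex_of_real (inverse (lam I)) * (\<integral>y. complex_of_real (wavelet_kernel \<nu> I y x) * f y \<partial>\<nu>))"
        using G by (intro sum.cong refl fibre_sum_kernel f) auto
      finally have eq: "?h x = (\<Sum>I\<in>G. complex_of_real (inverse (lam I)) * (\<integral>y. complex_of_real (wavelet_kernel \<nu> I y x) * f y \<partial>\<nu>))" .
      have "(\<integral>y. complex_of_real (wavelet_kernel \<nu> I y x) * f y \<partial>\<nu>) =
          complex_of_real (\<integral>y. wavelet_kernel \<nu> I y x * Re (f y) \<partial>\<nu>)" for I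
      proof -
        have "f y \<in> \<real>" for y using real by blast
        then show ?thesis
          unfolding integral_complex_of_real[symmetric] by (intro Bochner_Integration.integral_cong) auto
      qed
      then show ?thesis unfolding eq by (simp only: of_real_mult of_real_sum)
    qed
    have hr: "range ?h \<subseteq> \<real>" unfolding hx by auto
    have eq: "AE \<omega> in P. \<phi> ?h \<omega> = ?S G \<omega>" by (rule noise_coeff_sum[OF N])
    have Sm[measurable]: "?S G \<in> borel_measurable P"
      using partial_sum_square_integrable[OF N(2)] by (rule square_integrable_measurable)
    have hm[measurable]: "\<phi> ?h \<in> borel_measurable P" by (rule gaussian_field_measurable[OF noise_gaussian h])
    have "AE \<omega> in P. ?S G \<omega> \<in> \<real>"
      using gaussian_field_real(1)[OF noise_gaussian h hr] eq by eventually_elim simp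
    moreover have "distr P borel (\<lambda>\<omega>. Re (\<phi> ?h \<omega>)) = distr P borel (\<lambda>\<omega>. Re (?S G \<omega>))"
    proof (rule distr_cong_AE)
      show "AE \<omega> in P. Re (\<phi> ?h \<omega>) = Re (?S G \<omega>)" using eq by eventually_elim simp
      show "(\<lambda>\<omega>. Re (\<phi> ?h \<omega>)) \<in> borel_measurable P" "(\<lambda>\<omega>. Re (?S G \<omega>)) \<in> borel_measurable P"
        by measurable
    qed simp_all
    ultimately show "?S G \<in> borel_measurable P \<and> (AE \<omega> in P. ?S G \<omega> \<in> \<real>) \<and>
       (\<exists>s\<ge>0. distr P borel (\<lambda>\<omega>. Re (?S G \<omega>)) = centered_normal s)"
      using Sm gaussian_field_real(2)[OF noise_gaussian h hr] by simp
  qed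
  show "AE \<omega> in P. \<psi> f \<omega> \<in> \<real>" "\<exists>s\<ge>0. distr P borel (\<lambda>\<omega>. Re (\<psi> f \<omega>)) = centered_normal s"
    by (rule gaussian_L2_limit[OF _ lim solution_measurable[OF f] ev]; simp)+
qed

lemma solution_gaussian: "gaussian_field P \<psi>"
  unfolding gaussian_field_def using solution_measurable solution_lincomb solution_real_normal by blast

text \<open>Orthonormality makes the covariance of two partial sums a finite sum over the index set,
  so the limit of covariances along finite sets is literally a \<open>has_sum\<close>. Unconditional
  convergence permits grouping by vertices, where \<open>wavelet_parseval\<close> applies.\<close>

lemma solution_covariance:
  assumes f: "f \<in> test_functions" and g: "g \<in> test_functions"
  shows "((\<lambda>I. \<integral>x. (\<integral>x'. complex_of_real (covariation_term \<nu> T I x x') * cnj (f x) * g x' \<partial>\<nu>) \<partial>\<nu>)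
      has_sum (\<integral>\<omega>. cnj (\<psi> f \<omega>) * \<psi> g \<omega> \<partial>P)) nonminimal"
proof -
  let ?F = "finite_subsets_at_top (wavelet_index :: ('a set \<times> nat) set)"
  have "((\<lambda>F. \<integral>\<omega>. cnj (partial_sum f F \<omega>) * partial_sum g F \<omega> \<partial>P) \<longlongrightarrow> (\<integral>\<omega>. cnj (\<psi> f \<omega>) * \<psi> g \<omega> \<partial>P)) ?F"
  proof (rule L2_tendsto_integral_mult)
    show "L2_tendsto P (\<lambda>F \<omega>. cnj (partial_sum f F \<omega>)) (\<lambda>\<omega>. cnj (\<psi> f \<omega>)) ?F"
      by (rule L2_tendsto_cnj[OF solution_L2[OF f]])
    show "L2_tendsto P (partial_sum g) (\<psi> g) ?F" by (rule solution_L2[OF g])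
    show "(\<lambda>\<omega>. cnj (\<psi> f \<omega>)) \<in> borel_measurable P" "\<psi> g \<in> borel_measurable P"
      using solution_measurable[OF f] solution_measurable[OF g] by measurable
    show "\<forall>\<^sub>F F in ?F. square_integrable P (\<lambda>\<omega>. cnj (partial_sum f F \<omega>))"
      using eventually_partial_sum_square_integrable by eventually_elim (rule square_integrable_cnj)
    show "\<forall>\<^sub>F F in ?F. square_integrable P (partial_sum g F)" by (rule eventually_partial_sum_square_integrable)
  qed simp
  moreover have "\<forall>\<^sub>F F in ?F. (\<integral>\<omega>. cnj (partial_sum f F \<omega>) * partial_sum g F \<omega> \<partial>P) = (\<Sum>i\<in>F. cnj (coeff f i) * coeff g i)"
    unfolding partial_sum_def
    by (rule eventually_finite_subsets_at_top_weakI)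
      (rule integral_orthonormal_sums[OF noise_coeff_square_integrable noise_coeff_orthonormal])
  ultimately have "((\<lambda>i. cnj (coeff f i) * coeff g i) has_sum (\<integral>\<omega>. cnj (\<psi> f \<omega>) * \<psi> g \<omega> \<partial>P)) wavelet_index"
    unfolding has_sum_def by (rule Lim_transform_eventually)
  then show ?thesis unfolding wavelet_index_def
  proof (rule has_sum_SigmaD)
    fix I :: "'a set" assume I: "I \<in> nonminimal"
    show "((\<lambda>j. cnj (coeff f (I, j)) * coeff g (I, j)) has_sum
       (\<integral>x. (\<integral>x'. complex_of_real (covariation_term \<nu> T I x x') * cnj (f x) * g x' \<partial>\<nu>) \<partial>\<nu>)) (wavelet_numbers I)"
      unfolding wavelet_parseval[OF I f g] by (rule has_sum_finite) simp
  qed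
qed

end

end

section \<open>The covariation off the diagonal\<close>

lemma has_sum_finite_sum:
  fixes f :: "'i \<Rightarrow> 'b \<Rightarrow> 'c::topological_comm_monoid_add"
  assumes "\<And>i. i \<in> F \<Longrightarrow> (f i has_sum s i) A"
  shows "((\<lambda>x. \<Sum>i\<in>F. f i x) has_sum (\<Sum>i\<in>F. s i)) A"
  using assms by (induction F rule: infinite_finite_induct) (auto intro: has_sum_add)

context wavelet_system
begin

text \<open>For distinct points \<open>sup_ball x x'\<close> is a vertex. It yields the negative
  term, the vertices above it yield the series, and all others contribute zero.\<close>

lemma covariation_has_sum:
  fixes x x' :: 'a
  assumes ne: "x \<noteq> x'"
  shows "((\<lambda>I. covariation_term \<nu> T I x x') has_sum covariation \<nu> T x x') nonminimal"
proof -
  let ?S = "sup_ball x x'"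
  let ?U = "{I\<in>ball_tree. ?S \<subset> I}"
  let ?g = "\<lambda>I. (inverse (lam I))\<^sup>2 * (inverse (measure \<nu> (pred_vertex I ?S)) - inverse (measure \<nu> I))"
  have S: "is_ball ?S" "?S \<in> nonminimal" using sup_ball_ball[OF ne] sup_ball_nonminimal[OF ne] by auto
  have "?g summable_on ?U"
    by (rule series_transfer[OF R_ball S(1), of "\<lambda>I M. (inverse (lam I))\<^sup>2 * (inverse (measure \<nu> M) - inverse (measure \<nu> I))"])
      (rule series_eigenvalue)
  then have "(?g has_sum infsum ?g ?U) ?U" by (rule has_sum_infsum)
  also have "(?g has_sum infsum ?g ?U) ?U \<longleftrightarrow> ((\<lambda>I. covariation_term \<nu> T I x x') has_sum infsum ?g ?U) ?U"
    by (intro has_sum_cong) (auto simp: covariation_term_def)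
  finally have "((\<lambda>I. covariation_term \<nu> T I x x') has_sum (covariation_term \<nu> T ?S x x' + infsum ?g ?U)) (insert ?S ?U)"
    by (intro has_sum_insert) auto
  also have "covariation_term \<nu> T ?S x x' + infsum ?g ?U = covariation \<nu> T x x'"
    by (simp add: covariation_term_def covariation_def)
  also have "((\<lambda>I. covariation_term \<nu> T I x x') has_sum covariation \<nu> T x x') (insert ?S ?U) \<longleftrightarrow>
     ((\<lambda>I. covariation_term \<nu> T I x x') has_sum covariation \<nu> T x x') nonminimal"
  proof (rule has_sum_cong_neutral)
    show "covariation_term \<nu> T I x x' = 0" if "I \<in> nonminimal - insert ?S ?U" for I
      using that nonminimal_ball by (auto simp: covariation_term_def ball_in_ball_tree)
    show "covariation_term \<nu> T I x x' = 0" if "I \<in> insert ?S ?U - nonminimal" for I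
      using that S nonminimalI[OF S(1)] by (auto simp: ball_in_ball_tree)
  qed simp
  finally show ?thesis .
qed

text \<open>A kernel depending only on \<open>sup_ball\<close> is constant on the product of two
  different balls of the partition, and \<open>cd\<close> removes the diagonal blocks. The kernel is
  arbitrary because the formula is used both for the covariation and for its single terms.\<close>

lemma disjoint_kernel_integral:
  fixes h :: "'a \<Rightarrow> 'a \<Rightarrow> real" and f g :: "'a \<Rightarrow> complex"
  assumes L: "finite L" "\<forall>A\<in>L. is_ball A" "\<forall>A\<in>L. \<forall>A'\<in>L. A \<noteq> A' \<longrightarrow> A \<inter> A' = {}"
    and f: "f = (\<lambda>x. \<Sum>A\<in>L. c A * indicator A x)" and g: "g = (\<lambda>x. \<Sum>A\<in>L. d A * indicator A x)"
    and cd: "\<And>A. A \<in> L \<Longrightarrow> c A = 0 \<or> d A = 0"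
    and h: "\<And>x x' y y'. sup_ball x x' = sup_ball y y' \<Longrightarrow> h x x' = h y y'"
    and p: "\<And>A. A \<in> L \<Longrightarrow> p A \<in> A"
  shows "(\<integral>x. (\<integral>x'. complex_of_real (h x x') * cnj (f x) * g x' \<partial>\<nu>) \<partial>\<nu>) =
    (\<Sum>A\<in>L. \<Sum>B\<in>L. complex_of_real (h (p A) (p B)) * (cnj (c A) * d B * complex_of_real (measure \<nu> A * measure \<nu> B)))"
proof -
  let ?H = "\<lambda>A B. complex_of_real (h (p A) (p B)) * (cnj (c A) * d B)"
  have pt: "complex_of_real (h x x') * cnj (f x) * g x' = (\<Sum>B\<in>L. (\<Sum>A\<in>L. ?H A B * indicator A x) * indicator B x')" for x x'
  proof -
    have pair: "complex_of_real (h x x') * (cnj (c A) * indicator A x) * (d B * indicator B x') = ?H A B * indicator A x * indicator B x'"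
      if AB: "A \<in> L" "B \<in> L" for A B
    proof (cases "x \<in> A \<and> x' \<in> B \<and> A \<noteq> B")
      case True
      have disj: "A \<inter> B = {}" using L(3) AB True by blast
      have ball: "is_ball A" "is_ball B" using L(2) AB by auto
      have "x \<notin> B" "p B \<notin> A" using disj True p[OF AB(2)] by auto
      \<comment> \<open>The two points are moved to the representatives one after the other, each
        seen from the other's ball.\<close>
      have "sup_ball x x' = sup_ball x (p B)"
        by (rule sup_ball_outside(1)[OF ball(2) \<open>x \<notin> B\<close>]) (use True p[OF AB(2)] in auto)
      also have "\<dots> = sup_ball (p B) x" by (rule sup_ball_sym)
      also have "\<dots> = sup_ball (p B) (p A)"
        by (rule sup_ball_outside(1)[OF ball(1) \<open>p B \<notin> A\<close>]) (use True p[OF AB(1)] in auto)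
      also have "\<dots> = sup_ball (p A) (p B)" by (rule sup_ball_sym)
      finally have "h x x' = h (p A) (p B)" by (rule h)
      then show ?thesis using True by simp
    next
      case False
      then show ?thesis using cd[OF AB(1)] by (auto simp: indicator_def)
    qed
    have cf: "cnj (f x) = (\<Sum>A\<in>L. cnj (c A) * indicator A x)"
      unfolding f cnj_sum by (intro sum.cong refl) (simp add: indicator_def)
    have "complex_of_real (h x x') * cnj (f x) * g x' =
       (\<Sum>A\<in>L. \<Sum>B\<in>L. complex_of_real (h x x') * (cnj (c A) * indicator A x) * (d B * indicator B x'))"
      unfolding cf unfolding g by (simp only: sum_distrib_left sum_distrib_right) (rule sum.swap)
    also have "\<dots> = (\<Sum>A\<in>L. \<Sum>B\<in>L. ?H A B * indicator A x * indicator B x')"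
      by (intro sum.cong refl pair)
    also have "\<dots> = (\<Sum>B\<in>L. (\<Sum>A\<in>L. ?H A B * indicator A x) * indicator B x')"
      by (subst sum.swap) (simp only: sum_distrib_right)
    finally show ?thesis .
  qed
  have int: "(\<integral>x. (\<Sum>A\<in>L. e A * indicator A x) \<partial>\<nu>) = (\<Sum>A\<in>L. e A * complex_of_real (measure \<nu> A))" for e :: "'a set \<Rightarrow> complex"
    using L(2) integral_indicator_complex by (intro has_bochner_integral_integral_eq has_bochner_integral_sum) blast
  have "(\<integral>x. (\<integral>x'. complex_of_real (h x x') * cnj (f x) * g x' \<partial>\<nu>) \<partial>\<nu>) =
     (\<integral>x. (\<Sum>B\<in>L. (\<Sum>A\<in>L. ?H A B * indicator A x) * complex_of_real (measure \<nu> B)) \<partial>\<nu>)"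
    unfolding pt int ..
  also have "\<dots> = (\<integral>x. (\<Sum>A\<in>L. (\<Sum>B\<in>L. ?H A B * complex_of_real (measure \<nu> B)) * indicator A x) \<partial>\<nu>)"
  proof (intro Bochner_Integration.integral_cong refl)
    fix x
    have "(\<Sum>B\<in>L. (\<Sum>A\<in>L. ?H A B * indicator A x) * complex_of_real (measure \<nu> B)) =
       (\<Sum>B\<in>L. \<Sum>A\<in>L. ?H A B * complex_of_real (measure \<nu> B) * indicator A x)"
      unfolding sum_distrib_right by (intro sum.cong refl) (simp only: mult_ac)
    also have "\<dots> = (\<Sum>A\<in>L. (\<Sum>B\<in>L. ?H A B * complex_of_real (measure \<nu> B)) * indicator A x)"
      by (subst sum.swap) (simp only: sum_distrib_right)
    finally show "(\<Sum>B\<in>L. (\<Sum>A\<in>L. ?H A B * indicator A x) * complex_of_real (measure \<nu> B)) =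
       (\<Sum>A\<in>L. (\<Sum>B\<in>L. ?H A B * complex_of_real (measure \<nu> B)) * indicator A x)" .
  qed
  also have "\<dots> = (\<Sum>A\<in>L. (\<Sum>B\<in>L. ?H A B * complex_of_real (measure \<nu> B)) * complex_of_real (measure \<nu> A))"
    by (rule int)
  also have "\<dots> = (\<Sum>A\<in>L. \<Sum>B\<in>L. complex_of_real (h (p A) (p B)) * (cnj (c A) * d B * complex_of_real (measure \<nu> A * measure \<nu> B)))"
    unfolding sum_distrib_right by (intro sum.cong refl) (simp only: of_real_mult mult_ac)
  finally show ?thesis .
qed

end

text \<open>Both sides become finite combinations of values at pairs of distinct representatives,
  where the terms sum to the covariation. Summation over vertices thus commutes with the integrals,
  and uniqueness of sums gives equality.\<close>

lemma (in wavelet_noise) solution_covariance_disjoint: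
  assumes sol: "is_solution \<nu> T \<Psi> P \<phi> \<psi>" and f: "f \<in> test_functions" and g: "g \<in> test_functions"
    and disj: "\<forall>x. f x = 0 \<or> g x = 0"
  shows "(\<integral>\<omega>. cnj (\<psi> f \<omega>) * \<psi> g \<omega> \<partial>P) =
    (\<integral>x. (\<integral>x'. complex_of_real (covariation \<nu> T x x') * cnj (f x) * g x' \<partial>\<nu>) \<partial>\<nu>)"
proof -
  obtain L c d where L: "finite L" "\<forall>A\<in>L. is_ball A" "\<forall>A\<in>L. \<forall>A'\<in>L. A \<noteq> A' \<longrightarrow> A \<inter> A' = {}"
    and fg: "f = (\<lambda>x::'a. \<Sum>A\<in>L. c A * indicator A x)" "g = (\<lambda>x. \<Sum>A\<in>L. d A * indicator A x)"
    by (rule test_functions_common_partition[OF f g])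
  define p where "p A = (SOME x. x \<in> A)" for A :: "'a set"
  have p: "p A \<in> A" if "A \<in> L" for A
    using L(2) ball_nonempty that unfolding p_def by (simp add: some_in_eq)
  have val: "(\<Sum>B\<in>L. e B * indicator B (p A)) = e A" if A: "A \<in> L" for A and e :: "'a set \<Rightarrow> complex"
  proof -
    have "(\<Sum>B\<in>L. e B * indicator B (p A)) = (\<Sum>B\<in>L. if B = A then e A else 0)"
    proof (rule sum.cong[OF refl])
      fix B assume B: "B \<in> L"
      have "p A \<in> B \<longleftrightarrow> B = A" using L(3) A B p[OF A] by blast
      then show "e B * indicator B (p A) = (if B = A then e A else 0)" by auto
    qed
    then show ?thesis using L(1) A by simp
  qed
  \<comment> \<open>Disjointness of the supports is read off at the representative, where each
    function takes its coefficient as value.\<close>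
  have cd: "c A = 0 \<or> d A = 0" if "A \<in> L" for A
    using disj[rule_format, of "p A"] unfolding fg val[OF that] .
  have cov: "covariation \<nu> T x x' = covariation \<nu> T y y'"
    and covt: "covariation_term \<nu> T I x x' = covariation_term \<nu> T I y y'"
    if "sup_ball x x' = sup_ball y y'" for x x' y y' I
    unfolding covariation_def covariation_term_def that by (rule refl)+
  let ?k = "\<lambda>A B. cnj (c A) * d B * complex_of_real (measure \<nu> A * measure \<nu> B)"
  have "((\<lambda>I. \<Sum>A\<in>L. \<Sum>B\<in>L. complex_of_real (covariation_term \<nu> T I (p A) (p B)) * ?k A B) has_sum
      (\<Sum>A\<in>L. \<Sum>B\<in>L. complex_of_real (covariation \<nu> T (p A) (p B)) * ?k A B)) nonminimal"
  proof (intro has_sum_finite_sum)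
    fix A B assume AB: "A \<in> L" "B \<in> L"
    show "((\<lambda>I. complex_of_real (covariation_term \<nu> T I (p A) (p B)) * ?k A B) has_sum
       complex_of_real (covariation \<nu> T (p A) (p B)) * ?k A B) nonminimal"
    proof (cases "A = B")
      case True
      then have "?k A B = 0" using cd[OF AB(1)] by auto
      then show ?thesis by (simp only: mult_zero_right has_sum_0)
    next
      case False
      then have "A \<inter> B = {}" using L(3) AB by blast
      then have "p A \<noteq> p B" using p[OF AB(1)] p[OF AB(2)] by auto
      then show ?thesis by (intro has_sum_cmult_left has_sum_of_real covariation_has_sum)
    qed
  qed
  also have "(\<Sum>A\<in>L. \<Sum>B\<in>L. complex_of_real (covariation \<nu> T (p A) (p B)) * ?k A B) =
    (\<integral>x. (\<integral>x'. complex_of_real (covariation \<nu> T x x') * cnj (f x) * g x' \<partial>\<nu>) \<partial>\<nu>)"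
    by (rule disjoint_kernel_integral[OF L fg cd cov p, symmetric])
  also have "(\<lambda>I. \<Sum>A\<in>L. \<Sum>B\<in>L. complex_of_real (covariation_term \<nu> T I (p A) (p B)) * ?k A B) =
     (\<lambda>I. \<integral>x. (\<integral>x'. complex_of_real (covariation_term \<nu> T I x x') * cnj (f x) * g x' \<partial>\<nu>) \<partial>\<nu>)"
    by (intro ext disjoint_kernel_integral[OF L fg cd covt p, symmetric])
  finally show ?thesis
    by (rule has_sum_unique[OF solution_covariance[OF sol f g]])
qed

section \<open>The law on the space of distributions\<close>

lemma sum_fun_apply: "(\<Sum>i\<in>A. f i) x = (\<Sum>i\<in>A. f i x)"
  for f :: "'i \<Rightarrow> 'x \<Rightarrow> 'b::comm_monoid_add"
  by (induction A rule: infinite_finite_induct) simp_all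

text \<open>Provides bases and linear extension for complex-valued functions, with pointwise scalar
  multiplication.\<close>

interpretation complex_functions: vector_space "\<lambda>c (f :: 'x \<Rightarrow> complex) x. c * f x"
  by unfold_locales (auto simp: fun_eq_iff algebra_simps)

interpretation complex_functionals:
  vector_space_pair "\<lambda>c (f :: 'x \<Rightarrow> complex) x. c * f x" "(*) :: complex \<Rightarrow> complex \<Rightarrow> complex"
  by unfold_locales (simp_all add: distrib_left distrib_right)

lemma distributions_lincomb:
  "u \<in> distributions \<Longrightarrow> f \<in> test_functions \<Longrightarrow> g \<in> test_functions \<Longrightarrow>
    u (\<lambda>x. a * f x + b * g x) = a * u f + b * u g"
  unfolding distributions_def by blast

lemma topspace_weak_topology: "topspace weak_topology = distributions"
  unfolding weak_topology_def by (auto simp: distributions_def PiE_UNIV_domain PiE_def)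

lemma weak_open_subset: "{U. openin weak_topology U} \<subseteq> Pow distributions"
  using openin_subset[of weak_topology] unfolding topspace_weak_topology by auto

lemma space_weak_borel: "space weak_borel = distributions"
  unfolding weak_borel_def by (rule space_measure_of[OF weak_open_subset])

lemma sets_weak_borel: "sets weak_borel = sigma_sets distributions {U. openin weak_topology U}"
  unfolding weak_borel_def by (rule sets_measure_of[OF weak_open_subset])

lemma evaluation_measurable:
  assumes f: "f \<in> test_functions"
  shows "(\<lambda>u. u f) \<in> borel_measurable weak_borel"
proof (rule borel_measurableI)
  fix S :: "complex set" assume "open S"
  then have "openin weak_topology {u \<in> topspace weak_topology. u f \<in> S}"
    using continuous_map_from_subtopology[OF continuous_map_product_projection[OF f, of "\<lambda>_. euclidean"], of distributions]
    unfolding weak_topology_def by (intro openin_continuous_map_preimage[where Y = euclidean]) auto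
  moreover have "(\<lambda>u. u f) -` S \<inter> space weak_borel = {u \<in> topspace weak_topology. u f \<in> S}"
    unfolding space_weak_borel topspace_weak_topology by auto
  ultimately show "(\<lambda>u. u f) -` S \<inter> space weak_borel \<in> sets weak_borel"
    unfolding sets_weak_borel by auto
qed

context regular_ultrametric
begin

lemma distributions_sum:
  fixes u :: "('a \<Rightarrow> complex) \<Rightarrow> complex"
  assumes u: "u \<in> distributions" and "finite F" "\<And>i. i \<in> F \<Longrightarrow> f i \<in> test_functions"
  shows "u (\<lambda>x. \<Sum>i\<in>F. a i * f i x) = (\<Sum>i\<in>F. a i * u (f i))"
  using assms(2,3)
proof (induction F rule: finite_induct)
  case empty
  then show ?case using distributions_lincomb[OF u test_zero test_zero, of 0 0] by simp
next
  case (insert i F)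
  have "(\<lambda>x. \<Sum>i\<in>F. a i * f i x) \<in> test_functions"
    using insert test_sum[of F "\<lambda>i x. a i * f i x"] by (auto intro: test_scale)
  then have "u (\<lambda>x. a i * f i x + 1 * (\<Sum>i\<in>F. a i * f i x)) = a i * u (f i) + 1 * u (\<lambda>x. \<Sum>i\<in>F. a i * f i x)"
    using insert by (intro distributions_lincomb[OF u]) auto
  then show ?case using insert by simp
qed

text \<open>Regularity counts only balls of nonzero diameter. A ball of diameter zero is one of the
  finitely many maximal subballs of a non-minimal vertex, so these are countably many too.\<close>

lemma countable_balls: "countable {B :: 'a set. is_ball B}"
proof -
  have "{B :: 'a set. is_ball B} \<subseteq> {D. is_ball D \<and> diameter D \<noteq> 0} \<union> (\<Union>I\<in>nonminimal. max_subballs I)"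
  proof
    fix B :: "'a set" assume "B \<in> {B. is_ball B}"
    then have B: "is_ball B" "B \<in> ball_tree" by (auto simp: ball_in_ball_tree)
    show "B \<in> {D. is_ball D \<and> diameter D \<noteq> 0} \<union> (\<Union>I\<in>nonminimal. max_subballs I)"
    proof (cases "diameter B = 0")
      case True
      then obtain I where I: "is_ball I" "B \<in> max_subballs I" using B(2) unfolding ball_tree_def by auto
      then have "I \<in> nonminimal" using nonminimalI[OF B(1) I(1)] max_subball by blast
      then show ?thesis using I by blast
    qed (use B in auto)
  qed
  moreover have "countable {D :: 'a set. is_ball D \<and> diameter D \<noteq> 0}"
    using reg by (simp add: regular_balls_def)
  moreover have "countable (\<Union>I\<in>(nonminimal :: 'a set set). max_subballs I)"
    by (rule countable_UN[OF countable_nonminimal countable_finite[OF finite_max_subballs]])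
  ultimately show ?thesis by (rule countable_subset[OF _ countable_Un])
qed

text \<open>
  Indicators of balls are linearly dependent (that of \<open>I\<close> is the sum of those of its maximal subballs),
  so only the values on a basis chosen among them can be prescribed.
\<close>

lemma test_functions_basis:
  obtains B :: "('a \<Rightarrow> complex) set" where "countable B" "B \<subseteq> test_functions" "\<And>b. b \<in> B \<Longrightarrow> range b \<subseteq> \<real>"
    "\<And>f. f \<in> test_functions \<Longrightarrow> \<exists>t r. finite t \<and> t \<subseteq> B \<and> f = (\<lambda>x. \<Sum>b\<in>t. r b * b x)"
    "\<And>m. \<exists>u\<in>distributions. \<forall>b\<in>B. u b = m b"
proof -
  let ?V = "indicator ` {B :: 'a set. is_ball B} :: ('a \<Rightarrow> complex) set"
  obtain B where B: "B \<subseteq> ?V" "complex_functions.independent B" "?V \<subseteq> complex_functions.span B"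
    by (rule complex_functions.maximal_independent_subset)
  show thesis
  proof (rule that[of B])
    show "countable B" using countable_subset[OF B(1)] countable_balls by blast
    show "B \<subseteq> test_functions" using B(1) test_indicator' by blast
    show "range b \<subseteq> \<real>" if "b \<in> B" for b
    proof -
      obtain D where "b = indicator D" using B(1) \<open>b \<in> B\<close> by blast
      then show ?thesis by (auto simp: indicator_def)
    qed
    show "\<exists>t r. finite t \<and> t \<subseteq> B \<and> f = (\<lambda>x. \<Sum>b\<in>t. r b * b x)" if f: "f \<in> test_functions" for f
    proof -
      obtain F c where F: "finite F" "\<forall>B\<in>F. is_ball B" "f = (\<lambda>x::'a. \<Sum>B\<in>F. c B * indicator B x)"
        using f by (rule test_functionsE)
      have "(\<Sum>D\<in>F. (\<lambda>x. c D * indicator D x)) \<in> complex_functions.span B"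
        using F(2) B(3) by (intro complex_functions.span_sum complex_functions.span_scale) auto
      moreover have "(\<Sum>D\<in>F. (\<lambda>x. c D * indicator D x)) = f"
        unfolding F(3) by (intro ext sum_fun_apply)
      ultimately have "f \<in> complex_functions.span B" by simp
      then obtain t r where t: "finite t" "t \<subseteq> B" "f = (\<Sum>b\<in>t. (\<lambda>x. r b * b x))"
        unfolding complex_functions.span_explicit by auto
      have "f = (\<lambda>x. \<Sum>b\<in>t. r b * b x)" unfolding t(3) by (intro ext sum_fun_apply)
      then show ?thesis using t by blast
    qed
    \<comment> \<open>Independence allows a linear extension to all functions; restricting it
      afterwards to test functions makes it extensional, as distributions have to be.\<close>
    show "\<exists>u\<in>distributions. \<forall>b\<in>B. u b = m b" for m :: "('a \<Rightarrow> complex) \<Rightarrow> complex"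
    proof -
      obtain l where l: "Vector_Spaces.linear (\<lambda>c (f :: 'a \<Rightarrow> complex) x. c * f x) (*) l" "\<forall>b\<in>B. l b = m b"
        using complex_functionals.linear_independent_extend[OF B(2)] by blast
      interpret l: Vector_Spaces.linear "\<lambda>c (f :: 'a \<Rightarrow> complex) x. c * f x" "(*)" l by (rule l(1))
      have lin: "l (\<lambda>x. a * f x + b * g x) = a * l f + b * l g" for a b f g
      proof -
        have "(\<lambda>x. a * f x + b * g x) = (\<lambda>x. a * f x) + (\<lambda>x. b * g x)" by (simp add: fun_eq_iff)
        then show ?thesis by (simp only: l.add l.scale)
      qed
      have "restrict l test_functions \<in> distributions"
        unfolding distributions_def using lin test_lincomb by auto
      moreover have "restrict l test_functions b = m b" if "b \<in> B" for b
        using l(2) that B(1) test_indicator' by auto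
      ultimately show ?thesis by blast
    qed
  qed
qed

text \<open>The weak topology is induced from a product with one coordinate for each test function,
  so open sets are not obviously countable unions of basic ones. Linearity removes the difficulty:
  every value is a finite combination of values on \<open>B\<close>, so countably many cylinders
  over finite subsets of \<open>B\<close> with sides from a countable base suffice.\<close>

lemma weak_borel_generated:
  fixes B :: "('a \<Rightarrow> complex) set"
  assumes B: "countable B" "B \<subseteq> test_functions"
    and span: "\<And>f. f \<in> test_functions \<Longrightarrow> \<exists>t r. finite t \<and> t \<subseteq> B \<and> f = (\<lambda>x. \<Sum>b\<in>t. r b * b x)"
  shows "sets weak_borel = sigma_sets distributions
    {{u\<in>distributions. \<forall>b\<in>K. u b \<in> A b} | K A. finite K \<and> K \<subseteq> B \<and> (\<forall>b. A b \<in> sets (borel :: complex measure))}"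
    (is "_ = sigma_sets _ ?C")
proof
  show "sigma_sets distributions ?C \<subseteq> sets weak_borel"
  proof (subst space_weak_borel[symmetric], rule sets.sigma_sets_subset, rule subsetI)
    fix X assume "X \<in> ?C"
    then obtain K A where X: "X = {u\<in>distributions. \<forall>b\<in>K. u b \<in> A b}" and K: "finite K" "K \<subseteq> B"
      and A: "\<And>b. A b \<in> sets (borel :: complex measure)" by auto
    have "{u\<in>space weak_borel. \<forall>b\<in>K. u b \<in> A b} \<in> sets weak_borel"
    proof (rule sets.sets_Collect_finite_All)
      fix b assume "b \<in> K"
      then have "(\<lambda>u. u b) -` A b \<inter> space weak_borel \<in> sets weak_borel"
        using K(2) B(2) by (intro measurable_sets[OF evaluation_measurable A]) auto
      then show "{u\<in>space weak_borel. u b \<in> A b} \<in> sets weak_borel"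
        by (simp add: vimage_def Int_def conj_commute)
    qed (rule K(1))
    then show "X \<in> sets weak_borel" unfolding X space_weak_borel .
  qed
  obtain D :: "complex set set" where D: "countable D" "topological_basis D"
    using ex_countable_basis by blast
  \<comment> \<open>Countably many cylinders, which will be shown to form a base of the weak
    topology.\<close>
  define G where "G = (\<lambda>(K, A). {u\<in>distributions. \<forall>b\<in>K. u b \<in> A b}) ` (SIGMA K:{K. finite K \<and> K \<subseteq> B}. PiE K (\<lambda>_. D))"
  have countG: "countable G"
    unfolding G_def using B(1) D(1)
    by (intro countable_image countable_SIGMA countable_Collect_finite_subset countable_PiE) auto
  have GC: "G \<subseteq> ?C"
  proof
    fix X assume "X \<in> G"
    then obtain K A where X: "X = {u\<in>distributions. \<forall>b\<in>K. u b \<in> A b}" "finite K" "K \<subseteq> B" "A \<in> PiE K (\<lambda>_. D)"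
      unfolding G_def by auto
    have "X = {u\<in>distributions. \<forall>b\<in>K. u b \<in> (if b \<in> K then A b else UNIV)}" unfolding X(1) by auto
    moreover have "(if b \<in> K then A b else UNIV) \<in> sets (borel :: complex measure)" for b
      using X(4) topological_basis_open[OF D(2)] by (auto simp: PiE_iff)
    ultimately show "X \<in> ?C"
      using X(2,3) by (intro CollectI exI[of _ K] exI[of _ "\<lambda>b. if b \<in> K then A b else UNIV"] conjI allI)
  qed
  have local: "\<exists>X\<in>G. u \<in> X \<and> X \<subseteq> U" if U: "openin weak_topology U" and u: "u \<in> U" for U u
  proof -
    obtain V where V: "openin (product_topology (\<lambda>_. euclidean) test_functions) V" "U = V \<inter> distributions"
      using U unfolding weak_topology_def openin_subtopology by blast
    have ud: "u \<in> distributions" and uV: "u \<in> V" using V(2) u by auto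
    obtain W where "finite {f \<in> test_functions. W f \<noteq> topspace (euclidean :: complex topology)} \<and>
      (\<forall>f\<in>test_functions. openin euclidean (W f)) \<and> u \<in> PiE test_functions W \<and> PiE test_functions W \<subseteq> V"
      using V(1)[unfolded openin_product_topology_alt, THEN bspec, OF uV] by (rule exE)
    then have W: "finite {f \<in> test_functions. W f \<noteq> (UNIV :: complex set)}" "\<And>f. f \<in> test_functions \<Longrightarrow> open (W f)"
      "u \<in> PiE test_functions W" "PiE test_functions W \<subseteq> V" by simp_all
    define J where "J = {f \<in> test_functions. W f \<noteq> UNIV}"
    have finJ: "finite J" and J: "J \<subseteq> test_functions" using W(1) by (auto simp: J_def)
    have "\<forall>f\<in>J. \<exists>t. \<exists>r. finite t \<and> t \<subseteq> B \<and> f = (\<lambda>x. \<Sum>b\<in>t. r b * b x)"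
      by (intro ballI span) (rule subsetD[OF J])
    from bchoice[OF this] obtain t where
      "\<forall>f\<in>J. \<exists>r. finite (t f) \<and> t f \<subseteq> B \<and> f = (\<lambda>x. \<Sum>b\<in>t f. r b * b x)" ..
    from bchoice[OF this] obtain r where
      tr: "\<forall>f\<in>J. finite (t f) \<and> t f \<subseteq> B \<and> f = (\<lambda>x. \<Sum>b\<in>t f. r f b * b x)" ..
    have t: "finite (t f)" "t f \<subseteq> B" "f = (\<lambda>x. \<Sum>b\<in>t f. r f b * b x)" if "f \<in> J" for f
      using bspec[OF tr that] by - (elim conjE, assumption)+
    define K where "K = (\<Union>f\<in>J. t f)"
    have K: "finite K" "K \<subseteq> B" using finJ t by (auto simp: K_def)
    have expand: "v f = (\<Sum>b\<in>t f. r f b * v b)" if v: "v \<in> distributions" and f: "f \<in> J" for v f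
    proof -
      have "v (\<lambda>x. \<Sum>b\<in>t f. r f b * b x) = (\<Sum>b\<in>t f. r f b * v b)"
        using t(1,2)[OF f] B(2) by (intro distributions_sum[OF v]) auto
      then show ?thesis using t(3)[OF f] by simp
    qed
    \<comment> \<open>The finitely many constraints on \<open>u\<close>, rewritten as conditions on
      coordinates in \<open>B\<close> and imposed on arbitrary functions instead of linear
      functionals; as an open set of the full product it contains a box around
      \<open>u\<close>.\<close>
    define Q where "Q = (\<Inter>f\<in>J. {z :: ('a \<Rightarrow> complex) \<Rightarrow> complex. (\<Sum>b\<in>t f. r f b * z b) \<in> W f})"
    have "open Q" unfolding Q_def
    proof (rule open_INT[OF finJ], rule ballI)
      fix f assume f: "f \<in> J"
      have "continuous_on UNIV (\<lambda>z :: ('a \<Rightarrow> complex) \<Rightarrow> complex. \<Sum>b\<in>t f. r f b * z b)"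
        by (intro continuous_on_sum continuous_on_mult continuous_on_const continuous_on_product_coordinates)
      from open_vimage[OF W(2) this] show "open {z :: ('a \<Rightarrow> complex) \<Rightarrow> complex. (\<Sum>b\<in>t f. r f b * z b) \<in> W f}"
        using f J by (auto simp: vimage_def)
    qed
    moreover have "u \<in> Q"
    proof -
      have "(\<Sum>b\<in>t f. r f b * u b) \<in> W f" if f: "f \<in> J" for f
        using PiE_mem[OF W(3) subsetD[OF J f]] expand[OF ud f] by simp
      then show ?thesis by (simp add: Q_def)
    qed
    ultimately obtain X where X: "u \<in> PiE UNIV X" "\<And>b. open (X b)" "PiE UNIV X \<subseteq> Q"
      unfolding open_fun_def openin_product_topology_alt by (metis UNIV_I open_openin)
    have "\<exists>A. A \<in> D \<and> u b \<in> A \<and> A \<subseteq> X b" for b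
      using topological_basisE[OF D(2) X(2)[of b], of "u b"] X(1) by (metis PiE_mem UNIV_I)
    then obtain A where A: "\<And>b. A b \<in> D" "\<And>b. u b \<in> A b" "\<And>b. A b \<subseteq> X b" by metis
    let ?X = "{v\<in>distributions. \<forall>b\<in>K. v b \<in> restrict A K b}"
    have XG: "?X \<in> G" unfolding G_def using K A(1) by (intro image_eqI[of _ _ "(K, restrict A K)"]) auto
    have uX: "u \<in> ?X" using ud A(2) by simp
    have XU: "?X \<subseteq> U"
    proof
      fix v assume "v \<in> ?X"
      then have v: "v \<in> distributions" "\<And>b. b \<in> K \<Longrightarrow> v b \<in> X b" using A(3) by auto
      \<comment> \<open>The box also restricts coordinates outside \<open>K\<close>; filling these
        with the values of \<open>u\<close> keeps the point in the box, and the constraints do not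
        see the change.\<close>
      let ?z = "\<lambda>b. if b \<in> K then v b else u b"
      have "?z \<in> Q" using X(1,3) v(2) by (auto simp: PiE_iff)
      then have "(\<Sum>b\<in>t f. r f b * ?z b) \<in> W f" if "f \<in> J" for f
        using that by (simp add: Q_def)
      moreover have "(\<Sum>b\<in>t f. r f b * ?z b) = v f" if f: "f \<in> J" for f
        unfolding expand[OF v(1) f] using f by (intro sum.cong) (auto simp: K_def)
      ultimately have "v f \<in> W f" if "f \<in> test_functions" for f
        using that by (cases "f \<in> J") (auto simp: J_def)
      then have "v \<in> PiE test_functions W" using v(1) by (auto simp: PiE_iff distributions_def)
      then show "v \<in> U" using W(4) V(2) v(1) by blast
    qed
    show ?thesis
    proof (rule bexI)
      show "u \<in> ?X \<and> ?X \<subseteq> U" using uX XU by (rule conjI)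
    qed (rule XG)
  qed
  show "sets weak_borel \<subseteq> sigma_sets distributions ?C"
    unfolding sets_weak_borel
  proof (rule sigma_sets_mono, rule subsetI)
    fix U :: "(('a \<Rightarrow> complex) \<Rightarrow> complex) set" assume "U \<in> {U. openin weak_topology U}"
    then have U: "openin weak_topology U" by simp
    have "U = \<Union>{X\<in>G. X \<subseteq> U}" using local[OF U] by blast
    moreover have "\<Union>{X\<in>G. X \<subseteq> U} \<in> sigma_sets distributions ?C"
    proof (rule sigma_sets_UNION)
      show "countable {X\<in>G. X \<subseteq> U}" using countG by (rule countable_subset[rotated]) auto
      show "X \<in> sigma_sets distributions ?C" if "X \<in> {X\<in>G. X \<subseteq> U}" for X
        using that GC by (intro sigma_sets.Basic) blast
    qed
    ultimately show "U \<in> sigma_sets distributions ?C" by simp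
  qed
qed


section \<open>Existence and uniqueness of the Gaussian law\<close>

lemma gaussian_law_exists:
  fixes \<psi> :: "('a \<Rightarrow> complex) \<Rightarrow> 'w \<Rightarrow> complex"
  assumes P: "prob_space P" and \<psi>: "gaussian_field P \<psi>"
  shows "\<exists>\<mu>. space \<mu> = distributions \<and> sets \<mu> = sets weak_borel \<and> prob_space \<mu> \<and>
    gaussian_field \<mu> (\<lambda>f u. u f) \<and>
    (\<forall>f\<in>test_functions. \<forall>g\<in>test_functions.
       (\<integral>u. cnj (u f) * u g \<partial>\<mu>) = (\<integral>\<omega>. cnj (\<psi> f \<omega>) * \<psi> g \<omega> \<partial>P))"
proof -
  interpret P: prob_space P by fact
  obtain B :: "('a \<Rightarrow> complex) set" where B: "countable B" "B \<subseteq> test_functions" "\<And>b. b \<in> B \<Longrightarrow> range b \<subseteq> \<real>"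
    "\<And>f. f \<in> test_functions \<Longrightarrow> \<exists>t r. finite t \<and> t \<subseteq> B \<and> f = (\<lambda>x. \<Sum>b\<in>t. r b * b x)"
    "\<And>m. \<exists>u\<in>distributions. \<forall>b\<in>B. u b = m b"
    by (rule test_functions_basis) blast
  have "\<forall>\<omega>. \<exists>u. u \<in> distributions \<and> (\<forall>b\<in>B. u b = \<psi> b \<omega>)"
    using B(5)[unfolded Bex_def] by (rule allI)
  from choice[OF this] obtain U where U: "\<And>\<omega>. U \<omega> \<in> distributions" "\<And>\<omega> b. b \<in> B \<Longrightarrow> U \<omega> b = \<psi> b \<omega>" by blast
  \<comment> \<open>On \<open>B\<close> the map \<open>U\<close> agrees with the field everywhere,
    not merely almost surely, so preimages of the generating cylinders are measurable sets for the
    field itself.\<close>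
  have U_meas: "U \<in> measurable P weak_borel"
  proof (rule measurable_sigma_sets[OF weak_borel_generated[OF B(1,2,4)]])
    show "{{u\<in>distributions. \<forall>b\<in>K. u b \<in> A b} | K A. finite K \<and> K \<subseteq> B \<and> (\<forall>b. A b \<in> sets (borel :: complex measure))} \<subseteq> Pow distributions"
      by auto
    show "U \<in> space P \<rightarrow> distributions" using U(1) by simp
    fix X assume "X \<in> {{u\<in>distributions. \<forall>b\<in>K. u b \<in> A b} | K A. finite K \<and> K \<subseteq> B \<and> (\<forall>b. A b \<in> sets (borel :: complex measure))}"
    then obtain K A where X: "X = {u\<in>distributions. \<forall>b\<in>K. u b \<in> A b}" and K: "finite K" "K \<subseteq> B"
      and A: "\<And>b. A b \<in> sets (borel :: complex measure)" by auto
    have "{\<omega>\<in>space P. \<forall>b\<in>K. \<psi> b \<omega> \<in> A b} \<in> sets P"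
    proof (rule sets.sets_Collect_finite_All)
      fix b assume "b \<in> K"
      then have "\<psi> b -` A b \<inter> space P \<in> sets P"
        using K(2) B(2) by (intro measurable_sets[OF gaussian_field_measurable[OF \<psi>] A]) auto
      then show "{\<omega>\<in>space P. \<psi> b \<omega> \<in> A b} \<in> sets P" by (simp add: vimage_def Int_def conj_commute)
    qed (rule K(1))
    moreover have "U -` X \<inter> space P = {\<omega>\<in>space P. \<forall>b\<in>K. \<psi> b \<omega> \<in> A b}"
      using U K(2) by (auto simp: X subset_iff)
    ultimately show "U -` X \<inter> space P \<in> sets P" by simp
  qed
  \<comment> \<open>Only the finite expansion of this one \<open>f\<close> is involved, hence a
    single null set.\<close>
  have U_eq: "AE \<omega> in P. U \<omega> f = \<psi> f \<omega>" if f: "f \<in> test_functions" for f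
  proof -
    obtain t r where t: "finite t" "t \<subseteq> B" "f = (\<lambda>x. \<Sum>b\<in>t. r b * b x)" using B(4)[OF f] by blast
    have "AE \<omega> in P. \<psi> (\<lambda>x. \<Sum>b\<in>t. r b * b x) \<omega> = (\<Sum>b\<in>t. r b * \<psi> b \<omega>)"
      using t B(2) by (intro gaussian_field_sum[OF \<psi>]) auto
    moreover have "U \<omega> (\<lambda>x. \<Sum>b\<in>t. r b * b x) = (\<Sum>b\<in>t. r b * \<psi> b \<omega>)" for \<omega>
    proof -
      have "U \<omega> (\<lambda>x. \<Sum>b\<in>t. r b * b x) = (\<Sum>b\<in>t. r b * U \<omega> b)"
        using t B(2) by (intro distributions_sum U(1)) auto
      also have "\<dots> = (\<Sum>b\<in>t. r b * \<psi> b \<omega>)" using t(2) U(2) by (intro sum.cong) auto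
      finally show ?thesis .
    qed
    ultimately show ?thesis unfolding t(3) by (simp add: eq_commute)
  qed
  let ?\<mu> = "distr P weak_borel U"
  have ev: "(\<lambda>u. u f) \<in> borel_measurable weak_borel" if "f \<in> test_functions" for f :: "'a \<Rightarrow> complex"
    by (rule evaluation_measurable[OF that])
  have Uf: "(\<lambda>\<omega>. U \<omega> f) \<in> borel_measurable P" if "f \<in> test_functions" for f
    using measurable_compose[OF U_meas ev[OF that]] .
  have "gaussian_field ?\<mu> (\<lambda>f u. u f)"
    unfolding gaussian_field_def
  proof (intro conjI ballI allI impI)
    fix f :: "'a \<Rightarrow> complex" assume f: "f \<in> test_functions"
    show "(\<lambda>u. u f) \<in> borel_measurable ?\<mu>" using ev[OF f] by simp
    show "AE u in ?\<mu>. u (\<lambda>x. a * f x + b * g x) = a * u f + b * u g" if "g \<in> test_functions" for g a b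
      using distributions_lincomb[OF _ f that] by (intro AE_I2) (simp add: space_weak_borel)
    assume real: "range f \<subseteq> \<real>"
    have "AE \<omega> in P. U \<omega> f \<in> \<real>"
      using gaussian_field_real(1)[OF \<psi> f real] U_eq[OF f] by eventually_elim simp
    moreover have "{u \<in> space weak_borel. u f \<in> \<real>} \<in> sets weak_borel"
      using measurable_sets[OF ev[OF f] borel_closed[OF closed_complex_Reals]] by (simp add: vimage_def Int_def conj_commute)
    ultimately show "AE u in ?\<mu>. u f \<in> \<real>" using U_meas by (subst AE_distr_iff) auto
    have "distr ?\<mu> borel (\<lambda>u. Re (u f)) = distr P borel ((\<lambda>u. Re (u f)) \<circ> U)"
      using ev[OF f] U_meas by (intro distr_distr) auto
    also have "\<dots> = distr P borel (\<lambda>\<omega>. Re (\<psi> f \<omega>))"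
      using U_eq[OF f] Uf[OF f] gaussian_field_measurable[OF \<psi> f]
      by (intro distr_cong_AE) (auto simp: comp_def)
    finally show "\<exists>s\<ge>0. distr ?\<mu> borel (\<lambda>u. Re (u f)) = centered_normal s"
      using gaussian_field_real(2)[OF \<psi> f real] by simp
  qed
  moreover have "(\<integral>u. cnj (u f) * u g \<partial>?\<mu>) = (\<integral>\<omega>. cnj (\<psi> f \<omega>) * \<psi> g \<omega> \<partial>P)"
    if f: "f \<in> test_functions" and g: "g \<in> test_functions" for f g
  proof -
    note [measurable] = ev[OF f] ev[OF g] Uf[OF f] Uf[OF g] gaussian_field_measurable[OF \<psi> f] gaussian_field_measurable[OF \<psi> g]
    have "(\<lambda>u. cnj (u f) * u g) \<in> borel_measurable weak_borel" by measurable
    then have "(\<integral>u. cnj (u f) * u g \<partial>?\<mu>) = (\<integral>\<omega>. cnj (U \<omega> f) * U \<omega> g \<partial>P)"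
      by (rule integral_distr[OF U_meas])
    also have "\<dots> = (\<integral>\<omega>. cnj (\<psi> f \<omega>) * \<psi> g \<omega> \<partial>P)"
    proof (rule integral_cong_AE)
      show "AE \<omega> in P. cnj (U \<omega> f) * U \<omega> g = cnj (\<psi> f \<omega>) * \<psi> g \<omega>"
        using U_eq[OF f] U_eq[OF g] by eventually_elim simp
    qed measurable
    finally show ?thesis .
  qed
  moreover have "prob_space ?\<mu>" by (rule P.prob_space_distr[OF U_meas])
  ultimately show ?thesis by (intro exI[of _ ?\<mu>]) (simp add: space_weak_borel)
qed

text \<open>The covariance fixes the variance, and so the law, of the evaluation at each real test
  function. These evaluations are closed under real linear combinations, so
  \<open>joint_law_unique\<close> determines all cylinders over \<open>B\<close>, which are stable
  under intersection and generate the weak Borel sets.\<close>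

lemma gaussian_law_unique:
  fixes \<mu> \<mu>' :: "(('a \<Rightarrow> complex) \<Rightarrow> complex) measure"
  assumes \<mu>: "sets \<mu> = sets weak_borel" "prob_space \<mu>" "gaussian_field \<mu> (\<lambda>f u. u f)"
    and \<mu>': "sets \<mu>' = sets weak_borel" "prob_space \<mu>'" "gaussian_field \<mu>' (\<lambda>f u. u f)"
    and cov: "\<And>f. f \<in> test_functions \<Longrightarrow> (\<integral>u. cnj (u f) * u f \<partial>\<mu>) = (\<integral>u. cnj (u f) * u f \<partial>\<mu>')"
  shows "\<mu> = \<mu>'"
proof -
  interpret M: prob_space \<mu> by fact
  interpret N: prob_space \<mu>' by fact
  have space: "space \<mu> = distributions" "space \<mu>' = distributions"
    using sets_eq_imp_space_eq[OF \<mu>(1)] sets_eq_imp_space_eq[OF \<mu>'(1)] by (simp_all add: space_weak_borel)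
  obtain B :: "('a \<Rightarrow> complex) set" where B: "countable B" "B \<subseteq> test_functions" "\<And>b. b \<in> B \<Longrightarrow> range b \<subseteq> \<real>"
    "\<And>f. f \<in> test_functions \<Longrightarrow> \<exists>t r. finite t \<and> t \<subseteq> B \<and> f = (\<lambda>x. \<Sum>b\<in>t. r b * b x)"
    by (rule test_functions_basis) blast
  \<comment> \<open>Agreement is demanded only on distributions, because a combination of
    evaluations is an evaluation only at linear functionals.\<close>
  define H where "H = {X. \<exists>f\<in>(test_functions :: ('a \<Rightarrow> complex) set). range f \<subseteq> \<real> \<and> (\<forall>u\<in>distributions. X u = Re (u f))}"
  have ev: "(\<lambda>u. u f) \<in> borel_measurable \<mu>" "(\<lambda>u. u f) \<in> borel_measurable \<mu>'" if "f \<in> test_functions" for f :: "'a \<Rightarrow> complex"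
    using evaluation_measurable[OF that] \<mu>(1) \<mu>'(1) by (simp_all cong: measurable_cong_sets)
  have H_meas: "X \<in> borel_measurable \<mu>" if X: "X \<in> H" for X
  proof -
    obtain f where f: "f \<in> test_functions" "\<And>u. u \<in> distributions \<Longrightarrow> X u = Re (u f)" using X unfolding H_def by blast
    have "X \<in> borel_measurable \<mu> \<longleftrightarrow> (\<lambda>u. Re (u f)) \<in> borel_measurable \<mu>"
      by (rule measurable_cong) (simp add: f space)
    then show ?thesis using ev(1)[OF f(1)] by simp
  qed
  have H_lin: "(\<lambda>u. a * X u + b * Y u) \<in> H" if X: "X \<in> H" and Y: "Y \<in> H" for X Y and a b :: real
  proof -
    obtain f where f: "f \<in> test_functions" "range f \<subseteq> \<real>" "\<And>u. u \<in> distributions \<Longrightarrow> X u = Re (u f)" using X unfolding H_def by blast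
    obtain g where g: "g \<in> test_functions" "range g \<subseteq> \<real>" "\<And>u. u \<in> distributions \<Longrightarrow> Y u = Re (u g)" using Y unfolding H_def by blast
    let ?h = "\<lambda>x. complex_of_real a * f x + complex_of_real b * g x"
    have "?h x \<in> \<real>" for x using f(2) g(2) by (intro Reals_add Reals_mult) auto
    then have "range ?h \<subseteq> \<real>" by auto
    moreover have "a * X u + b * Y u = Re (u ?h)" if "u \<in> distributions" for u
      unfolding distributions_lincomb[OF that f(1) g(1)] using f(3)[OF that] g(3)[OF that] by simp
    ultimately show ?thesis unfolding H_def using test_lincomb[OF f(1) g(1)] by blast
  qed
  have H_law: "distr \<mu> borel X = distr \<mu>' borel X" if X: "X \<in> H" for X
  proof -
    obtain f where f: "f \<in> test_functions" "range f \<subseteq> \<real>" "\<And>u. u \<in> distributions \<Longrightarrow> X u = Re (u f)" using X unfolding H_def by blast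
    have law: "distr \<mu> borel X = distr \<mu> borel (\<lambda>u. Re (u f))" "distr \<mu>' borel X = distr \<mu>' borel (\<lambda>u. Re (u f))"
      using f(3) by (intro distr_cong; simp add: space)+
    obtain s where s: "0 \<le> s" "distr \<mu> borel (\<lambda>u. Re (u f)) = centered_normal s" "AE u in \<mu>. u f \<in> \<real>"
      using gaussian_field_real[OF \<mu>(3) f(1,2)] by blast
    obtain s' where s': "0 \<le> s'" "distr \<mu>' borel (\<lambda>u. Re (u f)) = centered_normal s'" "AE u in \<mu>'. u f \<in> \<real>"
      using gaussian_field_real[OF \<mu>'(3) f(1,2)] by blast
    have "complex_of_real (s\<^sup>2) = complex_of_real (s'\<^sup>2)"
      using centered_normal_real_variable(3)[OF ev(1)[OF f(1)] s(3,2,1)]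
        centered_normal_real_variable(3)[OF ev(2)[OF f(1)] s'(3,2,1)] cov[OF f(1)] by simp
    then have "s\<^sup>2 = s'\<^sup>2" by (simp only: of_real_eq_iff)
    then have "s = s'" using s(1) s'(1) by (simp add: power2_eq_iff_nonneg)
    then show ?thesis using law s(2) s'(2) by simp
  qed
  let ?C = "{{u\<in>distributions. \<forall>b\<in>K. u b \<in> A b} | K A. finite K \<and> K \<subseteq> B \<and> (\<forall>b. A b \<in> sets (borel :: complex measure))}"
  have gen: "sets weak_borel = sigma_sets distributions ?C"
    by (rule weak_borel_generated[OF B(1,2,4)])
  have cyl: "measure \<mu> {u\<in>distributions. \<forall>b\<in>K. u b \<in> A b} = measure \<mu>' {u\<in>distributions. \<forall>b\<in>K. u b \<in> A b}"
    if K: "finite K" "K \<subseteq> B" and A: "\<And>b. A b \<in> sets (borel :: complex measure)" for K A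
  proof -
    \<comment> \<open>Basis functions are real, so their values are almost surely real and a complex
      side of a cylinder matters only through its real points.\<close>
    let ?A = "\<lambda>b. complex_of_real -` A b"
    have A': "?A b \<in> sets borel" for b
      using measurable_sets[OF _ A, of complex_of_real borel b] by simp
    let ?X = "{u\<in>distributions. \<forall>b\<in>K. u b \<in> A b}"
    have X: "?X \<in> sets weak_borel"
      unfolding gen using K A by (intro sigma_sets.Basic CollectI exI[of _ K] exI[of _ A]) simp
    have main: "measure Q ?X = (\<integral>u. (\<Prod>b\<in>K. indicator (?A b) (Re (u b))) \<partial>Q)"
      if Q: "sets Q = sets weak_borel" "space Q = distributions" "gaussian_field Q (\<lambda>f u. u f)" for Q
    proof -
      have "AE u in Q. u b = complex_of_real (Re (u b))" if "b \<in> K" for b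
        by (rule AE_real_eq_Re[OF gaussian_field_real(1)[OF Q(3)]]) (use that K(2) B(2,3) in blast)+
      then have "AE u in Q. \<forall>b\<in>K. u b = complex_of_real (Re (u b))"
        using K(1) by (intro AE_finite_allI)
      then have AE: "AE u in Q. indicat_real ?X u = (\<Prod>b\<in>K. indicator (?A b) (Re (u b)))"
      proof (rule AE_mp, intro AE_I2 impI)
        fix u assume u: "u \<in> space Q" and re: "\<forall>b\<in>K. u b = complex_of_real (Re (u b))"
        have mem: "Re (u b) \<in> ?A b \<longleftrightarrow> u b \<in> A b" if "b \<in> K" for b using re that by (simp add: vimage_def)
        show "indicat_real ?X u = (\<Prod>b\<in>K. indicator (?A b) (Re (u b)))"
        proof (cases "\<forall>b\<in>K. u b \<in> A b")
          case True
          then have "(\<Prod>b\<in>K. indicator (?A b) (Re (u b))) = (1::real)" using mem by (intro prod.neutral) simp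
          then show ?thesis using True u Q(2) by simp
        next
          case False
          then obtain b where b: "b \<in> K" "u b \<notin> A b" by blast
          then have "indicat_real (?A b) (Re (u b)) = 0" using mem[OF b(1)] by (simp add: indicator_def)
          then have "(\<Prod>b\<in>K. indicator (?A b) (Re (u b))) = (0::real)"
            using b(1) by (intro prod_zero[OF K(1)] bexI[of _ b])
          then show ?thesis using False by simp
        qed
      qed
      have meas: "(\<lambda>u. Re (u b)) \<in> borel_measurable Q" if "b \<in> K" for b
      proof -
        have "b \<in> test_functions" using that K(2) B(2) by blast
        then have "(\<lambda>u. u b) \<in> borel_measurable Q"
          using evaluation_measurable[of b] Q(1) by (simp cong: measurable_cong_sets)
        then show ?thesis by simp
      qed
      have "?X \<inter> space Q = ?X" using Q(2) by blast
      then have "measure Q ?X = (\<integral>u. indicat_real ?X u \<partial>Q)" by simp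
      also have "\<dots> = (\<integral>u. (\<Prod>b\<in>K. indicator (?A b) (Re (u b))) \<partial>Q)"
      proof (rule integral_cong_AE[OF _ _ AE])
        show "indicat_real ?X \<in> borel_measurable Q" using X Q(1) by simp
        show "(\<lambda>u. \<Prod>b\<in>K. indicat_real (?A b) (Re (u b))) \<in> borel_measurable Q"
          using meas A' by (intro borel_measurable_prod) (auto intro: measurable_compose[OF _ borel_measurable_indicator])
      qed
      finally show ?thesis .
    qed
    have "(\<integral>u. (\<Prod>b\<in>K. indicator (?A b) (Re (u b))) \<partial>\<mu>) = (\<integral>u. (\<Prod>b\<in>K. indicator (?A b) (Re (u b))) \<partial>\<mu>' :: real)"
    proof (rule joint_law_unique[OF \<mu>(2) \<mu>'(2) _ H_meas H_lin H_law K(1), of "\<lambda>b u. Re (u b)" ?A])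
      show "sets \<mu> = sets \<mu>'" using \<mu>(1) \<mu>'(1) by simp
      show "(\<lambda>u. Re (u b)) \<in> H" if "b \<in> K" for b
        using that K(2) B(2,3) unfolding H_def by blast
    qed (use A' in simp_all)
    then show ?thesis using main[OF \<mu>(1) space(1) \<mu>(3)] main[OF \<mu>'(1) space(2) \<mu>'(3)] by simp
  qed
  show ?thesis
  proof (rule measure_eqI_generator_eq[where E = ?C and \<Omega> = distributions and A = "\<lambda>_. distributions"])
    show "Int_stable ?C"
    proof (rule Int_stableI)
      fix X Y assume "X \<in> ?C" "Y \<in> ?C"
      then obtain K A K' A' where X: "X = {u\<in>distributions. \<forall>b\<in>K. u b \<in> A b}" "finite K" "K \<subseteq> B" "\<forall>b. A b \<in> sets (borel :: complex measure)"
        and Y: "Y = {u\<in>distributions. \<forall>b\<in>K'. u b \<in> A' b}" "finite K'" "K' \<subseteq> B" "\<forall>b. A' b \<in> sets (borel :: complex measure)"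
        by auto
      let ?D = "\<lambda>b. (if b \<in> K then A b else UNIV) \<inter> (if b \<in> K' then A' b else UNIV)"
      have "X \<inter> Y = {u\<in>distributions. \<forall>b\<in>K \<union> K'. u b \<in> ?D b}" unfolding X(1) Y(1) by auto
      moreover have "\<forall>b. ?D b \<in> sets (borel :: complex measure)" using X(4) Y(4) by auto
      ultimately show "X \<inter> Y \<in> ?C"
        using X(2,3) Y(2,3) by (intro CollectI exI[of _ "K \<union> K'"] exI[of _ ?D]) simp
    qed
    show "?C \<subseteq> Pow distributions" by auto
    show "emeasure \<mu> X = emeasure \<mu>' X" if "X \<in> ?C" for X
      using that cyl by (auto simp: M.emeasure_eq_measure N.emeasure_eq_measure)
    show "sets \<mu> = sigma_sets distributions ?C" "sets \<mu>' = sigma_sets distributions ?C"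
      using \<mu>(1) \<mu>'(1) gen by simp_all
    have "distributions = {u\<in>distributions. \<forall>b\<in>{}. u b \<in> (\<lambda>_. UNIV) b}" by simp
    then show "range (\<lambda>_. distributions) \<subseteq> ?C" by (auto intro!: exI[of _ "{}"] exI[of _ "\<lambda>_. UNIV"])
    show "(\<Union>i. distributions) = distributions" by simp
    show "emeasure \<mu> distributions \<noteq> \<infinity>" by simp
  qed
qed

end

theorem theorem16:
  fixes \<nu> :: "'a::metric_space measure"
    and T :: "'a set \<Rightarrow> real"
    and R :: "'a set"
    and \<Psi> :: "'a set \<Rightarrow> nat \<Rightarrow> 'a \<Rightarrow> complex"
    and P :: "'w measure"
    and \<phi> :: "('a \<Rightarrow> complex) \<Rightarrow> 'w \<Rightarrow> complex"
  assumes ultrametric: "\<And>x y z :: 'a. dist x y \<le> max (dist x z) (dist y z)"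
    and regular: "regular_balls TYPE('a)"
    and borel_measure: "sets \<nu> = sets borel"
    and basis: "has_countable_basis \<nu>"
    and ball_measure: "\<And>D. is_ball D \<Longrightarrow> 0 < emeasure \<nu> D \<and> emeasure \<nu> D < \<infinity>"
    and T_nonneg: "\<And>I. I \<in> ball_tree \<Longrightarrow> 0 \<le> T I"
    and T_positive: "\<And>I. I \<in> nonminimal \<Longrightarrow> 0 < psd_eigenvalue \<nu> T I"
    and R_vertex: "R \<in> ball_tree"
    and series_T: "(\<lambda>J. T J * (measure \<nu> J - measure \<nu> (pred_vertex J R)))
          summable_on {J\<in>ball_tree. R \<subset> J}"
    and series_eigenvalue: "(\<lambda>I. (inverse (psd_eigenvalue \<nu> T I))\<^sup>2
            * (inverse (measure \<nu> (pred_vertex I R)) - inverse (measure \<nu> I)))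
          summable_on {I\<in>ball_tree. R \<subset> I}"
    and wavelets: "wavelet_basis \<nu> \<Psi>"
    and probability: "prob_space P"
    and noise: "white_noise \<nu> P \<phi>"
  shows "(\<exists>\<psi>. is_solution \<nu> T \<Psi> P \<phi> \<psi>) \<and>
    (\<forall>\<psi>. is_solution \<nu> T \<Psi> P \<phi> \<psi> \<longrightarrow>
       (\<forall>f\<in>test_functions. (\<integral>x. f x \<partial>\<nu>) = 0 \<longrightarrow>
          psd_op \<nu> T f \<in> test_functions \<and> (AE \<omega> in P. \<psi> (psd_op \<nu> T f) \<omega> = \<phi> f \<omega>)) \<and>
       gaussian_field P \<psi> \<and>
       (\<forall>f\<in>test_functions. \<forall>g\<in>test_functions.
          ((\<lambda>I. \<integral>x. (\<integral>x'. complex_of_real (covariation_term \<nu> T I x x') * cnj (f x) * g x' \<partial>\<nu>) \<partial>\<nu>)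
             has_sum (\<integral>\<omega>. cnj (\<psi> f \<omega>) * \<psi> g \<omega> \<partial>P)) nonminimal) \<and>
       (\<forall>x x'. x \<noteq> x' \<longrightarrow>
          ((\<lambda>I. covariation_term \<nu> T I x x') has_sum covariation \<nu> T x x') nonminimal) \<and>
       (\<forall>f\<in>test_functions. \<forall>g\<in>test_functions. (\<forall>x. f x = 0 \<or> g x = 0) \<longrightarrow>
          (\<integral>\<omega>. cnj (\<psi> f \<omega>) * \<psi> g \<omega> \<partial>P) =
          (\<integral>x. (\<integral>x'. complex_of_real (covariation \<nu> T x x') * cnj (f x) * g x' \<partial>\<nu>) \<partial>\<nu>)) \<and>
       (\<exists>!\<mu>. space \<mu> = distributions \<and> sets \<mu> = sets weak_borel \<and> prob_space \<mu> \<and>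
          gaussian_field \<mu> (\<lambda>f u. u f) \<and>
          (\<forall>f\<in>test_functions. \<forall>g\<in>test_functions.
             (\<integral>u. cnj (u f) * u g \<partial>\<mu>) = (\<integral>\<omega>. cnj (\<psi> f \<omega>) * \<psi> g \<omega> \<partial>P))))"
proof -
  \<comment> \<open>In a one-point space every ball has diameter zero, so there would be no vertex
    at all, contrary to \<open>R_vertex\<close>.\<close>
  have "\<exists>x y :: 'a. x \<noteq> y"
  proof (rule ccontr)
    assume "\<not> ?thesis"
    then have one: "\<And>x y :: 'a. x = y" by blast
    obtain I :: "'a set" where "diameter I \<noteq> 0"
      using R_vertex unfolding ball_tree_def by blast
    moreover have "I = {} \<or> (\<exists>x. I = {x})" using one by blast
    ultimately show False by auto
  qed
  then interpret wavelet_noise \<nu> T R \<Psi> P \<phi>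
    using assms by (intro wavelet_noise.intro wavelet_system.intro ultrametric_operator.intro
        regular_ultrametric.intro ultrametric_operator_axioms.intro wavelet_system_axioms.intro
        wavelet_noise_axioms.intro) (auto simp: ball_tree_def)
  show ?thesis
  proof (intro conjI allI impI)
    show "\<exists>\<psi>. is_solution \<nu> T \<Psi> P \<phi> \<psi>" by (rule solution_exists)
  next
    fix \<psi> assume sol: "is_solution \<nu> T \<Psi> P \<phi> \<psi>"
    show "\<forall>f\<in>test_functions. (\<integral>x. f x \<partial>\<nu>) = 0 \<longrightarrow>
        psd_op \<nu> T f \<in> test_functions \<and> (AE \<omega> in P. \<psi> (psd_op \<nu> T f) \<omega> = \<phi> f \<omega>)"
      using solution_equation[OF sol] by blast
    show gauss: "gaussian_field P \<psi>" by (rule solution_gaussian[OF sol])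
    show "\<forall>f\<in>test_functions. \<forall>g\<in>test_functions.
        ((\<lambda>I. \<integral>x. (\<integral>x'. complex_of_real (covariation_term \<nu> T I x x') * cnj (f x) * g x' \<partial>\<nu>) \<partial>\<nu>)
           has_sum (\<integral>\<omega>. cnj (\<psi> f \<omega>) * \<psi> g \<omega> \<partial>P)) nonminimal"
      by (intro ballI solution_covariance[OF sol])
    show "((\<lambda>I. covariation_term \<nu> T I x x') has_sum covariation \<nu> T x x') nonminimal"
      if "x \<noteq> x'" for x x' using that by (rule covariation_has_sum)
    show "\<forall>f\<in>test_functions. \<forall>g\<in>test_functions. (\<forall>x. f x = 0 \<or> g x = 0) \<longrightarrow>
        (\<integral>\<omega>. cnj (\<psi> f \<omega>) * \<psi> g \<omega> \<partial>P) =
        (\<integral>x. (\<integral>x'. complex_of_real (covariation \<nu> T x x') * cnj (f x) * g x' \<partial>\<nu>) \<partial>\<nu>)"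
      by (intro ballI impI solution_covariance_disjoint[OF sol])
    let ?L = "\<lambda>\<mu>. space \<mu> = distributions \<and> sets \<mu> = sets weak_borel \<and> prob_space \<mu> \<and>
      gaussian_field \<mu> (\<lambda>f u. u f) \<and>
      (\<forall>f\<in>test_functions. \<forall>g\<in>test_functions.
         (\<integral>u. cnj (u f) * u g \<partial>\<mu>) = (\<integral>\<omega>. cnj (\<psi> f \<omega>) * \<psi> g \<omega> \<partial>P))"
    show "\<exists>!\<mu>. ?L \<mu>"
    proof (rule ex_ex1I)
      show "\<exists>\<mu>. ?L \<mu>" by (rule gaussian_law_exists[OF probability gauss])
      fix \<mu> \<mu>' assume L: "?L \<mu>" "?L \<mu>'"
      show "\<mu> = \<mu>'" by (rule gaussian_law_unique) (use L in simp_all)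
    qed
  qed
qed

end
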